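(* Let the infinite sequence $\{(x_k,u_k)\}$ be generated by the method B-STEP-DCA described in the context, let the sequence $\{x_k\}$ be bounded in $W^{1,r}([0,T];\mathbb R^n)$ for some $1<r\le\infty$, and let $\varphi(x_k,u_k)\to0$ as $k\to\infty$. Suppose also that some subsequence of controls $\{u_{k_l}\}$ is bounded in $L^\infty([0,T];\mathbb R^m)$ and converges in $L^1([0,T];\mathbb R^m)$ to a function $u_*\in L^\infty([0,T];\mathbb R^m)$. Then the corresponding subsequence of trajectories $\{x_{k_l}\}$ is relatively compact in $W^{1,1}([0,T];\mathbb R^n)$, its limit points $x_*$ belong to $W^{1,\infty}([0,T];\mathbb R^n)$, and all pairs $(x_*,u_* )$ are feasible for the problem $(\mathcal P)$. If, in addition, the initial condition $x(0)$ is fixed (that is, there is $x^0\in\mathbb R^n$ such that $x(0)=x^0$ for all feasible $(x,u)$ of $(\mathcal P)$; e.g. $X_0=\{(x,u)\in X\mid x(0)=x^0\}$), then the subsequence $\{x_{k_l}\}$ converges in $W^{1,1}([0,T];\mathbb R^n)$.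
   Context: Notation. $T>0$; $|\cdot|$ is the Euclidean norm; $\mathbb N=\{0,1,2,\dots\}$; $\|\cdot\|_s$ is the $L^s$ norm on $[0,T]$, and $\|(x,u)\|_2^2=\int_0^T(|x(t)|^2+|u(t)|^2)\,dt$; $W^{1,s}([0,T];\mathbb R^n)$ is the space of absolutely continuous $x$ with $\dot x\in L^s$, normed by $\|x\|_{1,s}=\|x\|_s+\|\dot x\|_s$. $X=W^{1,\infty}([0,T];\mathbb R^n)\times L^\infty([0,T];\mathbb R^m)$ with norm $\|x\|_{1,\infty}+\|u\|_\infty$; $Y=W^{1,1}([0,T];\mathbb R^n)\times L^1([0,T];\mathbb R^m)$ with norm $\|x\|_{1,1}+\|u\|_1$. $X_0\subseteq X$ is a convex set closed in $X$ with respect to the topology of $Y$. A limit point of a sequence is the limit of some subsequence. $\partial$ is the convex subdifferential, $\partial_{x,u}$ the one with respect to $(x,u)$. A point $z\in X_0$ is $\varepsilon$-optimal for minimising $f$ over $X_0$ if $f(z)\le\inf_{X_0}f+\varepsilon$. Problem $(\mathcal P)$: minimise $J(x,u)=\int_0^TF_0(x(t),u(t),t)\,dt+f_0(x(0),x(T))$ over $(x,u)\in X_0$ subject to $\dot x(t)=F(x(t),u(t),t)$ for a.e. $t$; $f_i(x(0),x(T))\le0$, $i\in\mathcal I=\{1,\dots,\ell_I\}$; $f_j(x(0),x(T))=0$, $j\in\mathcal E=\{\ell_I+1,\dots,\ell_E\}$; $\Xi_s(x(t),u(t),t)\le0$ for a.e. $t$, $s\in\mathcal M=\{1,\dots,\ell_M\}$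 (index sets may be empty). Here $F_0=G_0-H_0$, $F=G-H$ ($\mathbb R^n$-valued, components $F_i=G_i-H_i$, $i=1,\dots,n$), $f_i=g_i-h_i$ on $\mathbb R^{2n}$, $\Xi_s=p_s-q_s$, where $G_i,H_i$ ($0\le i\le n$), $p_s,q_s$ are real-valued functions of $(x,u,t)\in\mathbb R^n\times\mathbb R^m\times[0,T]$ convex in $(x,u)$, and $g_i,h_i$ are real-valued convex functions (possibly nonsmooth). Data assumptions. $G_i,H_i$ ($0\le i\le n$), $p_s,q_s$ are Carathéodory (continuous in $(x,u)$ for a.e. $t$, measurable in $t$); for every $(x,u)\in X$ the multifunctions $t\mapsto\partial_{x,u}G_i(x(t),u(t),t)$, and likewise for $H_i,p_s,q_s$, are measurable; for every $R>0$ there is $\gamma_R>0$ such that for a.e. $t$ and all $(x,u)$ with $|x|+|u|\le R$ the absolute values of all these functions at $(x,u,t)$, and the norms of all their subgradients in $(x,u)$ there, are at most $\gamma_R$. Penalty function. $\Phi_c=J+c\varphi$, $\varphi(x,u)=\sum_{i=1}^n\int_0^T|\dot x_i(t)-F_i(x(t),u(t),t)|\,dt+\sum_{i\in\mathcal I}\max\{0,f_i(x(0),x(T))\}+\sum_{j\in\mathcal E}|f_j(x(0),x(T))|+\sum_{s\in\mathcal M}\int_0^T\max\{0,\Xi_s(x(t),u(t),t)\}\,dt$. Convex majorants. A collection of subgradients at $(\bar x,\bar u)\in X$ is $V=(V_0,\dots,V_n,W_1,\dots,W_n,v_0,\dots,v_{\ell_E},w_{\ell_I+1},\dots,w_{\ell_E},z_1,\dots,z_{\ell_M})$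 with $V_i,W_i,z_s$ measurable on $[0,T]$ and, for a.e. $t$, $V_i(t)\in\partial_{x,u}H_i(\bar x(t),\bar u(t),t)$, $W_i(t)\in\partial_{x,u}G_i(\bar x(t),\bar u(t),t)$, $z_s(t)\in\partial_{x,u}q_s(\bar x(t),\bar u(t),t)$, $v_i\in\partial h_i(\bar x(0),\bar x(T))$, $w_j\in\partial g_j(\bar x(0),\bar x(T))$. With $\Delta(t)=(x(t)-\bar x(t),u(t)-\bar u(t))$, $\Delta_b=(x(0)-\bar x(0),x(T)-\bar x(T))$, put $\Gamma(x,u;\bar x,\bar u;V)=\sum_{i=1}^n\int_0^T\max\{\dot x_i+H_i(x,u,t)-G_i(\bar x,\bar u,t)-\langle W_i,\Delta\rangle,\,-\dot x_i+G_i(x,u,t)-H_i(\bar x,\bar u,t)-\langle V_i,\Delta\rangle\}\,dt+\sum_{i\in\mathcal I}\max\{0,g_i(x(0),x(T))-h_i(\bar x(0),\bar x(T))-\langle v_i,\Delta_b\rangle\}+\sum_{j\in\mathcal E}\max\{g_j(x(0),x(T))-h_j(\bar x(0),\bar x(T))-\langle v_j,\Delta_b\rangle,\,h_j(x(0),x(T))-g_j(\bar x(0),\bar x(T))-\langle w_j,\Delta_b\rangle\}+\sum_{s\in\mathcal M}\int_0^T\max\{0,p_s(x,u,t)-q_s(\bar x,\bar u,t)-\langle z_s,\Delta\rangle\}\,dt$ (functions under integrals evaluated at $t$), $\omega(x,u;V)=\int_0^T(G_0(x(t),u(t),t)-\langle V_0(t),(x(t),u(t))\rangle)\,dt+g_0(x(0),x(T))-\langle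 v_0,(x(0),x(T))\rangle$, and $Q_c(x,u;\bar x,\bar u;V)=\omega(x,u;V)+c\,\Gamma(x,u;\bar x,\bar u;V)$. Method B-STEP-DCA. Choose $(x_0,u_0)\in X_0$, $c_0>0$, $\eta_1,\eta_2,\zeta,\sigma\in(0,1)$, $\varepsilon_\varphi,\varepsilon_{feas}>0$, $\{\varepsilon_k\}\subset(0,\infty)$. For iteration $k=0,1,\dots$: pick a collection of subgradients $V_k$ at $(x_k,u_k)$; write $\Gamma_k(\cdot)=\Gamma(\cdot;x_k,u_k;V_k)$, $\omega_k(\cdot)=\omega(\cdot;V_k)$, $Q_{c,k}=\omega_k+c\Gamma_k$; $(x_k[c],u_k[c])$ denotes a computed $\varepsilon_k$-optimal solution of $\min_{X_0}Q_{c,k}$. Step 1: $c_+=c_k$; compute $(x_k[c_+],u_k[c_+])$; if $\Gamma_k(x_k[c_+],u_k[c_+])\le\varepsilon_\varphi$ go to Step 4, else to Step 2. Step 2: compute an $\varepsilon_k$-optimal solution $(\widehat x_k,\widehat u_k)$ of $\min_{X_0}\Gamma_k$. If $\Gamma_k(\widehat x_k,\widehat u_k)<\Gamma_k(x_k,u_k)$ go to Step 3. Otherwise, while $\Gamma_k(x_k[c_+],u_k[c_+])\le\Gamma_k(x_k,u_k)+\varepsilon_{feas}$ fails, increase $c_+$ and recompute $(x_k[c_+],u_k[c_+])$; then go to Step 4. Step 3: while $\Gamma_k(x_k[c_+],u_k[c_+])-\Gamma_k(x_k,u_k)\le\eta_1(\Gamma_k(\widehat x_k,\widehat u_k)-\Gamma_k(x_k,u_k))$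 fails, increase $c_+$ and recompute; then go to Step 4. Step 4: put $c_{k+1}=c_+$; while $Q_{c_{k+1},k}(x_k[c_{k+1}],u_k[c_{k+1}])-Q_{c_{k+1},k}(x_k,u_k)\le c_{k+1}\eta_2(\Gamma_k(x_k[c_{k+1}],u_k[c_{k+1}])-\Gamma_k(x_k,u_k))$ fails, increase $c_{k+1}$ and recompute. Step 5: with $d_k=(x_k[c_{k+1}]-x_k,u_k[c_{k+1}]-u_k)$, choose $\nu_k>0$, $\overline\alpha_k\ge0$, find the smallest $j_k\in\mathbb N$ such that, for $\alpha_k=\zeta^{j_k}\overline\alpha_k$, $\Phi_{c_{k+1}}((x_k[c_{k+1}],u_k[c_{k+1}])+\alpha_kd_k)-\Phi_{c_{k+1}}(x_k[c_{k+1}],u_k[c_{k+1}])\le-\sigma\alpha_k^2\|d_k\|_2^2+\nu_k$; set $(x_{k+1},u_{k+1})=(x_k[c_{k+1}],u_k[c_{k+1}])+\alpha_kd_k$. (No stopping criterion is applied, so the sequence is infinite.) Standing assumptions on the method. All computed points $(x_k[c],u_k[c])$ satisfy $Q_{c,k}(x_k[c],u_k[c])\le Q_{c,k}(x_k,u_k)$. The trial step $\overline\alpha_k$ is such that $(x_k[c_{k+1}],u_k[c_{k+1}])+\zeta^j\overline\alpha_kd_k\in X_0$ for all $j\in\mathbb N$ (hence all $(x_k,u_k)\in X_0$). $\Phi_{c_0}$ is bounded below on $X_0$. There is $\varkappa>0$ such that whenever $c_+$ or $c_{k+1}$ is increased in Steps 2, 3, 4, it is increased by at least $\varkappa$. 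*)

theory Defs
  imports "HOL-Analysis.Analysis" "HOL-Probability.Essential_Supremum"
begin

section \<open>Lebesgue and Sobolev spaces on an interval\<close>

text \<open>Elements of the function spaces on \<open>[0,T]\<close> are represented by functions on the whole real
  line whose values outside \<open>[0,T]\<close> are irrelevant; the norms below do not depend on them.\<close>

abbreviation leb :: "real \<Rightarrow> real measure" where
  "leb T \<equiv> lebesgue_on {0..T}"

definition Lspace :: "real \<Rightarrow> ennreal \<Rightarrow> (real \<Rightarrow> 'a::euclidean_space) set" where
  "Lspace T s = {f. f \<in> borel_measurable (leb T) \<and>
     (if s = \<infinity> then esssup (leb T) (\<lambda>t. ennreal (norm (f t))) < \<infinity>
      else integrable (leb T) (\<lambda>t. norm (f t) powr enn2real s))}"

definition Lnorm :: "real \<Rightarrow> ennreal \<Rightarrow> (real \<Rightarrow> 'a::euclidean_space) \<Rightarrow> real" where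
  "Lnorm T s f =
     (if s = \<infinity> then enn2real (esssup (leb T) (\<lambda>t. ennreal (norm (f t))))
      else (LINT t|leb T. norm (f t) powr enn2real s) powr (1 / enn2real s))"

definition abs_continuous_on :: "real \<Rightarrow> real \<Rightarrow> (real \<Rightarrow> 'a::euclidean_space) \<Rightarrow> bool" where
  "abs_continuous_on a b x \<longleftrightarrow>
     (\<forall>e>0. \<exists>d>0. \<forall>(N::nat) (l::nat \<Rightarrow> real) (r::nat \<Rightarrow> real).
        (\<forall>i<N. a \<le> l i \<and> l i \<le> r i \<and> r i \<le> b) \<and>
        disjoint_family_on (\<lambda>i. {l i<..<r i}) {..<N} \<and>
        (\<Sum>i<N. r i - l i) < d
        \<longrightarrow> (\<Sum>i<N. norm (x (r i) - x (l i))) < e)"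

definition dot :: "real \<Rightarrow> (real \<Rightarrow> 'a::euclidean_space) \<Rightarrow> real \<Rightarrow> 'a" where
  "dot T x t = vector_derivative x (at t within {0..T})"

text \<open>The second conjunct says that the pointwise derivative exists almost everywhere. It is a
  consequence of absolute continuity and is spelled out so that \<^const>\<open>dot\<close> is visibly the
  derivative.\<close>

definition W1 :: "real \<Rightarrow> ennreal \<Rightarrow> (real \<Rightarrow> 'a::euclidean_space) set" where
  "W1 T s = {x. abs_continuous_on 0 T x \<and>
     (AE t in leb T. x differentiable (at t within {0..T})) \<and>
     dot T x \<in> Lspace T s}"

definition W1norm :: "real \<Rightarrow> ennreal \<Rightarrow> (real \<Rightarrow> 'a::euclidean_space) \<Rightarrow> real" where
  "W1norm T s x = Lnorm T s x + Lnorm T s (dot T x)"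

text \<open>For the norm topology the representatives are made unique by restricting to \<open>[0,T]\<close>.\<close>

definition W1_metric_space :: "real \<Rightarrow> ennreal \<Rightarrow> (real \<Rightarrow> 'a::euclidean_space) set" where
  "W1_metric_space T s = W1 T s \<inter> extensional {0..T}"

definition W1_topology :: "real \<Rightarrow> ennreal \<Rightarrow> (real \<Rightarrow> 'a::euclidean_space) topology" where
  "W1_topology T s =
     Metric_space.mtopology (W1_metric_space T s) (\<lambda>x y. W1norm T s (\<lambda>t. x t - y t))"

text \<open>The facts up to \<open>Metric_space_W1_1\<close> show that \<open>W1_topology T 1\<close> is the topology of a genuine
  metric, so that \<^const>\<open>Metric_space.mtopology\<close> is used within its locale assumptions.\<close>

lemma abs_continuous_on_continuous:
  assumes "abs_continuous_on a b x" shows "continuous_on {a..b} x"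
  unfolding continuous_on_iff
proof (intro ballI allI impI)
  fix s e :: real assume s: "s \<in> {a..b}" and e: "e > 0"
  obtain d where d: "d > 0" "\<And>(N::nat) l r. (\<forall>i<N. a \<le> l i \<and> l i \<le> r i \<and> r i \<le> b) \<and>
        disjoint_family_on (\<lambda>i. {l i<..<r i}) {..<N} \<and> (\<Sum>i<N. r i - l i) < d
        \<longrightarrow> (\<Sum>i<N. norm (x (r i) - x (l i))) < e"
    using assms e unfolding abs_continuous_on_def by meson
  have "dist (x t) (x s) < e" if t: "t \<in> {a..b}" "dist t s < d" for t
    using d(2)[of 1 "\<lambda>_. min s t" "\<lambda>_. max s t"] s t
    by (cases "s \<le> t") (simp_all add: disjoint_family_on_def dist_norm norm_minus_commute)
  then show "\<exists>d>0. \<forall>t\<in>{a..b}. dist t s < d \<longrightarrow> dist (x t) (x s) < e" using d(1) by blast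
qed

lemma Lnorm_1: "Lnorm T 1 f = (LINT t|leb T. norm (f t))"
  unfolding Lnorm_def by simp

lemma AE_dot_diff:
  assumes "T > 0" "x \<in> W1 T s" "y \<in> W1 T s"
  shows "AE t in leb T. dot T (\<lambda>t. x t - y t) t = dot T x t - dot T y t"
proof -
  have "AE t in leb T. x differentiable (at t within {0..T})"
       "AE t in leb T. y differentiable (at t within {0..T})"
    using assms unfolding W1_def by auto
  moreover have "AE t in leb T. t \<in> {0..T}" by (rule AE_I2) simp
  ultimately show ?thesis
  proof eventually_elim
    case (elim t)
    have "((\<lambda>t. x t - y t) has_vector_derivative (dot T x t - dot T y t)) (at t within {0..T})"
      using elim unfolding dot_def
      by (intro has_vector_derivative_diff) (auto simp: vector_derivative_works[symmetric])
    then show ?case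
      using vector_derivative_within_closed_interval[OF \<open>T > 0\<close> elim(3)] by (simp add: dot_def)
  qed
qed

lemma W1_integrable:
  assumes "x \<in> W1 T 1"
  shows "integrable (leb T) x" "integrable (leb T) (dot T x)"
proof -
  have "continuous_on {0..T} x" using assms abs_continuous_on_continuous unfolding W1_def by auto
  then show "integrable (leb T) x"
    by (rule continuous_imp_integrable_real)
  have m: "dot T x \<in> borel_measurable (leb T)" and i: "integrable (leb T) (\<lambda>t. norm (dot T x t))"
    using assms unfolding W1_def Lspace_def by simp_all
  show "integrable (leb T) (dot T x)"
    by (rule integrable_norm_cancel[OF i m])
qed

lemma W1norm_diff:
  assumes "T > 0" "x \<in> W1 T 1" "y \<in> W1 T 1"
  shows "W1norm T 1 (\<lambda>t. x t - y t) =
    (LINT t|leb T. norm (x t - y t)) + (LINT t|leb T. norm (dot T x t - dot T y t))"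
proof -
  have m: "dot T x \<in> borel_measurable (leb T)" "dot T y \<in> borel_measurable (leb T)"
    using assms unfolding W1_def Lspace_def by auto
  have ae: "AE t in leb T. dot T x t - dot T y t = dot T (\<lambda>t. x t - y t) t"
    using AE_dot_diff[OF assms] by eventually_elim simp
  have b: "(\<lambda>t. if t \<in> {0..T} then dot T x t - dot T y t else 0) \<in> borel_measurable lebesgue"
    using m by (intro borel_measurable_if_I borel_measurable_diff) auto
  have a: "AE t in lebesgue. (if t \<in> {0..T} then dot T x t - dot T y t else 0) =
      (if t \<in> {0..T} then dot T (\<lambda>t. x t - y t) t else 0)"
    using ae by (auto simp: AE_restrict_space_iff elim!: eventually_mono)
  have m': "dot T (\<lambda>t. x t - y t) \<in> borel_measurable (leb T)"
    by (rule borel_measurable_if_D[OF borel_measurable_AE[OF b a]])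
  have "(LINT t|leb T. norm (dot T (\<lambda>t. x t - y t) t)) =
      (LINT t|leb T. norm (dot T x t - dot T y t))"
  proof (rule integral_cong_AE)
    show "(\<lambda>t. norm (dot T (\<lambda>t. x t - y t) t)) \<in> borel_measurable (leb T)"
      by (rule measurable_compose[OF m' borel_measurable_norm])
    show "(\<lambda>t. norm (dot T x t - dot T y t)) \<in> borel_measurable (leb T)"
      by (rule measurable_compose[OF borel_measurable_diff[OF m] borel_measurable_norm])
    show "AE t in leb T. norm (dot T (\<lambda>t. x t - y t) t) = norm (dot T x t - dot T y t)"
      using ae by eventually_elim simp
  qed
  then show ?thesis unfolding W1norm_def Lnorm_1 by simp
qed

lemma Metric_space_W1_1:
  assumes T: "T > 0"
  shows "Metric_space (W1_metric_space T 1) (\<lambda>x y. W1norm T 1 (\<lambda>t. x t - y t))"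
proof
  show "0 \<le> W1norm T 1 (\<lambda>t. x t - y t)" for x y :: "real \<Rightarrow> 'a"
    unfolding W1norm_def Lnorm_1 by simp
  show "W1norm T 1 (\<lambda>t. x t - y t) = W1norm T 1 (\<lambda>t. y t - x t)" for x y :: "real \<Rightarrow> 'a"
  proof -
    have "norm (dot T (\<lambda>t. x t - y t) t) = norm (dot T (\<lambda>t. y t - x t) t)" if t: "t \<in> {0..T}" for t
    proof -
      have neg: "((\<lambda>t. y t - x t) has_vector_derivative - D) (at t within {0..T})"
        if "((\<lambda>t. x t - y t) has_vector_derivative D) (at t within {0..T})"
        for D and x y :: "real \<Rightarrow> 'a"
        using has_vector_derivative_minus[OF that] by simp
      show ?thesis
      proof (cases "\<exists>D. ((\<lambda>t. x t - y t) has_vector_derivative D) (at t within {0..T})")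
        case True
        then obtain D where D: "((\<lambda>t. x t - y t) has_vector_derivative D) (at t within {0..T})"
          by blast
        have "dot T (\<lambda>t. x t - y t) t = D" "dot T (\<lambda>t. y t - x t) t = - D"
          using vector_derivative_within_closed_interval[OF T t] D neg[OF D] by (simp_all add: dot_def)
        then show ?thesis by simp
      next
        case False
        then have "\<not> (\<exists>D. ((\<lambda>t. y t - x t) has_vector_derivative D) (at t within {0..T}))"
          using neg by blast
        with False show ?thesis by (simp add: dot_def vector_derivative_def)
      qed
    qed
    then show ?thesis
      unfolding W1norm_def Lnorm_1
      by (intro arg_cong2[where f="(+)"] Bochner_Integration.integral_cong)
         (auto simp: norm_minus_commute)
  qed
next
  fix x y :: "real \<Rightarrow> 'a"
  assume "x \<in> W1_metric_space T 1" "y \<in> W1_metric_space T 1"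
  then have xy: "x \<in> W1 T 1" "y \<in> W1 T 1" "x \<in> extensional {0..T}" "y \<in> extensional {0..T}"
    unfolding W1_metric_space_def by auto
  have cont: "continuous_on {0..T} (\<lambda>t. norm (x t - y t))"
    using xy(1,2) abs_continuous_on_continuous unfolding W1_def by (auto intro!: continuous_intros)
  show "W1norm T 1 (\<lambda>t. x t - y t) = 0 \<longleftrightarrow> x = y"
  proof
    assume "W1norm T 1 (\<lambda>t. x t - y t) = 0"
    moreover have "0 \<le> (LINT t|leb T. norm (x t - y t))"
      "0 \<le> (LINT t|leb T. norm (dot T x t - dot T y t))" by simp_all
    ultimately have "(LINT t|leb T. norm (x t - y t)) = 0"
      using W1norm_diff[OF T xy(1,2)] by linarith
    then have "\<forall>t\<in>{0..T}. norm (x t - y t) = 0"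
      using integralL_eq_0_iff[OF cont T] by simp
    then show "x = y" using xy(3,4) by (intro extensionalityI[of x "{0..T}"]) auto
  qed (use W1norm_diff[OF T xy(1,2)] in simp)
next
  fix x y z :: "real \<Rightarrow> 'a"
  assume "x \<in> W1_metric_space T 1" "y \<in> W1_metric_space T 1" "z \<in> W1_metric_space T 1"
  then have xyz: "x \<in> W1 T 1" "y \<in> W1 T 1" "z \<in> W1 T 1" unfolding W1_metric_space_def by auto
  have tri: "(LINT t|leb T. norm (f t - h t)) \<le>
      (LINT t|leb T. norm (f t - g t)) + (LINT t|leb T. norm (g t - h t))"
    if "integrable (leb T) f" "integrable (leb T) g" "integrable (leb T) h"
    for f g h :: "real \<Rightarrow> 'a"
  proof -
    have "(LINT t|leb T. norm (f t - h t)) \<le> (LINT t|leb T. norm (f t - g t) + norm (g t - h t))"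
      using that by (intro integral_mono) (auto intro: norm_diff_triangle_le)
    then show ?thesis using that by simp
  qed
  show "W1norm T 1 (\<lambda>t. x t - z t) \<le> W1norm T 1 (\<lambda>t. x t - y t) + W1norm T 1 (\<lambda>t. y t - z t)"
    using tri[of x y z] tri[of "dot T x" "dot T y" "dot T z"] xyz
    by (simp add: W1norm_diff[OF T] W1_integrable)
qed

definition relatively_compact_W1 ::
    "real \<Rightarrow> ennreal \<Rightarrow> (real \<Rightarrow> 'a::euclidean_space) set \<Rightarrow> bool" where
  "relatively_compact_W1 T s S \<longleftrightarrow> S \<subseteq> W1 T s \<and>
     compactin (W1_topology T s) (W1_topology T s closure_of ((\<lambda>x. restrict x {0..T}) ` S))"

definition W1_converges ::
    "real \<Rightarrow> ennreal \<Rightarrow> (nat \<Rightarrow> real \<Rightarrow> 'a::euclidean_space) \<Rightarrow> (real \<Rightarrow> 'a) \<Rightarrow> bool" where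
  "W1_converges T s x y \<longleftrightarrow> (\<forall>k. x k \<in> W1 T s) \<and> y \<in> W1 T s \<and>
     (\<lambda>k. W1norm T s (\<lambda>t. x k t - y t)) \<longlonglongrightarrow> 0"

definition limit_point_W1 ::
    "real \<Rightarrow> ennreal \<Rightarrow> (nat \<Rightarrow> real \<Rightarrow> 'a::euclidean_space) \<Rightarrow> (real \<Rightarrow> 'a) \<Rightarrow> bool" where
  "limit_point_W1 T s x y \<longleftrightarrow> (\<exists>\<tau>::nat \<Rightarrow> nat. strict_mono \<tau> \<and> W1_converges T s (x \<circ> \<tau>) y)"


section \<open>Processes\<close>

type_synonym ('n, 'm) process = "(real \<Rightarrow> real^'n) \<times> (real \<Rightarrow> real^'m)"

definition ev :: "('n::finite, 'm::finite) process \<Rightarrow> real \<Rightarrow> (real^'n) \<times> (real^'m)" where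
  "ev z t = (fst z t, snd z t)"

definition ends :: "real \<Rightarrow> ('n::finite, 'm::finite) process \<Rightarrow> (real^'n) \<times> (real^'n)" where
  "ends T z = (fst z 0, fst z T)"

definition lincomb :: "real \<Rightarrow> ('n::finite, 'm::finite) process \<Rightarrow> real \<Rightarrow> ('n, 'm) process
    \<Rightarrow> ('n, 'm) process" where
  "lincomb a z b w =
     ((\<lambda>t. a *\<^sub>R fst z t + b *\<^sub>R fst w t), (\<lambda>t. a *\<^sub>R snd z t + b *\<^sub>R snd w t))"

abbreviation pdiff :: "('n::finite, 'm::finite) process \<Rightarrow> ('n, 'm) process \<Rightarrow> ('n, 'm) process"
  where "pdiff z w \<equiv> lincomb 1 z (- 1) w"

definition Xspace :: "real \<Rightarrow> ('n::finite, 'm::finite) process set" where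
  "Xspace T = W1 T \<infinity> \<times> Lspace T \<infinity>"

definition Ynorm :: "real \<Rightarrow> ('n::finite, 'm::finite) process \<Rightarrow> real" where
  "Ynorm T z = W1norm T 1 (fst z) + Lnorm T 1 (snd z)"

definition L2norm_sq :: "real \<Rightarrow> ('n::finite, 'm::finite) process \<Rightarrow> real" where
  "L2norm_sq T z = (LINT t|leb T. (norm (fst z t))\<^sup>2 + (norm (snd z t))\<^sup>2)"


section \<open>Convex analysis and multifunctions\<close>

definition subdifferential :: "('a::euclidean_space \<Rightarrow> real) \<Rightarrow> 'a \<Rightarrow> 'a set" where
  "subdifferential f a = {v. \<forall>y. f a + inner v (y - a) \<le> f y}"

definition measurable_multifunction ::
    "'t measure \<Rightarrow> ('t \<Rightarrow> 'a::topological_space set) \<Rightarrow> bool" where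
  "measurable_multifunction M S \<longleftrightarrow>
     (\<forall>U. open U \<longrightarrow> {t \<in> space M. S t \<inter> U \<noteq> {}} \<in> sets M)"

text \<open>The infimum is taken in the extended reals, so that no point is \<open>\<epsilon>\<close>-optimal when the
  objective is unbounded below.\<close>

definition eps_optimal :: "real \<Rightarrow> ('a \<Rightarrow> real) \<Rightarrow> 'a set \<Rightarrow> 'a \<Rightarrow> bool" where
  "eps_optimal e f S z \<longleftrightarrow> z \<in> S \<and> ereal (f z) \<le> (INF w\<in>S. ereal (f w)) + ereal e"


section \<open>The optimal control problem\<close>

record ('n, 'm) dc_problem =
  hor :: real
  ell_I :: nat
  ell_E :: nat
  ell_M :: nat
  dom_X0 :: "('n, 'm) process set"
  G0_of :: "(real^'n) \<times> (real^'m) \<Rightarrow> real \<Rightarrow> real"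
  H0_of :: "(real^'n) \<times> (real^'m) \<Rightarrow> real \<Rightarrow> real"
  G_of :: "'n \<Rightarrow> (real^'n) \<times> (real^'m) \<Rightarrow> real \<Rightarrow> real"
  H_of :: "'n \<Rightarrow> (real^'n) \<times> (real^'m) \<Rightarrow> real \<Rightarrow> real"
  g_of :: "nat \<Rightarrow> (real^'n) \<times> (real^'n) \<Rightarrow> real"
  h_of :: "nat \<Rightarrow> (real^'n) \<times> (real^'n) \<Rightarrow> real"
  p_of :: "nat \<Rightarrow> (real^'n) \<times> (real^'m) \<Rightarrow> real \<Rightarrow> real"
  q_of :: "nat \<Rightarrow> (real^'n) \<times> (real^'m) \<Rightarrow> real \<Rightarrow> real"

definition ineq_idx :: "('n::finite, 'm::finite) dc_problem \<Rightarrow> nat set" where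
  "ineq_idx P = {1..ell_I P}"

definition eq_idx :: "('n::finite, 'm::finite) dc_problem \<Rightarrow> nat set" where
  "eq_idx P = {ell_I P + 1..ell_E P}"

definition mixed_idx :: "('n::finite, 'm::finite) dc_problem \<Rightarrow> nat set" where
  "mixed_idx P = {1..ell_M P}"

definition F0_of :: "('n::finite, 'm::finite) dc_problem \<Rightarrow> (real^'n) \<times> (real^'m) \<Rightarrow> real \<Rightarrow> real"
  where "F0_of P y t = G0_of P y t - H0_of P y t"

definition F_of :: "('n::finite, 'm::finite) dc_problem \<Rightarrow> (real^'n) \<times> (real^'m) \<Rightarrow> real \<Rightarrow> real^'n"
  where "F_of P y t = (\<chi> i. G_of P i y t - H_of P i y t)"

definition f_of :: "('n::finite, 'm::finite) dc_problem \<Rightarrow> nat \<Rightarrow> (real^'n) \<times> (real^'n) \<Rightarrow> real"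
  where "f_of P i b = g_of P i b - h_of P i b"

definition Xi_of ::
    "('n::finite, 'm::finite) dc_problem \<Rightarrow> nat \<Rightarrow> (real^'n) \<times> (real^'m) \<Rightarrow> real \<Rightarrow> real"
  where "Xi_of P s y t = p_of P s y t - q_of P s y t"

definition integrands ::
    "('n::finite, 'm::finite) dc_problem \<Rightarrow> ((real^'n) \<times> (real^'m) \<Rightarrow> real \<Rightarrow> real) set" where
  "integrands P = {G0_of P, H0_of P} \<union> range (G_of P) \<union> range (H_of P) \<union>
     p_of P ` mixed_idx P \<union> q_of P ` mixed_idx P"

definition caratheodory ::
    "real \<Rightarrow> ((real^'n::finite) \<times> (real^'m::finite) \<Rightarrow> real \<Rightarrow> real) \<Rightarrow> bool" where
  "caratheodory T K \<longleftrightarrow>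
     (AE t in leb T. continuous_on UNIV (\<lambda>y. K y t)) \<and>
     (\<forall>y. (\<lambda>t. K y t) \<in> borel_measurable (leb T))"

definition data_assumptions :: "('n::finite, 'm::finite) dc_problem \<Rightarrow> bool" where
  "data_assumptions P \<longleftrightarrow>
     0 < hor P \<and> ell_I P \<le> ell_E P \<and>
     (\<forall>K\<in>integrands P. \<forall>t\<in>{0..hor P}. convex_on UNIV (\<lambda>y. K y t)) \<and>
     (\<forall>i\<le>ell_E P. convex_on UNIV (g_of P i) \<and> convex_on UNIV (h_of P i)) \<and>
     (\<forall>K\<in>integrands P. caratheodory (hor P) K) \<and>
     (\<forall>K\<in>integrands P. \<forall>z\<in>Xspace (hor P).
        measurable_multifunction (leb (hor P)) (\<lambda>t. subdifferential (\<lambda>y. K y t) (ev z t))) \<and>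
     (\<forall>R>0. \<exists>\<gamma>>0. AE t in leb (hor P). \<forall>K\<in>integrands P. \<forall>a b. norm a + norm b \<le> R \<longrightarrow>
        \<bar>K (a, b) t\<bar> \<le> \<gamma> \<and> (\<forall>v\<in>subdifferential (\<lambda>y. K y t) (a, b). norm v \<le> \<gamma>))"

text \<open>The last conjunct is closedness in \<open>X\<close> with respect to the topology of \<open>Y\<close>. It makes the set
  invariant under changes of representatives.\<close>

definition admissible_domain :: "('n::finite, 'm::finite) dc_problem \<Rightarrow> bool" where
  "admissible_domain P \<longleftrightarrow>
     dom_X0 P \<subseteq> Xspace (hor P) \<and>
     (\<forall>z\<in>dom_X0 P. \<forall>w\<in>dom_X0 P. \<forall>a\<in>{0..1}. lincomb (1 - a) z a w \<in> dom_X0 P) \<and>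
     (\<forall>z\<in>Xspace (hor P). (\<forall>e>0. \<exists>w\<in>dom_X0 P. Ynorm (hor P) (pdiff w z) < e) \<longrightarrow> z \<in> dom_X0 P)"

definition feasible :: "('n::finite, 'm::finite) dc_problem \<Rightarrow> ('n, 'm) process \<Rightarrow> bool" where
  "feasible P z \<longleftrightarrow>
     z \<in> dom_X0 P \<and>
     (AE t in leb (hor P). dot (hor P) (fst z) t = F_of P (ev z t) t) \<and>
     (\<forall>i\<in>ineq_idx P. f_of P i (ends (hor P) z) \<le> 0) \<and>
     (\<forall>j\<in>eq_idx P. f_of P j (ends (hor P) z) = 0) \<and>
     (\<forall>s\<in>mixed_idx P. AE t in leb (hor P). Xi_of P s (ev z t) t \<le> 0)"

definition J_of :: "('n::finite, 'm::finite) dc_problem \<Rightarrow> ('n, 'm) process \<Rightarrow> real" where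
  "J_of P z = (LINT t|leb (hor P). F0_of P (ev z t) t) + f_of P 0 (ends (hor P) z)"

definition penalty :: "('n::finite, 'm::finite) dc_problem \<Rightarrow> ('n, 'm) process \<Rightarrow> real" where
  "penalty P z =
     (\<Sum>i\<in>UNIV. LINT t|leb (hor P). \<bar>dot (hor P) (fst z) t $ i - F_of P (ev z t) t $ i\<bar>) +
     (\<Sum>i\<in>ineq_idx P. max 0 (f_of P i (ends (hor P) z))) +
     (\<Sum>j\<in>eq_idx P. \<bar>f_of P j (ends (hor P) z)\<bar>) +
     (\<Sum>s\<in>mixed_idx P. LINT t|leb (hor P). max 0 (Xi_of P s (ev z t) t))"

definition Phi :: "('n::finite, 'm::finite) dc_problem \<Rightarrow> real \<Rightarrow> ('n, 'm) process \<Rightarrow> real" where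
  "Phi P c z = J_of P z + c * penalty P z"


section \<open>Convex majorants\<close>

record ('n, 'm) subgrads =
  sub_V0 :: "real \<Rightarrow> (real^'n) \<times> (real^'m)"
  sub_V :: "'n \<Rightarrow> real \<Rightarrow> (real^'n) \<times> (real^'m)"
  sub_W :: "'n \<Rightarrow> real \<Rightarrow> (real^'n) \<times> (real^'m)"
  sub_v :: "nat \<Rightarrow> (real^'n) \<times> (real^'n)"
  sub_w :: "nat \<Rightarrow> (real^'n) \<times> (real^'n)"
  sub_z :: "nat \<Rightarrow> real \<Rightarrow> (real^'n) \<times> (real^'m)"

definition measurable_selection :: "real \<Rightarrow> (real \<Rightarrow> (real^'n::finite) \<times> (real^'m::finite)) \<Rightarrow>
    ((real^'n) \<times> (real^'m) \<Rightarrow> real \<Rightarrow> real) \<Rightarrow> ('n, 'm) process \<Rightarrow> bool" where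
  "measurable_selection T U K z \<longleftrightarrow>
     U \<in> borel_measurable (leb T) \<and>
     (AE t in leb T. U t \<in> subdifferential (\<lambda>y. K y t) (ev z t))"

definition subgradients_at :: "('n::finite, 'm::finite) dc_problem \<Rightarrow> ('n, 'm) process \<Rightarrow>
    ('n, 'm) subgrads \<Rightarrow> bool" where
  "subgradients_at P z V \<longleftrightarrow>
     measurable_selection (hor P) (sub_V0 V) (H0_of P) z \<and>
     (\<forall>i. measurable_selection (hor P) (sub_V V i) (H_of P i) z) \<and>
     (\<forall>i. measurable_selection (hor P) (sub_W V i) (G_of P i) z) \<and>
     (\<forall>s\<in>mixed_idx P. measurable_selection (hor P) (sub_z V s) (q_of P s) z) \<and>
     (\<forall>i\<le>ell_E P. sub_v V i \<in> subdifferential (h_of P i) (ends (hor P) z)) \<and>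
     (\<forall>j\<in>eq_idx P. sub_w V j \<in> subdifferential (g_of P j) (ends (hor P) z))"

definition Gamma_of :: "('n::finite, 'm::finite) dc_problem \<Rightarrow> ('n, 'm) process \<Rightarrow>
    ('n, 'm) subgrads \<Rightarrow> ('n, 'm) process \<Rightarrow> real" where
  "Gamma_of P zb V z =
    (let T = hor P; \<Delta> = (\<lambda>t. ev z t - ev zb t); b = ends T z; bb = ends T zb; \<Delta>b = b - bb in
     (\<Sum>i\<in>UNIV. LINT t|leb T.
        max (dot T (fst z) t $ i + H_of P i (ev z t) t - G_of P i (ev zb t) t
               - inner (sub_W V i t) (\<Delta> t))
            (- (dot T (fst z) t $ i) + G_of P i (ev z t) t - H_of P i (ev zb t) t
               - inner (sub_V V i t) (\<Delta> t))) +
     (\<Sum>i\<in>ineq_idx P. max 0 (g_of P i b - h_of P i bb - inner (sub_v V i) \<Delta>b)) +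
     (\<Sum>j\<in>eq_idx P. max (g_of P j b - h_of P j bb - inner (sub_v V j) \<Delta>b)
                       (h_of P j b - g_of P j bb - inner (sub_w V j) \<Delta>b)) +
     (\<Sum>s\<in>mixed_idx P. LINT t|leb T.
        max 0 (p_of P s (ev z t) t - q_of P s (ev zb t) t - inner (sub_z V s t) (\<Delta> t))))"

definition omega_of :: "('n::finite, 'm::finite) dc_problem \<Rightarrow> ('n, 'm) subgrads \<Rightarrow>
    ('n, 'm) process \<Rightarrow> real" where
  "omega_of P V z =
     (LINT t|leb (hor P). G0_of P (ev z t) t - inner (sub_V0 V t) (ev z t)) +
     g_of P 0 (ends (hor P) z) - inner (sub_v V 0) (ends (hor P) z)"

definition Q_of :: "('n::finite, 'm::finite) dc_problem \<Rightarrow> real \<Rightarrow> ('n, 'm) process \<Rightarrow>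
    ('n, 'm) subgrads \<Rightarrow> ('n, 'm) process \<Rightarrow> real" where
  "Q_of P c zb V z = omega_of P V z + c * Gamma_of P zb V z"


section \<open>The method B-STEP-DCA\<close>

record step_params =
  eta1 :: real
  eta2 :: real
  zeta :: real
  sigma :: real
  eps_phi :: real
  eps_feas :: real
  eps_seq :: "nat \<Rightarrow> real"
  kappa :: real

definition valid_params :: "step_params \<Rightarrow> bool" where
  "valid_params A \<longleftrightarrow>
     eta1 A \<in> {0<..<1} \<and> eta2 A \<in> {0<..<1} \<and> zeta A \<in> {0<..<1} \<and> sigma A \<in> {0<..<1} \<and>
     eps_phi A > 0 \<and> eps_feas A > 0 \<and> (\<forall>k. eps_seq A k > 0) \<and> kappa A > 0"

text \<open>A pair \<open>(c, z)\<close> below consists of a penalty parameter and the point computed for it; an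
  iteration strictly increases the parameter before it recomputes, so it never computes two points
  for the same parameter. Only the parameters that are actually tried need a computed point. The
  second conjunct is the standing descent assumption on computed points.\<close>

definition computed_point :: "('n::finite, 'm::finite) dc_problem \<Rightarrow> real \<Rightarrow> ('n, 'm) process \<Rightarrow>
    ('n, 'm) subgrads \<Rightarrow> real \<Rightarrow> ('n, 'm) process \<Rightarrow> bool" where
  "computed_point P e zk V c z \<longleftrightarrow>
     eps_optimal e (Q_of P c zk V) (dom_X0 P) z \<and> Q_of P c zk V z \<le> Q_of P c zk V zk"

text \<open>\<open>increase_until \<kappa> comp test s s'\<close>: the loop ``while \<open>test\<close> fails, increase the parameter by at
  least \<open>\<kappa>\<close> and recompute'' started in \<open>s\<close> terminates in \<open>s'\<close>.\<close>

inductive increase_until :: "real \<Rightarrow> (real \<Rightarrow> 'z \<Rightarrow> bool) \<Rightarrow> (real \<Rightarrow> 'z \<Rightarrow> bool) \<Rightarrow>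
    real \<times> 'z \<Rightarrow> real \<times> 'z \<Rightarrow> bool" for \<kappa> comp test where
  stop: "test c z \<Longrightarrow> increase_until \<kappa> comp test (c, z) (c, z)"
| incr: "\<not> test c z \<Longrightarrow> c + \<kappa> \<le> c' \<Longrightarrow> comp c' z' \<Longrightarrow>
         increase_until \<kappa> comp test (c', z') s \<Longrightarrow> increase_until \<kappa> comp test (c, z) s"

definition feasibility_steps :: "('n::finite, 'm::finite) dc_problem \<Rightarrow> step_params \<Rightarrow> nat \<Rightarrow>
    ('n, 'm) subgrads \<Rightarrow> real \<Rightarrow> ('n, 'm) process \<Rightarrow> real \<times> ('n, 'm) process \<Rightarrow> bool" where
  "feasibility_steps P A k V ck zk s \<longleftrightarrow>
    (let e = eps_seq A k; \<Gamma> = Gamma_of P zk V; comp = computed_point P e zk V in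
     \<exists>z1. comp ck z1 \<and>
       (if \<Gamma> z1 \<le> eps_phi A then s = (ck, z1)
        else \<exists>zh. eps_optimal e \<Gamma> (dom_X0 P) zh \<and>
          (if \<Gamma> zh < \<Gamma> zk
           then increase_until (kappa A) comp
                  (\<lambda>c z. \<Gamma> z - \<Gamma> zk \<le> eta1 A * (\<Gamma> zh - \<Gamma> zk)) (ck, z1) s
           else increase_until (kappa A) comp
                  (\<lambda>c z. \<Gamma> z \<le> \<Gamma> zk + eps_feas A) (ck, z1) s)))"

definition descent_step :: "('n::finite, 'm::finite) dc_problem \<Rightarrow> step_params \<Rightarrow> nat \<Rightarrow>
    ('n, 'm) subgrads \<Rightarrow> ('n, 'm) process \<Rightarrow>
    real \<times> ('n, 'm) process \<Rightarrow> real \<times> ('n, 'm) process \<Rightarrow> bool" where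
  "descent_step P A k V zk =
    (let \<Gamma> = Gamma_of P zk V in
     increase_until (kappa A) (computed_point P (eps_seq A k) zk V)
       (\<lambda>c z. Q_of P c zk V z - Q_of P c zk V zk \<le> c * eta2 A * (\<Gamma> z - \<Gamma> zk)))"

definition line_search :: "('n::finite, 'm::finite) dc_problem \<Rightarrow> step_params \<Rightarrow> real \<Rightarrow>
    ('n, 'm) process \<Rightarrow> ('n, 'm) process \<Rightarrow> ('n, 'm) process \<Rightarrow> bool" where
  "line_search P A c zk y z' \<longleftrightarrow>
    (let d = pdiff y zk in
     \<exists>\<nu> \<alpha>b j. \<nu> > 0 \<and> \<alpha>b \<ge> 0 \<and>
       (let trial = (\<lambda>i. lincomb 1 y (zeta A ^ i * \<alpha>b) d);
            accept = (\<lambda>i. Phi P c (trial i) - Phi P c y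
                        \<le> - sigma A * (zeta A ^ i * \<alpha>b)\<^sup>2 * L2norm_sq (hor P) d + \<nu>) in
        (\<forall>i. trial i \<in> dom_X0 P) \<and>
        accept j \<and> (\<forall>i<j. \<not> accept i) \<and> z' = trial j))"

definition iteration :: "('n::finite, 'm::finite) dc_problem \<Rightarrow> step_params \<Rightarrow> nat \<Rightarrow>
    real \<times> ('n, 'm) process \<Rightarrow> real \<times> ('n, 'm) process \<Rightarrow> bool" where
  "iteration P A k s s' \<longleftrightarrow>
    (case s of (ck, zk) \<Rightarrow> case s' of (c', z') \<Rightarrow>
     \<exists>V sp y. subgradients_at P zk V \<and>
       feasibility_steps P A k V ck zk sp \<and>
       descent_step P A k V zk sp (c', y) \<and>
       line_search P A c' zk y z')"

definition b_step_dca :: "('n::finite, 'm::finite) dc_problem \<Rightarrow> step_params \<Rightarrow>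
    (nat \<Rightarrow> real) \<Rightarrow> (nat \<Rightarrow> ('n, 'm) process) \<Rightarrow> bool" where
  "b_step_dca P A c z \<longleftrightarrow>
     valid_params A \<and> z 0 \<in> dom_X0 P \<and> c 0 > 0 \<and>
     (\<exists>B. \<forall>w\<in>dom_X0 P. B \<le> Phi P (c 0) w) \<and>
     (\<forall>k. iteration P A k (c k, z k) (c (Suc k), z (Suc k)))"

end

theory Submission
  imports Defs
begin

text \<open>The \<open>L\<^sup>r\<close> bound on the trajectories gives a uniform bound, so only the behaviour of the data on
  bounded sets matters, where they are bounded and, by convexity, Lipschitz in \<open>(x,u)\<close>. Since
  \<open>\<phi> \<longlongrightarrow> 0\<close>, the trajectories solve \<open>x' = F(x,u,t)\<close> up to an error vanishing in \<open>L\<^sup>1\<close>, and Gronwall's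
  inequality bounds their mutual distance by the distance of the initial values, these errors and
  the \<open>L\<^sup>1\<close> distance of the controls. Along any subsequence whose initial values converge, the
  trajectories are therefore uniformly Cauchy; their limit solves the limit equation and the
  derivatives converge in \<open>L\<^sup>1\<close>. Bolzano-Weierstrass for the initial values gives compactness, and
  if \<open>x(0)\<close> is fixed on the feasible set then the initial values themselves converge.\<close>


section \<open>Absolutely continuous functions and Sobolev spaces\<close>

text \<open>Sobolev functions are given by epsilon-delta absolute continuity and a pointwise
  derivative, whereas Gronwall's inequality and the passage to the limit speak about integrals. Two
  bridges are therefore needed: increments are integrals of \<open>dot\<close>, and a primitive of a
  bounded function has that function as its \<open>dot\<close> almost everywhere. Each iterate has a
  bounded derivative, but in general with no bound common to all iterates; uniform control is
  available for the trajectories in the sup norm and for the derivatives in L^1. Hence convergence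
  takes place in W^{1,1}, while boundedness of the derivative of a limit is recovered from the
  equation x_*' = F(x_*,u_*,t). Strong convergence of the controls makes F(x,u,t) converge in L^1,
  so the derivatives converge strongly and no weak compactness enters. Iterates need not be
  feasible, so an initial value that is fixed on the feasible set says nothing about x_k(0)
  directly; it acts on the limits, once these are known to be feasible.\<close>

text \<open>Transport along a bijection with an initial segment of the naturals: the pieces of a
  tagged division are indexed by pairs of tag and interval, not by numbers.\<close>

lemma AC_small_sum:
  assumes "abs_continuous_on a b f" "e > 0"
  obtains d where "d > 0" "\<And>S. \<lbrakk>finite S; \<And>k. k \<in> S \<Longrightarrow> a \<le> l k \<and> l k \<le> r k \<and> r k \<le> b;
     disjoint_family_on (\<lambda>k. {l k<..<r k}) S; (\<Sum>k\<in>S. r k - l k) < d\<rbrakk>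
     \<Longrightarrow> (\<Sum>k\<in>S. norm (f (r k) - f (l k))) < e"
proof -
  obtain d where d: "d > 0" "\<And>(N::nat) l r. (\<forall>i<N. a \<le> l i \<and> l i \<le> r i \<and> r i \<le> b) \<and>
        disjoint_family_on (\<lambda>i. {l i<..<r i}) {..<N} \<and> (\<Sum>i<N. r i - l i) < d
        \<longrightarrow> (\<Sum>i<N. norm (f (r i) - f (l i))) < e"
    using assms unfolding abs_continuous_on_def by meson
  show thesis
  proof (rule that[OF d(1)])
    fix S assume S: "finite S" "\<And>k. k \<in> S \<Longrightarrow> a \<le> l k \<and> l k \<le> r k \<and> r k \<le> b"
      "disjoint_family_on (\<lambda>k. {l k<..<r k}) S" "(\<Sum>k\<in>S. r k - l k) < d"
    obtain h where h: "bij_betw h {..<card S} S"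
      using ex_bij_betw_nat_finite[OF S(1)] by (auto simp: atLeast0LessThan)
    then have hS: "h i \<in> S" if "i < card S" for i
      using that by (auto simp: bij_betw_def)
    have "(\<Sum>i<card S. norm (f (r (h i)) - f (l (h i)))) < e"
    proof (rule d(2)[rule_format], intro conjI)
      show "\<forall>i<card S. a \<le> l (h i) \<and> l (h i) \<le> r (h i) \<and> r (h i) \<le> b" using S(2) hS by blast
      show "disjoint_family_on (\<lambda>i. {l (h i)<..<r (h i)}) {..<card S}"
        unfolding disjoint_family_on_def
      proof (intro ballI impI)
        fix i j assume ij: "i \<in> {..<card S}" "j \<in> {..<card S}" "i \<noteq> j"
        then have "h i \<noteq> h j" using h by (auto simp: bij_betw_def inj_on_def)
        then show "{l (h i)<..<r (h i)} \<inter> {l (h j)<..<r (h j)} = {}"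
          using S(3) hS ij unfolding disjoint_family_on_def by auto
      qed
      show "(\<Sum>i<card S. r (h i) - l (h i)) < d"
        using S(4) sum.reindex_bij_betw[OF h, of "\<lambda>k. r k - l k"] by simp
    qed
    then show "(\<Sum>k\<in>S. norm (f (r k) - f (l k))) < e"
      using sum.reindex_bij_betw[OF h, of "\<lambda>k. norm (f (r k) - f (l k))"] by simp
  qed
qed

text \<open>\<open>Inf\<close> and \<open>Sup\<close> recover the end points of a piece. Open
  intervals are compared because neighbouring closed pieces share end points; disjointness then
  turns the total length into the measure of a union contained in \<open>U\<close>.\<close>

lemma tagged_division_subset_length_le:
  fixes p :: "(real \<times> real set) set"
  assumes p: "p tagged_division_of {a..b}" and q: "q \<subseteq> p"
    and U: "U \<in> sets lebesgue" "\<And>t K. (t, K) \<in> q \<Longrightarrow> K \<subseteq> U"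
  shows "disjoint_family_on (\<lambda>k. {Inf (snd k)<..<Sup (snd k)}) q"
    and "ennreal (\<Sum>k\<in>q. Sup (snd k) - Inf (snd k)) \<le> emeasure lebesgue U"
proof -
  have K: "\<exists>u v. K = {u..v} \<and> u \<le> v" if "(t, K) \<in> p" for t K
    using tagged_division_ofD(2,4)[OF p that] by (metis atLeastatMost_empty_iff2 box_real(2) empty_iff)
  show disj: "disjoint_family_on (\<lambda>k. {Inf (snd k)<..<Sup (snd k)}) q"
    unfolding disjoint_family_on_def
  proof (intro ballI impI)
    fix i j assume ij: "i \<in> q" "j \<in> q" "i \<noteq> j"
    obtain t K s L where tK: "i = (t, K)" "j = (s, L)" by fastforce
    have "interior K \<inter> interior L = {}"
      using tagged_division_ofD(5)[OF p, of t K s L] ij tK q by auto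
    moreover have "interior K = {Inf K<..<Sup K}" if tK: "(t, K) \<in> q" for t K
    proof -
      obtain u v where "K = {u..v}" "u \<le> v" using K[of t K] tK q by blast
      then show ?thesis by simp
    qed
    then have "interior K = {Inf K<..<Sup K}" "interior L = {Inf L<..<Sup L}"
      using ij tK by auto
    ultimately show "{Inf (snd i)<..<Sup (snd i)} \<inter> {Inf (snd j)<..<Sup (snd j)} = {}"
      by (simp add: tK)
  qed
  have fin: "finite q" using p q finite_subset by blast
  have le: "Inf (snd k) \<le> Sup (snd k)" if "k \<in> q" for k
    using K[of "fst k" "snd k"] that q by fastforce
  have "ennreal (\<Sum>k\<in>q. Sup (snd k) - Inf (snd k))
      = (\<Sum>k\<in>q. emeasure lebesgue {Inf (snd k)<..<Sup (snd k)})"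
    using le by (subst sum_ennreal[symmetric]) (auto intro!: sum.cong)
  also have "\<dots> = emeasure lebesgue (\<Union>k\<in>q. {Inf (snd k)<..<Sup (snd k)})"
    by (rule sum_emeasure) (use disj fin in auto)
  also have "\<dots> \<le> emeasure lebesgue U"
  proof (rule emeasure_mono)
    show "(\<Union>k\<in>q. {Inf (snd k)<..<Sup (snd k)}) \<subseteq> U"
    proof safe
      fix s t K assume "(t, K) \<in> q" "s \<in> {Inf (snd (t, K))<..<Sup (snd (t, K))}"
      moreover from this obtain u v where "K = {u..v}" "u \<le> v" using K[of t K] q by blast
      ultimately show "s \<in> U" using U(2)[of t K] by auto
    qed
  qed (use U in auto)
  finally show "ennreal (\<Sum>k\<in>q. Sup (snd k) - Inf (snd k)) \<le> emeasure lebesgue U" .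
qed

text \<open>The gauge integral suits an almost everywhere derivative: the fineness may depend on the
  tag, and existence of the integral of \<open>g\<close> is part of the conclusion.\<close>

theorem fundamental_theorem_of_calculus_AC:
  fixes f :: "real \<Rightarrow> 'a::euclidean_space"
  assumes "a \<le> b" and AC: "abs_continuous_on a b f" and N: "negligible N"
    and der: "\<And>t. t \<in> {a..b} - N \<Longrightarrow> (f has_vector_derivative g t) (at t within {a..b})"
  shows "(g has_integral (f b - f a)) {a..b}"
proof (cases "a = b")
  case True
  then show ?thesis by (simp add: has_integral_refl)
next
  case False
  with \<open>a \<le> b\<close> have ab: "a < b" by simp
  \<comment> \<open>The value 0 on \<open>N\<close> removes the Riemann terms at tags where
    \<open>g\<close> is arbitrary; changing \<open>g\<close> on a null set leaves the integral
    alone.\<close>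
  define g' where "g' t = (if t \<in> N then 0 else g t)" for t
  have "(g' has_integral (f b - f a)) {a..b}"
    unfolding has_integral_factor_content_real
  proof (intro allI impI)
    fix e' :: real assume "e' > 0"
    \<comment> \<open>Half of the error is spent on the tags in \<open>N\<close>, half on the
      others.\<close>
    define e where "e = e' / 2"
    have e: "e > 0" using \<open>e' > 0\<close> by (simp add: e_def)
    have "\<forall>x. \<exists>d>0. x \<in> {a..b} - N \<longrightarrow>
         (\<forall>y\<in>{a..b}. norm (y-x) < d \<longrightarrow> norm (f y - f x - (y-x) *\<^sub>R g x) \<le> e * norm (y-x))"
      using der[unfolded has_vector_derivative_def has_derivative_within_alt] e by (meson zero_less_one)
    then obtain d where d: "\<And>x. 0 < d x"
                 "\<And>x y. \<lbrakk>x \<in> {a..b} - N; y \<in> {a..b}; norm (y-x) < d x\<rbrakk>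
                        \<Longrightarrow> norm (f y - f x - (y-x) *\<^sub>R g x) \<le> e * norm (y-x)"
      by metis
    obtain \<delta> where \<delta>: "\<delta> > 0" "\<And>S. \<lbrakk>finite S;
        \<And>k::real \<times> real set. k \<in> S \<Longrightarrow> a \<le> Inf (snd k) \<and> Inf (snd k) \<le> Sup (snd k) \<and> Sup (snd k) \<le> b;
        disjoint_family_on (\<lambda>k. {Inf (snd k)<..<Sup (snd k)}) S; (\<Sum>k\<in>S. Sup (snd k) - Inf (snd k)) < \<delta>\<rbrakk>
       \<Longrightarrow> (\<Sum>k\<in>S. norm (f (Sup (snd k)) - f (Inf (snd k)))) < e * (b - a)"
      using AC_small_sum[OF AC, of "e * (b - a)" "\<lambda>k. Inf (snd k)" "\<lambda>k. Sup (snd k)"] e ab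
      by (auto simp: algebra_simps)
    have Nnull: "N \<in> null_sets lebesgue" using N by (simp add: negligible_iff_null_sets)
    then have Ns: "N \<in> sets lebesgue" by auto
    obtain U where U: "open U" "N \<subseteq> U" "U - N \<in> lmeasurable" "emeasure lebesgue (U - N) < ennreal \<delta>"
      using sets_lebesgue_outer_open[OF Ns \<delta>(1)] by metis
    have Us: "U \<in> sets lebesgue" using U(1) by (simp add: borel_open)
    have "emeasure lebesgue U = emeasure lebesgue (U - N)"
      using emeasure_Diff_null_set[OF Nnull Us] by simp
    with U have U\<delta>: "emeasure lebesgue U < ennreal \<delta>" by simp
    \<comment> \<open>Intervals tagged in the null set \<open>N\<close> stay inside an open set of measure below \<open>\<delta>\<close>, so that
      absolute continuity controls their increments; the others are handled by differentiability.\<close>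
    define \<gamma> where "\<gamma> t = (if t \<in> N then U else ball t (d t))" for t
    show "\<exists>\<gamma>. gauge \<gamma> \<and> (\<forall>p. p tagged_division_of {a..b} \<and> \<gamma> fine p \<longrightarrow>
        norm ((\<Sum>(x,k)\<in>p. measure lborel k *\<^sub>R g' x) - (f b - f a)) \<le> e' * measure lborel {a..b})"
    proof (intro exI[of _ \<gamma>] conjI allI impI)
      show "gauge \<gamma>" unfolding gauge_def \<gamma>_def using U d(1) by auto
      fix p assume "p tagged_division_of {a..b} \<and> \<gamma> fine p"
      then have p: "p tagged_division_of {a..b}" and fine: "\<gamma> fine p" by auto
      have fin: "finite p" using p by blast
      define \<phi> where "\<phi> k = measure lborel (snd k) *\<^sub>R g' (fst k) - (f (Sup (snd k)) - f (Inf (snd k)))" for k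
      have K: "\<exists>u v. K = {u..v} \<and> u \<le> t \<and> t \<le> v \<and> a \<le> u \<and> v \<le> b" if tK: "(t, K) \<in> p" for t K
      proof -
        obtain u v where "K = {u..v}" using tagged_division_ofD(4)[OF p tK] by auto
        moreover have "t \<in> K" "K \<subseteq> {a..b}" using tagged_division_ofD(2,3)[OF p tK] by auto
        ultimately show ?thesis by auto
      qed
      define q where "q = {k\<in>p. fst k \<in> N}"
      have q: "q \<subseteq> p" "finite q" using fin by (auto simp: q_def)
      have KU: "K \<subseteq> U" if "(t, K) \<in> q" for t K
        using that fine unfolding fine_def q_def \<gamma>_def by fastforce
      have "(\<Sum>k\<in>q. norm (\<phi> k)) = (\<Sum>k\<in>q. norm (f (Sup (snd k)) - f (Inf (snd k))))"
        by (rule sum.cong) (auto simp: \<phi>_def q_def g'_def norm_minus_commute)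
      also have "\<dots> < e * (b - a)"
      proof (rule \<delta>(2))
        have "ennreal (\<Sum>k\<in>q. Sup (snd k) - Inf (snd k)) < ennreal \<delta>"
          using tagged_division_subset_length_le(2)[OF p q(1) Us KU] U\<delta> by (rule le_less_trans)
        then show "(\<Sum>k\<in>q. Sup (snd k) - Inf (snd k)) < \<delta>"
          by (metis ennreal_leI linorder_not_less)
        show "a \<le> Inf (snd k) \<and> Inf (snd k) \<le> Sup (snd k) \<and> Sup (snd k) \<le> b" if "k \<in> q" for k
          using K[of "fst k" "snd k"] that q by fastforce
      qed (use q tagged_division_subset_length_le(1)[OF p q(1) Us KU] in auto)
      finally have 1: "(\<Sum>k\<in>q. norm (\<phi> k)) \<le> e * (b - a)" by simp
      have "(\<Sum>k\<in>p-q. norm (\<phi> k)) \<le> (\<Sum>k\<in>p-q. e * measure lborel (snd k))"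
      proof (rule sum_mono, clarify)
        fix t K assume tK: "(t, K) \<in> p" "(t, K) \<notin> q"
        then have tN: "t \<notin> N" by (auto simp: q_def)
        obtain u v where uv: "K = {u..v}" "u \<le> t" "t \<le> v" "a \<le> u" "v \<le> b" using K[OF tK(1)] by blast
        have "K \<subseteq> ball t (d t)" using fine tK(1) tN unfolding fine_def \<gamma>_def by fastforce
        moreover have "u \<in> K" "v \<in> K" using uv by auto
        ultimately have "u \<in> ball t (d t)" "v \<in> ball t (d t)" by blast+
        then have "norm (u - t) < d t" "norm (v - t) < d t" by (auto simp: dist_real_def)
        then have b: "norm (f u - f t - (u-t) *\<^sub>R g t) \<le> e * norm (u-t)"
          "norm (f v - f t - (v-t) *\<^sub>R g t) \<le> e * norm (v-t)"
          using d(2)[of t u] d(2)[of t v] uv tN by auto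
        \<comment> \<open>The increment is split at the tag, the point where \<open>f\<close> is
          differentiable; the two errors are proportional to t - u and v - t, which add up to the
          length of the piece.\<close>
        have "\<phi> (t, K) = (f u - f t - (u-t) *\<^sub>R g t) - (f v - f t - (v-t) *\<^sub>R g t)"
          using uv tN by (simp add: \<phi>_def g'_def algebra_simps)
        then have "norm (\<phi> (t, K)) \<le> e * norm (u-t) + e * norm (v-t)"
          using b norm_triangle_ineq4[of "f u - f t - (u-t) *\<^sub>R g t" "f v - f t - (v-t) *\<^sub>R g t"] by simp
        also have "\<dots> = e * measure lborel K" using uv by (simp add: algebra_simps)
        finally show "norm (\<phi> (t, K)) \<le> e * measure lborel (snd (t, K))" by simp
      qed
      also have "\<dots> \<le> (\<Sum>k\<in>p. e * measure lborel (snd k))"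
        by (rule sum_mono2) (use fin e in auto)
      also have "\<dots> = e * (b - a)"
        using additive_content_tagged_division[of p a b] p ab
        by (simp add: sum_distrib_left[symmetric] case_prod_unfold)
      finally have 2: "(\<Sum>k\<in>p-q. norm (\<phi> k)) \<le> e * (b - a)" .
      have "(\<Sum>(x,k)\<in>p. measure lborel k *\<^sub>R g' x) - (f b - f a) = (\<Sum>k\<in>p. \<phi> k)"
        using additive_tagged_division_1[OF \<open>a \<le> b\<close> p, of f]
        by (simp add: \<phi>_def sum_subtractf case_prod_unfold)
      also have "norm \<dots> \<le> (\<Sum>k\<in>p. norm (\<phi> k))" by (rule norm_sum)
      also have "\<dots> = (\<Sum>k\<in>p-q. norm (\<phi> k)) + (\<Sum>k\<in>q. norm (\<phi> k))"
        using q fin by (subst sum.subset_diff[of q]) auto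
      also have "\<dots> \<le> e' * measure lborel {a..b}" using 1 2 ab by (simp add: e_def algebra_simps)
      finally show "norm ((\<Sum>(x,k)\<in>p. measure lborel k *\<^sub>R g' x) - (f b - f a)) \<le> e' * measure lborel {a..b}" .
    qed
  qed
  then show ?thesis
    by (rule has_integral_spike[OF N, rotated]) (auto simp: g'_def)
qed

section \<open>Essentially bounded functions and the integral form of Sobolev functions\<close>

text \<open>Completeness of Lebesgue measure, reached by extending both functions by zero to the
  whole line.\<close>

lemma measurable_leb_AE_cong:
  fixes f g :: "real \<Rightarrow> 'a::euclidean_space"
  assumes "f \<in> borel_measurable (leb T)" "AE t in leb T. f t = g t"
  shows "g \<in> borel_measurable (leb T)"
proof -
  have "(\<lambda>t. if t \<in> {0..T} then f t else 0) \<in> borel_measurable lebesgue"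
    using assms by (intro borel_measurable_if_I) auto
  moreover have "AE t in lebesgue. (if t \<in> {0..T} then f t else 0) = (if t \<in> {0..T} then g t else 0)"
    using assms(2) by (auto simp: AE_restrict_space_iff elim!: eventually_mono)
  ultimately show ?thesis by (intro borel_measurable_if_D[OF borel_measurable_AE])
qed

lemma finite_measure_leb: "finite_measure (leb T)"
  by (rule finite_measure_lebesgue_on) simp

text \<open>Trades the essential supremum for an explicit almost everywhere bound, which combines
  directly with other almost everywhere facts.\<close>

lemma Lspace_infinity_iff:
  "f \<in> Lspace T \<infinity> \<longleftrightarrow> f \<in> borel_measurable (leb T) \<and> (\<exists>M. AE t in leb T. norm (f t) \<le> M)"
proof safe
  assume f: "f \<in> Lspace T \<infinity>"
  then show m: "f \<in> borel_measurable (leb T)" by (simp add: Lspace_def)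
  have lt: "esssup (leb T) (\<lambda>t. ennreal (norm (f t))) < \<infinity>" using f by (simp add: Lspace_def)
  have "AE t in leb T. norm (f t) \<le> enn2real (esssup (leb T) (\<lambda>t. ennreal (norm (f t))))"
    using esssup_AE[of "\<lambda>t. ennreal (norm (f t))" "leb T"]
  proof eventually_elim
    case (elim t)
    then have "enn2real (ennreal (norm (f t))) \<le> enn2real (esssup (leb T) (\<lambda>t. ennreal (norm (f t))))"
      using lt by (intro enn2real_mono) auto
    then show ?case by simp
  qed
  then show "\<exists>M. AE t in leb T. norm (f t) \<le> M" by blast
next
  fix M assume m: "f \<in> borel_measurable (leb T)" and M: "AE t in leb T. norm (f t) \<le> M"
  have "esssup (leb T) (\<lambda>t. ennreal (norm (f t))) \<le> ennreal M"
    using m M by (intro esssup_I) (auto intro: ennreal_leI elim!: eventually_mono)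
  then have "esssup (leb T) (\<lambda>t. ennreal (norm (f t))) < \<infinity>"
    unfolding infinity_ennreal_def by (rule le_less_trans[OF _ ennreal_less_top])
  then show "f \<in> Lspace T \<infinity>" using m by (simp add: Lspace_def)
qed

text \<open>Membership matters: \<open>enn2real\<close> sends an infinite essential supremum to 0,
  so \<open>Lnorm\<close> of an unbounded function carries no information.\<close>

lemma AE_norm_le_Lnorm_infinity:
  assumes "f \<in> Lspace T \<infinity>"
  shows "AE t in leb T. norm (f t) \<le> Lnorm T \<infinity> f"
  using esssup_AE[of "\<lambda>t. ennreal (norm (f t))" "leb T"]
proof eventually_elim
  case (elim t)
  have lt: "esssup (leb T) (\<lambda>t. ennreal (norm (f t))) < \<infinity>" using assms by (simp add: Lspace_def)
  have "enn2real (ennreal (norm (f t))) \<le> enn2real (esssup (leb T) (\<lambda>t. ennreal (norm (f t))))"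
    using lt elim by (intro enn2real_mono) auto
  then show ?case by (simp add: Lnorm_def)
qed

lemma integrable_leb_AE_bounded:
  fixes f :: "real \<Rightarrow> 'a::euclidean_space"
  assumes "f \<in> borel_measurable (leb T)" "AE t in leb T. norm (f t) \<le> M"
  shows "integrable (leb T) f"
  using finite_measure.integrable_const_bound[OF finite_measure_leb assms(2,1)] .

lemma Lspace_infinity_integrable:
  assumes "f \<in> Lspace T \<infinity>" shows "integrable (leb T) f"
  using assms integrable_leb_AE_bounded unfolding Lspace_infinity_iff by blast

lemma Lspace_1_iff: "f \<in> Lspace T 1 \<longleftrightarrow> integrable (leb T) f"
  by (auto simp: Lspace_def intro: integrable_norm_cancel integrable_norm)

lemma W1_infinity_imp_W1_1: "x \<in> W1 T \<infinity> \<Longrightarrow> x \<in> W1 T 1"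
  by (auto simp: W1_def Lspace_1_iff Lspace_infinity_integrable)

lemma abs_continuous_on_subset:
  "abs_continuous_on a b f \<Longrightarrow> a \<le> a' \<Longrightarrow> b' \<le> b \<Longrightarrow> abs_continuous_on a' b' f"
  unfolding abs_continuous_on_def by (meson order.trans)

text \<open>\<open>dot\<close> is a derivative within [0,T], one-sided at the ends, and so restricts
  to a derivative within any subinterval; the fundamental theorem then applies on [s,t].\<close>

lemma W1_integral:
  assumes T: "0 < T" and x: "x \<in> W1 T 1" and st: "0 \<le> s" "s \<le> t" "t \<le> T"
  shows "x t - x s = (LINT r|lebesgue_on {s..t}. dot T x r)"
    and "integrable (lebesgue_on {s..t}) (dot T x)"
proof -
  have AC: "abs_continuous_on s t x"
    using x st by (auto simp: W1_def intro: abs_continuous_on_subset)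
  have "AE r in leb T. x differentiable (at r within {0..T})" using x by (simp add: W1_def)
  then have "AE r in lebesgue. r \<in> {0..T} \<longrightarrow> x differentiable (at r within {0..T})"
    by (simp add: AE_restrict_space_iff)
  then obtain N where N: "N \<in> null_sets lebesgue"
    "{r. \<not> (r \<in> {0..T} \<longrightarrow> x differentiable (at r within {0..T}))} \<subseteq> N"
    by (auto simp: eventually_ae_filter)
  have "(dot T x has_integral (x t - x s)) {s..t}"
  proof (rule fundamental_theorem_of_calculus_AC[OF st(2) AC])
    show "negligible N" using N by (simp add: negligible_iff_null_sets)
    fix r assume r: "r \<in> {s..t} - N"
    then have "r \<in> {0..T} \<longrightarrow> x differentiable (at r within {0..T})"
      using subsetD[OF N(2), of r] by auto
    then have "x differentiable (at r within {0..T})" using r st by simp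
    then have "(x has_vector_derivative dot T x r) (at r within {0..T})"
      unfolding dot_def by (simp add: vector_derivative_works[symmetric])
    then show "(x has_vector_derivative dot T x r) (at r within {s..t})"
      by (rule has_vector_derivative_within_subset) (use st in auto)
  qed
  then have D: "(dot T x has_integral (x t - x s)) {s..t}" .
  show i: "integrable (lebesgue_on {s..t}) (dot T x)"
    by (rule integrable_subinterval[OF W1_integrable(2)[OF x]]) (use st in auto)
  show "x t - x s = (LINT r|lebesgue_on {s..t}. dot T x r)"
    by (rule has_integral_unique[OF D has_integral_integral_lebesgue_on[OF i]]) simp
qed

lemma integral_lebesgue_on_mono_set:
  fixes f :: "real \<Rightarrow> real"
  assumes "integrable (lebesgue_on {a..b}) f" "{c..d} \<subseteq> {a..b}" "\<And>t. f t \<ge> 0"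
  shows "(LINT t|lebesgue_on {c..d}. f t) \<le> (LINT t|lebesgue_on {a..b}. f t)"
proof -
  have i: "integrable (lebesgue_on {c..d}) f"
    using assms integrable_subinterval by blast
  show ?thesis
    using assms i by (simp add: lebesgue_integral_eq_integral integral_subset_le integrable_on_lebesgue_on)
qed

lemma W1_diff_le:
  assumes T: "0 < T" and x: "x \<in> W1 T 1" and st: "s \<in> {0..T}" "t \<in> {0..T}"
  shows "norm (x t - x s) \<le> (LINT r|leb T. norm (dot T x r))"
proof -
  have *: "norm (x t - x s) \<le> (LINT r|leb T. norm (dot T x r))" if "0 \<le> s" "s \<le> t" "t \<le> T" for s t
  proof -
    have "norm (x t - x s) \<le> (LINT r|lebesgue_on {s..t}. norm (dot T x r))"
      using W1_integral[OF T x that] by simp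
    also have "\<dots> \<le> (LINT r|leb T. norm (dot T x r))"
      using W1_integrable(2)[OF x] that by (intro integral_lebesgue_on_mono_set) auto
    finally show ?thesis .
  qed
  show ?thesis
    using *[of s t] *[of t s] st by (cases "s \<le> t") (auto simp: norm_minus_commute)
qed

lemma measure_leb: "T \<ge> 0 \<Longrightarrow> measure (leb T) (space (leb T)) = T"
  by (simp add: measure_restrict_space)

text \<open>The embedding of W^{1,1} into the bounded functions: averaging
  \<open>norm (x t) \<le> norm (x s) + ?D\<close> over s gives the factor 1/T.\<close>

lemma W1_norm_le:
  assumes T: "0 < T" and x: "x \<in> W1 T 1" and t: "t \<in> {0..T}"
  shows "norm (x t) \<le> (LINT r|leb T. norm (x r)) / T + (LINT r|leb T. norm (dot T x r))"
proof -
  let ?D = "LINT r|leb T. norm (dot T x r)"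
  interpret finite_measure "leb T" by (rule finite_measure_leb)
  have "(LINT s|leb T. norm (x t)) \<le> (LINT s|leb T. norm (x s) + ?D)"
  proof (rule integral_mono)
    fix s assume "s \<in> space (leb T)"
    then have "norm (x t - x s) \<le> ?D" using W1_diff_le[OF T x] t by simp
    then show "norm (x t) \<le> norm (x s) + ?D" using norm_triangle_sub[of "x t" "x s"] by linarith
  qed (use W1_integrable(1)[OF x] in auto)
  also have "\<dots> = (LINT s|leb T. norm (x s)) + T * ?D"
    using W1_integrable(1)[OF x] T by (subst Bochner_Integration.integral_add) (auto simp: measure_leb[simplified])
  finally have "T * norm (x t) \<le> (LINT s|leb T. norm (x s)) + T * ?D" using T by (simp add: measure_leb[simplified])
  then show ?thesis using T by (simp add: field_simps)
qed

text \<open>The topology lives on functions restricted to [0,T], so everything has to be insensitive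
  to values outside; this holds because all derivatives are taken within [0,T].\<close>

lemma W1_cong:
  assumes T: "0 < T" and eq: "\<And>t. t \<in> {0..T} \<Longrightarrow> x t = y t" and y: "y \<in> W1 T s"
  shows "x \<in> W1 T s" "\<And>t. t \<in> {0..T} \<Longrightarrow> dot T x t = dot T y t"
proof -
  have der: "(x has_vector_derivative D) (at t within {0..T}) \<longleftrightarrow>
      (y has_vector_derivative D) (at t within {0..T})" if "t \<in> {0..T}" for t D
    by (rule has_vector_derivative_cong_ev) (use that eq in auto)
  show d: "dot T x t = dot T y t" if "t \<in> {0..T}" for t
    unfolding dot_def vector_derivative_def der[OF that] ..
  have "(AE t in leb T. x differentiable at t within {0..T}) \<longleftrightarrow> (AE t in leb T. y differentiable at t within {0..T})"
  proof (rule AE_cong)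
    fix t assume "t \<in> space (leb T)"
    then have "t \<in> {0..T}" by simp
    have "x differentiable at t within {0..T}" if "y differentiable at t within {0..T}" "\<And>t. t \<in> {0..T} \<Longrightarrow> x t = y t" for x y :: "real \<Rightarrow> 'a"
      using that(1) by (rule differentiable_transform_within[OF _ zero_less_one \<open>t \<in> {0..T}\<close>]) (use that in auto)
    then show "x differentiable at t within {0..T} \<longleftrightarrow> y differentiable at t within {0..T}"
      using eq by metis
  qed
  moreover have "abs_continuous_on 0 T x"
  proof -
    have "norm (x r - x l) = norm (y r - y l)" if "0 \<le> l \<and> l \<le> r \<and> r \<le> T" for l r
      using that eq by auto
    then have s: "(\<Sum>i<N. norm (x (r i) - x (l i))) = (\<Sum>i<N. norm (y (r i) - y (l i)))"
      if "\<forall>i<N. 0 \<le> l i \<and> l i \<le> r i \<and> r i \<le> T" for N and l r :: "nat \<Rightarrow> real"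
      using that by (intro sum.cong) auto
    have "abs_continuous_on 0 T y" using y by (simp add: W1_def)
    then show ?thesis unfolding abs_continuous_on_def using s by (simp cong: conj_cong)
  qed
  moreover have "dot T x \<in> Lspace T s"
  proof -
    have m: "dot T x \<in> borel_measurable (leb T) \<longleftrightarrow> dot T y \<in> borel_measurable (leb T)"
      by (rule measurable_cong) (use d in auto)
    have y': "dot T y \<in> Lspace T s" using y by (simp add: W1_def)
    then have my: "dot T y \<in> borel_measurable (leb T)" by (simp add: Lspace_def)
    have e: "esssup (leb T) (\<lambda>t. ennreal (norm (dot T x t))) = esssup (leb T) (\<lambda>t. ennreal (norm (dot T y t)))"
    proof (rule esssup_AE_cong)
      show "(\<lambda>t. ennreal (norm (dot T x t))) \<in> borel_measurable (leb T)"
        using my m by simp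
      show "(\<lambda>t. ennreal (norm (dot T y t))) \<in> borel_measurable (leb T)"
        using my by simp
      show "AE t in leb T. ennreal (norm (dot T x t)) = ennreal (norm (dot T y t))"
        by (rule AE_I2) (simp add: d)
    qed
    have i: "integrable (leb T) (\<lambda>t. norm (dot T x t) powr enn2real s) \<longleftrightarrow> integrable (leb T) (\<lambda>t. norm (dot T y t) powr enn2real s)"
      by (rule Bochner_Integration.integrable_cong) (use d in auto)
    show ?thesis using y' m e i unfolding Lspace_def by auto
  qed
  ultimately show "x \<in> W1 T s" using y by (simp add: W1_def)
qed

text \<open>The library result only concerns intervals to the right of the point; the left-hand
  intervals are obtained by reflecting the integrand.\<close>

lemma Lebesgue_differentiation:
  fixes g :: "real \<Rightarrow> 'a::euclidean_space"
  assumes g: "integrable (leb T) g"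
    and \<xi>: "\<And>t. t \<in> {0..T} \<Longrightarrow> \<xi> t = \<xi> 0 + (LINT r|lebesgue_on {0..t}. g r)"
  shows "AE t in leb T. (\<xi> has_vector_derivative g t) (at t within {0..T})"
proof -
  \<comment> \<open>Extension by zero makes the integrand integrable over every interval, including
    those that leave [0,T].\<close>
  define f where "f t = (if t \<in> {0..T} then g t else 0)" for t
  have fU: "f integrable_on UNIV"
    unfolding f_def using integrable_on_lebesgue_on[OF g]
    by (simp only: Henstock_Kurzweil_Integration.integrable_restrict_UNIV) simp
  have f: "f integrable_on cbox a b" for a b :: real
    using fU integrable_on_subcbox by blast
  then have f': "(\<lambda>t. f (- t)) integrable_on cbox a b" for a b :: real
    using Henstock_Kurzweil_Integration.integrable_reflect_real[where f=f and a="-b" and b="-a"] f[of "-b" "-a"]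
    unfolding box_real minus_minus by blast
  obtain N where N: "negligible N" "\<And>x e. \<lbrakk>x \<notin> N; 0 < e\<rbrakk> \<Longrightarrow>
     \<exists>d>0. \<forall>h. 0 < h \<and> h < d \<longrightarrow> norm(integral {x..x + h} f /\<^sub>R h - f x) < e"
    using integrable_ccontinuous_explicit[of f] f by (auto simp: box_real)
  obtain N' where N': "negligible N'" "\<And>x e. \<lbrakk>x \<notin> N'; 0 < e\<rbrakk> \<Longrightarrow>
     \<exists>d>0. \<forall>h. 0 < h \<and> h < d \<longrightarrow> norm(integral {x..x + h} (\<lambda>t. f (-t)) /\<^sub>R h - f (-x)) < e"
    using integrable_ccontinuous_explicit[of "\<lambda>t. f (-t)"] f' by (auto simp: box_real)
  \<comment> \<open>The exceptional set of the reflected integrand has to be reflected back; a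
    differentiable image of a null set is null.\<close>
  have "negligible (uminus ` N')"
    by (rule negligible_differentiable_image_negligible[OF _ N'(1)])
       (auto intro: differentiable_on_minus differentiable_on_id[unfolded id_def] simp: differentiable_on_def)
  then have "negligible (N \<union> uminus ` N')" using N by (simp add: negligible_Un)
  then have null: "N \<union> uminus ` N' \<in> null_sets lebesgue" by (simp add: negligible_iff_null_sets)
  have \<xi>_diff: "\<xi> t - \<xi> s = integral {s..t} f" if "0 \<le> s" "s \<le> t" "t \<le> T" for s t
  proof -
    have 1: "integral {0..r} f = (LINT r|lebesgue_on {0..r}. g r)" if "r \<in> {0..T}" for r
    proof -
      have "integral {0..r} f = integral {0..r} g"
        by (rule Henstock_Kurzweil_Integration.integral_cong) (use that in \<open>auto simp: f_def\<close>)
      moreover have "integrable (lebesgue_on {0..r}) g"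
        by (rule integrable_subinterval[OF g]) (use that in auto)
      ultimately show ?thesis by (simp add: lebesgue_integral_eq_integral)
    qed
    have "integral {0..s} f + integral {s..t} f = integral {0..t} f"
      using f[of 0 t] that by (intro Henstock_Kurzweil_Integration.integral_combine) auto
    then have "integral {s..t} f = integral {0..t} f - integral {0..s} f"
      by (metis add_diff_cancel_left')
    then show ?thesis using 1[of s] 1[of t] \<xi>[of s] \<xi>[of t] that by simp
  qed
  have scale: "norm (I - h *\<^sub>R v) \<le> e * h" if "norm (I /\<^sub>R h - v) < e" "h > 0" for I v :: 'a and e h :: real
  proof -
    have "I - h *\<^sub>R v = h *\<^sub>R (I /\<^sub>R h - v)" using that by (simp add: algebra_simps)
    then have "norm (I - h *\<^sub>R v) = h * norm (I /\<^sub>R h - v)" using that by simp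
    then show ?thesis using that by (simp add: mult.commute mult_left_mono)
  qed
  have "(\<xi> has_vector_derivative g t) (at t within {0..T})"
    if t: "t \<in> {0..T}" "t \<notin> N \<union> uminus ` N'" for t
    unfolding has_vector_derivative_def has_derivative_within_alt
  proof (intro conjI allI impI)
    fix e :: real assume "e > 0"
    have "- t \<notin> N'" using t by (metis UnCI image_eqI minus_minus)
    obtain d1 where d1: "d1 > 0" "\<And>h. 0 < h \<Longrightarrow> h < d1 \<Longrightarrow> norm (integral {t..t + h} f /\<^sub>R h - f t) < e"
      using N(2)[of t e] t \<open>e > 0\<close> by blast
    obtain d2 where d2: "d2 > 0" "\<And>h. 0 < h \<Longrightarrow> h < d2 \<Longrightarrow> norm (integral {-t..-t + h} (\<lambda>t. f (-t)) /\<^sub>R h - f t) < e"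
      using N'(2)[OF \<open>- t \<notin> N'\<close> \<open>e > 0\<close>] by auto
    have ft: "f t = g t" using t by (simp add: f_def)
    show "\<exists>d>0. \<forall>y\<in>{0..T}. norm (y - t) < d \<longrightarrow>
        norm (\<xi> y - \<xi> t - (y - t) *\<^sub>R g t) \<le> e * norm (y - t)"
    proof (intro exI[of _ "min d1 d2"] conjI ballI impI)
      fix y assume y: "y \<in> {0..T}" "norm (y - t) < min d1 d2"
      consider "y = t" | "y > t" | "y < t" by linarith
      then show "norm (\<xi> y - \<xi> t - (y - t) *\<^sub>R g t) \<le> e * norm (y - t)"
      proof cases
        case 2
        then show ?thesis using scale[OF d1(2)[of "y - t"]] \<xi>_diff[of t y] y t ft by simp
      next
        case 3
        have "integral {-t..-t + (t - y)} (\<lambda>t. f (-t)) = \<xi> t - \<xi> y"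
          using Henstock_Kurzweil_Integration.integral_reflect_real[of t y f] \<xi>_diff[of y t] 3 y t by simp
        then have "norm ((\<xi> t - \<xi> y) - (t - y) *\<^sub>R g t) \<le> e * (t - y)"
          using scale[OF d2(2)[of "t - y"]] 3 y ft by simp
        moreover have "norm ((\<xi> t - \<xi> y) - (t - y) *\<^sub>R g t) = norm (\<xi> y - \<xi> t - (y - t) *\<^sub>R g t)"
          by (subst norm_minus_cancel[symmetric]) (simp add: algebra_simps)
        ultimately show ?thesis using 3 by simp
      qed simp
    qed (use d1 d2 in simp)
  qed (rule bounded_linear_scaleR_left)
  then have "{t. \<not> (t \<in> {0..T} \<longrightarrow> (\<xi> has_vector_derivative g t) (at t within {0..T}))} \<subseteq> N \<union> uminus ` N'"
    by blast
  then have "AE t in lebesgue. t \<in> {0..T} \<longrightarrow> (\<xi> has_vector_derivative g t) (at t within {0..T})"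
    using null by (intro AE_I'[of "N \<union> uminus ` N'"]) auto
  then show ?thesis by (simp add: AE_restrict_space_iff)
qed

text \<open>Boundedness of \<open>g\<close> makes the primitive Lipschitz, hence absolutely
  continuous. This is how a limit trajectory, known at first only through an integral equation,
  enters W^{1,infinity}.\<close>

lemma W1_infinity_primitive:
  fixes g :: "real \<Rightarrow> 'a::euclidean_space"
  assumes T: "0 < T" and g: "g \<in> Lspace T \<infinity>"
    and \<xi>: "\<And>t. t \<in> {0..T} \<Longrightarrow> \<xi> t = \<xi> 0 + (LINT r|lebesgue_on {0..t}. g r)"
  shows "\<xi> \<in> W1 T \<infinity>" and "AE t in leb T. dot T \<xi> t = g t"
proof -
  have gi: "integrable (leb T) g" by (rule Lspace_infinity_integrable[OF g])
  have gm: "g \<in> borel_measurable (leb T)" using g by (simp add: Lspace_def)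
  have der: "AE t in leb T. (\<xi> has_vector_derivative g t) (at t within {0..T})"
    by (rule Lebesgue_differentiation[OF gi \<xi>])
  have "AE t in leb T. t \<in> {0..T}" by (rule AE_I2) simp
  with der show dot: "AE t in leb T. dot T \<xi> t = g t"
    by eventually_elim (simp add: dot_def vector_derivative_within_closed_interval[OF T])
  obtain M' where M': "AE t in leb T. norm (g t) \<le> M'"
    using g unfolding Lspace_infinity_iff by blast
  \<comment> \<open>Made strictly positive, since e / M serves as the modulus of absolute
    continuity.\<close>
  define M where "M = \<bar>M'\<bar> + 1"
  have M: "AE t in leb T. norm (g t) \<le> M" "M > 0" using M' by (auto simp: M_def elim!: eventually_mono)
  have lip: "norm (\<xi> t - \<xi> s) \<le> M * (t - s)" if st: "0 \<le> s" "s \<le> t" "t \<le> T" for s t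
  proof -
    interpret finite_measure "lebesgue_on {s..t}" by (rule finite_measure_lebesgue_on) simp
    have "\<xi> t - \<xi> s = (LINT r|lebesgue_on {0..t}. g r) - (LINT r|lebesgue_on {0..s}. g r)"
      using \<xi>[of s] \<xi>[of t] st by simp
    also have "\<dots> = (LINT r|lebesgue_on {s..t}. g r)"
      using integral_combine[of 0 t g s] integrable_subinterval[OF gi, of 0 t] st by simp
    finally have "norm (\<xi> t - \<xi> s) \<le> (LINT r|lebesgue_on {s..t}. norm (g r))" by simp
    also have "\<dots> \<le> (LINT r|lebesgue_on {s..t}. M)"
    proof (rule integral_mono_AE)
      show "integrable (lebesgue_on {s..t}) (\<lambda>r. norm (g r))"
        using integrable_subinterval[OF gi, of s t] st by simp
      show "AE r in lebesgue_on {s..t}. norm (g r) \<le> M"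
        using M(1) st by (auto simp: AE_restrict_space_iff elim!: eventually_mono)
    qed simp
    also have "\<dots> = M * (t - s)" using st by (simp add: measure_restrict_space)
    finally show ?thesis .
  qed
  have "abs_continuous_on 0 T \<xi>"
    unfolding abs_continuous_on_def
  proof (intro allI impI)
    fix e :: real assume e: "e > 0"
    show "\<exists>d>0. \<forall>(N::nat) l r. (\<forall>i<N. 0 \<le> l i \<and> l i \<le> r i \<and> r i \<le> T) \<and>
        disjoint_family_on (\<lambda>i. {l i<..<r i}) {..<N} \<and> (\<Sum>i<N. r i - l i) < d \<longrightarrow>
        (\<Sum>i<N. norm (\<xi> (r i) - \<xi> (l i))) < e"
    proof (intro exI[of _ "e / M"] conjI allI impI; (elim conjE)?)
      fix N :: nat and l r :: "nat \<Rightarrow> real"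
      assume lr: "\<forall>i<N. 0 \<le> l i \<and> l i \<le> r i \<and> r i \<le> T" and s: "(\<Sum>i<N. r i - l i) < e / M"
      have "(\<Sum>i<N. norm (\<xi> (r i) - \<xi> (l i))) \<le> (\<Sum>i<N. M * (r i - l i))"
        using lr lip by (intro sum_mono) auto
      also have "\<dots> = M * (\<Sum>i<N. r i - l i)" by (simp add: sum_distrib_left)
      also have "\<dots> < e" using s M by (simp add: field_simps)
      finally show "(\<Sum>i<N. norm (\<xi> (r i) - \<xi> (l i))) < e" .
    qed (use e M in simp)
  qed
  moreover have "AE t in leb T. \<xi> differentiable (at t within {0..T})"
    using der by eventually_elim (rule differentiableI_vector)
  moreover have "dot T \<xi> \<in> Lspace T \<infinity>"
    unfolding Lspace_infinity_iff
  proof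
    show "dot T \<xi> \<in> borel_measurable (leb T)"
    proof (rule measurable_leb_AE_cong[OF gm])
      show "AE t in leb T. g t = dot T \<xi> t" using dot by eventually_elim simp
    qed
    show "\<exists>M. AE t in leb T. norm (dot T \<xi> t) \<le> M"
    proof
      show "AE t in leb T. norm (dot T \<xi> t) \<le> M"
        using dot M(1) by eventually_elim simp
    qed
  qed
  ultimately show "\<xi> \<in> W1 T \<infinity>" by (simp add: W1_def)
qed


section \<open>Locally Lipschitz integrands\<close>

lemma convex_on_bounded_Lipschitz:
  fixes f :: "'a::real_normed_vector \<Rightarrow> real"
  assumes f: "convex_on UNIV f" and b: "\<And>y. norm y \<le> R + 1 \<Longrightarrow> \<bar>f y\<bar> \<le> \<gamma>"
    and xy: "norm x \<le> R" "norm y \<le> R"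
  shows "\<bar>f x - f y\<bar> \<le> 2 * \<gamma> * norm (x - y)"
proof -
  \<comment> \<open>Extend the segment from \<open>x\<close> through \<open>y\<close> by length \<open>1\<close> and use convexity along it.\<close>
  have *: "f y - f x \<le> 2 * \<gamma> * norm (x - y)" if xy: "norm x \<le> R" "norm y \<le> R" for x y
  proof (cases "x = y")
    case False
    define d where "d = norm (y - x)"
    have d: "d > 0" using False by (simp add: d_def)
    \<comment> \<open>The point y divides the segment from x to z, of length d + 1, in the ratio d :
      1.\<close>
    define \<theta> where "\<theta> = d / (1 + d)"
    define z where "z = y + (1 / d) *\<^sub>R (y - x)"
    have \<theta>: "0 \<le> \<theta>" "\<theta> \<le> 1" "\<theta> \<le> d" using d by (auto simp: \<theta>_def field_simps)
    have "norm z \<le> norm y + norm ((1 / d) *\<^sub>R (y - x))" unfolding z_def by (rule norm_triangle_ineq)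
    also have "\<dots> \<le> R + 1" using d xy by (simp add: d_def)
    finally have z: "\<bar>f z\<bar> \<le> \<gamma>" by (rule b)
    have x: "\<bar>f x\<bar> \<le> \<gamma>" using b xy by auto
    have "(1 + d) *\<^sub>R ((1 - \<theta>) *\<^sub>R x + \<theta> *\<^sub>R z) = x + d *\<^sub>R z"
      using d by (simp add: \<theta>_def algebra_simps scaleR_add_left[symmetric] divide_simps)
    also have "\<dots> = (1 + d) *\<^sub>R y" using d by (simp add: z_def algebra_simps)
    finally have "y = (1 - \<theta>) *\<^sub>R x + \<theta> *\<^sub>R z" using d by simp
    then have "f y \<le> (1 - \<theta>) * f x + \<theta> * f z"
      using convex_onD[OF f \<theta>(1,2)] by simp
    then have "f y - f x \<le> \<theta> * (f z - f x)" by (simp add: algebra_simps)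
    also have "\<dots> \<le> \<theta> * (2 * \<gamma>)" using x z \<theta> by (intro mult_left_mono) auto
    also have "\<dots> \<le> d * (2 * \<gamma>)" using \<theta> x by (intro mult_right_mono) auto
    finally show ?thesis by (simp add: d_def norm_minus_commute mult.commute)
  qed simp
  show ?thesis using *[of x y] *[of y x] xy by (simp add: norm_minus_commute abs_le_iff)
qed

text \<open>Along a simple approximation of \<open>z\<close> only finitely many sections
  \<open>K y\<close> occur, each measurable in t; continuity in y carries measurability to the
  limit, outside the null set where continuity fails.\<close>

lemma caratheodory_compose_measurable:
  assumes K: "caratheodory T K" and z: "z \<in> borel_measurable (leb T)"
  shows "(\<lambda>t. K (z t) t) \<in> borel_measurable (leb T)"
proof -
  obtain F where F: "\<And>i. simple_function (leb T) (F i)"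
    "\<And>t. t \<in> space (leb T) \<Longrightarrow> (\<lambda>i. F i t) \<longlonglongrightarrow> z t"
    using borel_measurable_implies_sequence_metric[OF z] by metis
  have Km: "(\<lambda>t. K y t) \<in> borel_measurable (leb T)" for y
    using K unfolding caratheodory_def by blast
  have KF: "(\<lambda>t. K (F i t) t) \<in> borel_measurable (leb T)" for i
  proof (rule measurable_compose_countable'[where I="F i ` space (leb T)"])
    show "F i \<in> leb T \<rightarrow>\<^sub>M count_space (F i ` space (leb T))"
    proof -
      have "F i \<in> leb T \<rightarrow>\<^sub>M count_space UNIV" by (rule measurable_simple_function[OF F(1)])
      then show ?thesis by (auto simp: measurable_def)
    qed
    show "countable (F i ` space (leb T))"
      using F(1)[of i] by (simp add: simple_function_def countable_finite)
  qed (rule Km)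
  have "AE t in leb T. continuous_on UNIV (\<lambda>y. K y t)" using K by (simp add: caratheodory_def)
  then obtain N where N: "N \<in> null_sets (leb T)"
    "{t \<in> space (leb T). \<not> continuous_on UNIV (\<lambda>y. K y t)} \<subseteq> N"
    by (auto simp: eventually_ae_filter)
  have "(\<lambda>t. if t \<in> N then 0 else K (z t) t) \<in> borel_measurable (leb T)"
  proof (rule borel_measurable_LIMSEQ_metric)
    fix i
    have "N \<in> sets (leb T)" using N by auto
    then have "{t \<in> space (leb T). t \<in> N} \<in> sets (leb T)" by (simp only: Collect_conj_eq Collect_mem_eq sets.Int_space_eq1)
    then show "(\<lambda>t. if t \<in> N then 0 else K (F i t) t) \<in> borel_measurable (leb T)"
      using KF by (intro measurable_If) auto
  next
    fix t assume t: "t \<in> space (leb T)"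
    show "(\<lambda>i. if t \<in> N then 0 else K (F i t) t) \<longlonglongrightarrow> (if t \<in> N then 0 else K (z t) t)"
    proof (cases "t \<in> N")
      case False
      then have "continuous_on UNIV (\<lambda>y. K y t)" using t N by blast
      then have "(\<lambda>i. K (F i t) t) \<longlonglongrightarrow> K (z t) t"
        by (rule continuous_on_tendsto_compose[OF _ F(2)[OF t]]) auto
      then show ?thesis using False by simp
    qed simp
  qed
  then show ?thesis
  proof (rule measurable_leb_AE_cong)
    show "AE t in leb T. (if t \<in> N then 0 else K (z t) t) = K (z t) t"
      using AE_not_in[OF N(1)] by eventually_elim simp
  qed
qed

text \<open>Isolated because it survives differences and the assembly of vectors, whereas convexity
  does not survive differences. The null set is chosen before the points y and y', so that arbitrary
  processes may be inserted.\<close>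

definition locally_Lipschitz_integrand ::
    "real \<Rightarrow> ('y::euclidean_space \<Rightarrow> real \<Rightarrow> 'a::euclidean_space) \<Rightarrow> bool" where
  "locally_Lipschitz_integrand T K \<longleftrightarrow>
     (\<forall>z\<in>borel_measurable (leb T). (\<lambda>t. K (z t) t) \<in> borel_measurable (leb T)) \<and>
     (\<forall>R. \<exists>L\<ge>0. AE t in leb T. \<forall>y y'. norm y \<le> R \<longrightarrow> norm y' \<le> R \<longrightarrow>
        norm (K y t) \<le> L \<and> norm (K y t - K y' t) \<le> L * norm (y - y'))"

lemma locally_Lipschitz_integrandD:
  assumes "locally_Lipschitz_integrand T K"
  obtains L where "L \<ge> 0" "AE t in leb T. \<forall>y y'. norm y \<le> R \<longrightarrow> norm y' \<le> R \<longrightarrow>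
        norm (K y t) \<le> L \<and> norm (K y t - K y' t) \<le> L * norm (y - y')"
  using assms unfolding locally_Lipschitz_integrand_def by meson

lemma locally_Lipschitz_integrand_diff:
  fixes K K' :: "'y::euclidean_space \<Rightarrow> real \<Rightarrow> 'a::euclidean_space"
  assumes "locally_Lipschitz_integrand T K" "locally_Lipschitz_integrand T K'"
  shows "locally_Lipschitz_integrand T (\<lambda>y t. K y t - K' y t)"
  unfolding locally_Lipschitz_integrand_def
proof (intro conjI allI ballI)
  fix R
  obtain L where L: "L \<ge> 0" "AE t in leb T. \<forall>y y'. norm y \<le> R \<longrightarrow> norm y' \<le> R \<longrightarrow>
        norm (K y t) \<le> L \<and> norm (K y t - K y' t) \<le> L * norm (y - y')"
    using locally_Lipschitz_integrandD[OF assms(1)] .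
  obtain L' where L': "L' \<ge> 0" "AE t in leb T. \<forall>y y'. norm y \<le> R \<longrightarrow> norm y' \<le> R \<longrightarrow>
        norm (K' y t) \<le> L' \<and> norm (K' y t - K' y' t) \<le> L' * norm (y - y')"
    using locally_Lipschitz_integrandD[OF assms(2)] .
  have "AE t in leb T. \<forall>y y'. norm y \<le> R \<longrightarrow> norm y' \<le> R \<longrightarrow>
        norm (K y t - K' y t) \<le> L + L' \<and>
        norm ((K y t - K' y t) - (K y' t - K' y' t)) \<le> (L + L') * norm (y - y')"
    using L(2) L'(2)
  proof eventually_elim
    case (elim t)
    show ?case
    proof (intro allI impI conjI)
      fix y y' :: 'y assume y: "norm y \<le> R" "norm y' \<le> R"
      have a: "norm (K y t) \<le> L" "norm (K y t - K y' t) \<le> L * norm (y - y')"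
        "norm (K' y t) \<le> L'" "norm (K' y t - K' y' t) \<le> L' * norm (y - y')"
        using elim y by blast+
      show "norm (K y t - K' y t) \<le> L + L'"
        using a norm_triangle_ineq4[of "K y t" "K' y t"] by linarith
      have "(K y t - K' y t) - (K y' t - K' y' t) = (K y t - K y' t) - (K' y t - K' y' t)" by simp
      then have "norm ((K y t - K' y t) - (K y' t - K' y' t)) \<le> norm (K y t - K y' t) + norm (K' y t - K' y' t)"
        using norm_triangle_ineq4 by metis
      then show "norm ((K y t - K' y t) - (K y' t - K' y' t)) \<le> (L + L') * norm (y - y')"
        using a unfolding distrib_right by linarith
    qed
  qed
  then show "\<exists>L\<ge>0. AE t in leb T. \<forall>y y'. norm y \<le> R \<longrightarrow> norm y' \<le> R \<longrightarrow>
        norm (K y t - K' y t) \<le> L \<and> norm ((K y t - K' y t) - (K y' t - K' y' t)) \<le> L * norm (y - y')"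
    using L(1) L'(1) by (intro exI[of _ "L + L'"]) auto
qed (use assms in \<open>auto simp: locally_Lipschitz_integrand_def intro!: borel_measurable_diff\<close>)

text \<open>Finitely many null sets are merged, and the l1 norm dominates the Euclidean one; hence
  the sum of the componentwise constants.\<close>

lemma locally_Lipschitz_integrand_vec:
  fixes K :: "'i::finite \<Rightarrow> 'y::euclidean_space \<Rightarrow> real \<Rightarrow> real"
  assumes K: "\<And>i. locally_Lipschitz_integrand T (K i)"
  shows "locally_Lipschitz_integrand T (\<lambda>y t. \<chi> i. K i y t)"
  unfolding locally_Lipschitz_integrand_def
proof (intro conjI allI ballI)
  fix z :: "real \<Rightarrow> 'y" assume z: "z \<in> borel_measurable (leb T)"
  have "(\<lambda>t. K i (z t) t) \<in> borel_measurable (leb T)" for i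
    using K z by (auto simp: locally_Lipschitz_integrand_def)
  then show "(\<lambda>t. \<chi> i. K i (z t) t) \<in> borel_measurable (leb T)"
    by (subst borel_measurable_euclidean_space) (auto simp: Basis_vec_def inner_axis)
next
  fix R
  have "\<forall>i. \<exists>L\<ge>0. AE t in leb T. \<forall>y y'. norm y \<le> R \<longrightarrow> norm y' \<le> R \<longrightarrow>
        norm (K i y t) \<le> L \<and> norm (K i y t - K i y' t) \<le> L * norm (y - y')"
    using K unfolding locally_Lipschitz_integrand_def by blast
  from choice[OF this] obtain L where L: "\<And>i. L i \<ge> 0" "\<And>i. AE t in leb T. \<forall>y y'. norm y \<le> R \<longrightarrow> norm y' \<le> R \<longrightarrow>
        norm (K i y t) \<le> L i \<and> norm (K i y t - K i y' t) \<le> L i * norm (y - y')"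
    by blast
  have "AE t in leb T. \<forall>i. \<forall>y y'. norm y \<le> R \<longrightarrow> norm y' \<le> R \<longrightarrow>
        norm (K i y t) \<le> L i \<and> norm (K i y t - K i y' t) \<le> L i * norm (y - y')"
    by (rule eventually_all_finite) (rule L(2))
  then have "AE t in leb T. \<forall>y y'. norm y \<le> R \<longrightarrow> norm y' \<le> R \<longrightarrow>
        norm (\<chi> i. K i y t) \<le> sum L UNIV \<and>
        norm ((\<chi> i. K i y t) - (\<chi> i. K i y' t)) \<le> sum L UNIV * norm (y - y')"
  proof eventually_elim
    case (elim t)
    show ?case
    proof (intro allI impI conjI)
      fix y y' :: 'y assume y: "norm y \<le> R" "norm y' \<le> R"
      have "norm (\<chi> i. K i y t) \<le> (\<Sum>i\<in>UNIV. \<bar>K i y t\<bar>)"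
        using norm_le_l1_cart[of "\<chi> i. K i y t"] by simp
      also have "\<dots> \<le> sum L UNIV" using elim y by (intro sum_mono) fastforce
      finally show "norm (\<chi> i. K i y t) \<le> sum L UNIV" .
      have "norm ((\<chi> i. K i y t) - (\<chi> i. K i y' t)) \<le> (\<Sum>i\<in>UNIV. \<bar>K i y t - K i y' t\<bar>)"
        using norm_le_l1_cart[of "(\<chi> i. K i y t) - (\<chi> i. K i y' t)"] by simp
      also have "\<dots> \<le> (\<Sum>i\<in>UNIV. L i * norm (y - y'))" using elim y by (intro sum_mono) fastforce
      finally show "norm ((\<chi> i. K i y t) - (\<chi> i. K i y' t)) \<le> sum L UNIV * norm (y - y')"
        by (simp add: sum_distrib_right)
    qed
  qed
  then show "\<exists>L\<ge>0. AE t in leb T. \<forall>y y'. norm y \<le> R \<longrightarrow> norm y' \<le> R \<longrightarrow>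
        norm (\<chi> i. K i y t) \<le> L \<and> norm ((\<chi> i. K i y t) - (\<chi> i. K i y' t)) \<le> L * norm (y - y')"
    using L(1) by (intro exI[of _ "sum L UNIV"]) (auto simp: sum_nonneg)
qed

lemma locally_Lipschitz_integrands:
  assumes data: "data_assumptions P" and K: "K \<in> integrands P"
  shows "locally_Lipschitz_integrand (hor P) K"
  unfolding locally_Lipschitz_integrand_def
proof (intro conjI allI ballI)
  fix z :: "real \<Rightarrow> (real^'a) \<times> (real^'b)" assume "z \<in> borel_measurable (leb (hor P))"
  then show "(\<lambda>t. K (z t) t) \<in> borel_measurable (leb (hor P))"
    using data K by (intro caratheodory_compose_measurable) (auto simp: data_assumptions_def)
next
  fix R :: real
  \<comment> \<open>The data bound is phrased for |a| + |b|, which is at most twice |(a,b)|; the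
    added 1 is the enlargement of the ball that the Lipschitz estimate for convex functions
    demands.\<close>
  define S where "S = 2 * (\<bar>R\<bar> + 1)"
  have "\<forall>R>0. \<exists>\<gamma>>0. AE t in leb (hor P). \<forall>K\<in>integrands P. \<forall>a b. norm a + norm b \<le> R \<longrightarrow>
        \<bar>K (a, b) t\<bar> \<le> \<gamma> \<and> (\<forall>v\<in>subdifferential (\<lambda>y. K y t) (a, b). norm v \<le> \<gamma>)"
    using data by (simp add: data_assumptions_def)
  moreover have "S > 0" by (simp add: S_def)
  ultimately obtain \<gamma> where \<gamma>: "\<gamma> > 0"
    "AE t in leb (hor P). \<forall>K\<in>integrands P. \<forall>a b. norm a + norm b \<le> S \<longrightarrow>
        \<bar>K (a, b) t\<bar> \<le> \<gamma> \<and> (\<forall>v\<in>subdifferential (\<lambda>y. K y t) (a, b). norm v \<le> \<gamma>)"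
    by blast
  have "AE t in leb (hor P). t \<in> {0..hor P}" by (rule AE_I2) simp
  with \<gamma>(2) have "AE t in leb (hor P). \<forall>y y'. norm y \<le> R \<longrightarrow> norm y' \<le> R \<longrightarrow>
      norm (K y t) \<le> 2 * \<gamma> \<and> norm (K y t - K y' t) \<le> 2 * \<gamma> * norm (y - y')"
  proof eventually_elim
    case (elim t)
    have b: "\<bar>K y t\<bar> \<le> \<gamma>" if "norm y \<le> \<bar>R\<bar> + 1" for y
    proof -
      have "norm (fst y) + norm (snd y) \<le> S"
        using norm_fst_le[of "fst y" "snd y"] norm_snd_le[of "snd y" "fst y"] that
        by (simp add: S_def)
      then have "\<bar>K (fst y, snd y) t\<bar> \<le> \<gamma>" using elim(1) K by blast
      then show ?thesis by simp
    qed
    have c: "convex_on UNIV (\<lambda>y. K y t)" using data K elim(2) by (auto simp: data_assumptions_def)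
    show ?case
    proof (intro allI impI conjI)
      fix y y' :: "(real^'a) \<times> (real^'b)" assume y: "norm y \<le> R" "norm y' \<le> R"
      have "norm y \<le> \<bar>R\<bar> + 1" using y by linarith
      then show "norm (K y t) \<le> 2 * \<gamma>" using b[of y] \<gamma>(1) by simp
      show "norm (K y t - K y' t) \<le> 2 * \<gamma> * norm (y - y')"
        using convex_on_bounded_Lipschitz[OF c b, where x=y and y=y'] y by auto
    qed
  qed
  then show "\<exists>L\<ge>0. AE t in leb (hor P). \<forall>y y'. norm y \<le> R \<longrightarrow> norm y' \<le> R \<longrightarrow>
        norm (K y t) \<le> L \<and> norm (K y t - K y' t) \<le> L * norm (y - y')"
    using \<gamma>(1) by (intro exI[of _ "2 * \<gamma>"]) auto
qed

lemma locally_Lipschitz_F_of: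
  assumes data: "data_assumptions P" shows "locally_Lipschitz_integrand (hor P) (F_of P)"
proof -
  have "locally_Lipschitz_integrand (hor P) (\<lambda>y t. \<chi> i. G_of P i y t - H_of P i y t)"
    by (intro locally_Lipschitz_integrand_vec locally_Lipschitz_integrand_diff
         locally_Lipschitz_integrands[OF data]) (auto simp: integrands_def)
  moreover have "F_of P = (\<lambda>y t. \<chi> i. G_of P i y t - H_of P i y t)"
    by (intro ext) (simp add: F_of_def)
  ultimately show ?thesis by simp
qed

lemma locally_Lipschitz_Xi_of:
  assumes data: "data_assumptions P" and s: "s \<in> mixed_idx P"
  shows "locally_Lipschitz_integrand (hor P) (Xi_of P s)"
proof -
  have "locally_Lipschitz_integrand (hor P) (\<lambda>y t. p_of P s y t - q_of P s y t)"
    using s by (intro locally_Lipschitz_integrand_diff locally_Lipschitz_integrands[OF data])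
      (auto simp: integrands_def)
  moreover have "Xi_of P s = (\<lambda>y t. p_of P s y t - q_of P s y t)"
    by (intro ext) (simp add: Xi_of_def)
  ultimately show ?thesis by simp
qed

section \<open>Superposition with essentially bounded functions\<close>

lemma locally_Lipschitz_compose_Lspace:
  assumes K: "locally_Lipschitz_integrand T K" and z: "z \<in> Lspace T \<infinity>"
  shows "(\<lambda>t. K (z t) t) \<in> Lspace T \<infinity>"
proof -
  obtain R where R: "AE t in leb T. norm (z t) \<le> R" and m: "z \<in> borel_measurable (leb T)"
    using z unfolding Lspace_infinity_iff by blast
  obtain L where L: "AE t in leb T. \<forall>y y'. norm y \<le> R \<longrightarrow> norm y' \<le> R \<longrightarrow>
        norm (K y t) \<le> L \<and> norm (K y t - K y' t) \<le> L * norm (y - y')"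
    using locally_Lipschitz_integrandD[OF K] by blast
  have "AE t in leb T. norm (K (z t) t) \<le> L" using R L by eventually_elim blast
  moreover have "(\<lambda>t. K (z t) t) \<in> borel_measurable (leb T)"
    using K m by (auto simp: locally_Lipschitz_integrand_def)
  ultimately show ?thesis unfolding Lspace_infinity_iff by blast
qed

text \<open>On a common essential ball superposition is Lipschitz in L^1 with the pointwise
  constant, so no almost everywhere convergent subsequence has to be extracted.\<close>

lemma locally_Lipschitz_compose_L1_tendsto:
  assumes K: "locally_Lipschitz_integrand T K"
    and zm: "\<And>l. z l \<in> borel_measurable (leb T)" "z' \<in> borel_measurable (leb T)"
    and R: "\<And>l. AE t in leb T. norm (z l t) \<le> R" "AE t in leb T. norm (z' t) \<le> R"
    and tends: "(\<lambda>l. LINT t|leb T. norm (z l t - z' t)) \<longlonglongrightarrow> 0"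
  shows "(\<lambda>l. LINT t|leb T. norm (K (z l t) t - K (z' t) t)) \<longlonglongrightarrow> 0"
proof -
  obtain L where L: "L \<ge> 0" "AE t in leb T. \<forall>y y'. norm y \<le> R \<longrightarrow> norm y' \<le> R \<longrightarrow>
        norm (K y t) \<le> L \<and> norm (K y t - K y' t) \<le> L * norm (y - y')"
    using locally_Lipschitz_integrandD[OF K] .
  have Ls: "z l \<in> Lspace T \<infinity>" "z' \<in> Lspace T \<infinity>" for l
    using zm R unfolding Lspace_infinity_iff by blast+
  have le: "(LINT t|leb T. norm (K (z l t) t - K (z' t) t)) \<le> L * (LINT t|leb T. norm (z l t - z' t))" for l
  proof -
    have "(LINT t|leb T. norm (K (z l t) t - K (z' t) t)) \<le> (LINT t|leb T. L * norm (z l t - z' t))"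
    proof (rule integral_mono_AE)
      show "AE t in leb T. norm (K (z l t) t - K (z' t) t) \<le> L * norm (z l t - z' t)"
        using L(2) R(1)[of l] R(2) by eventually_elim blast
      show "integrable (leb T) (\<lambda>t. norm (K (z l t) t - K (z' t) t))"
        by (intro integrable_norm Bochner_Integration.integrable_diff Lspace_infinity_integrable
            locally_Lipschitz_compose_Lspace[OF K] Ls)
      show "integrable (leb T) (\<lambda>t. L * norm (z l t - z' t))"
        by (intro integrable_mult_right integrable_norm Bochner_Integration.integrable_diff
            Lspace_infinity_integrable Ls)
    qed
    then show ?thesis by simp
  qed
  show ?thesis
  proof (rule tendsto_sandwich[OF _ _ tendsto_const])
    show "(\<lambda>l. L * (LINT t|leb T. norm (z l t - z' t))) \<longlonglongrightarrow> 0"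
      using tendsto_mult_right_zero[OF tends] .
  qed (use le in auto)
qed


section \<open>Stability of trajectories\<close>

lemma Gronwall:
  fixes v :: "real \<Rightarrow> real"
  assumes cont: "continuous_on {0..T} v" and nn: "0 \<le> A" "0 \<le> L"
    and le: "\<And>t. t \<in> {0..T} \<Longrightarrow> v t \<le> A + L * (LINT s|lebesgue_on {0..t}. v s)"
    and v: "\<And>t. t \<in> {0..T} \<Longrightarrow> 0 \<le> v t" and t: "t \<in> {0..T}"
  shows "v t \<le> 2 * A * exp ((2 * L + 1) * T)"
proof -
  \<comment> \<open>Bounding the maximum \<open>M\<close> of \<open>exp (- k * s) * v s\<close> for \<open>k > 2 * L\<close> lets the integral term be absorbed.\<close>
  define k where "k = 2 * L + 1"
  have k: "k > 0" "L \<le> k / 2" using nn by (auto simp: k_def)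
  have "continuous_on {0..T} (\<lambda>s. exp (- k * s) * v s)" using cont by (intro continuous_intros)
  then obtain s where s: "s \<in> {0..T}" "\<And>r. r \<in> {0..T} \<Longrightarrow> exp (- k * r) * v r \<le> exp (- k * s) * v s"
    using continuous_attains_sup[of "{0..T}" "\<lambda>s. exp (- k * s) * v s"] t by auto
  define M where "M = exp (- k * s) * v s"
  have M0: "M \<ge> 0" using s v by (simp add: M_def)
  have vM: "v r \<le> M * exp (k * r)" if "r \<in> {0..T}" for r
    using s(2)[OF that] by (simp add: M_def exp_minus field_simps)
  have "((\<lambda>r. exp (k * r)) has_integral (exp (k * s) / k - exp (k * 0) / k)) {0..s}"
    using s k by (intro fundamental_theorem_of_calculus)
      (auto intro!: derivative_eq_intros simp: has_real_derivative_iff_has_vector_derivative[symmetric])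
  then have I: "integral {0..s} (\<lambda>r. exp (k * r)) = (exp (k * s) - 1) / k"
    by (simp add: integral_unique diff_divide_distrib)
  have ie: "integrable (lebesgue_on {0..s}) (\<lambda>r. exp (k * r))"
    by (intro continuous_imp_integrable_real continuous_intros)
  have iv: "integrable (lebesgue_on {0..s}) v"
    using cont s by (intro continuous_imp_integrable_real) (auto intro: continuous_on_subset)
  have "(LINT r|lebesgue_on {0..s}. v r) \<le> (LINT r|lebesgue_on {0..s}. M * exp (k * r))"
    using ie iv vM s by (intro integral_mono) auto
  also have "\<dots> = M * ((exp (k * s) - 1) / k)"
    using I ie by (simp add: lebesgue_integral_eq_integral)
  also have "\<dots> \<le> M * (exp (k * s) / k)"
    using M0 k by (intro mult_left_mono divide_right_mono) auto
  finally have "L * (LINT r|lebesgue_on {0..s}. v r) \<le> L * (M * (exp (k * s) / k))"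
    using nn by (intro mult_left_mono)
  also have "\<dots> \<le> (k / 2) * (M * (exp (k * s) / k))"
    using k M0 by (intro mult_right_mono) auto
  also have "\<dots> = M / 2 * exp (k * s)" using k by simp
  finally have "v s \<le> A + M / 2 * exp (k * s)" using le[OF s(1)] by linarith
  moreover have "v s = M * exp (k * s)" by (simp add: M_def exp_minus)
  ultimately have "M / 2 * exp (k * s) \<le> A" by simp
  moreover have "M / 2 * 1 \<le> M / 2 * exp (k * s)" using M0 s k by (intro mult_left_mono) auto
  ultimately have "M \<le> 2 * A" by simp
  then have "v t \<le> 2 * A * exp (k * t)"
    using vM[OF t] by (meson exp_ge_zero mult_right_mono order_trans)
  also have "\<dots> \<le> 2 * A * exp (k * T)" using t k nn by (intro mult_left_mono) auto
  finally show ?thesis by (simp add: k_def)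
qed

lemma AE_leb_subinterval:
  assumes "AE t in leb T. Q t" "s \<le> T"
  shows "AE t in lebesgue_on {0..s}. Q t"
proof -
  have "AE t in lebesgue. t \<in> {0..T} \<longrightarrow> Q t" using assms(1) by (simp add: AE_restrict_space_iff)
  then have "AE t in lebesgue. t \<in> {0..s} \<longrightarrow> Q t"
    by eventually_elim (use assms(2) in auto)
  then show ?thesis by (simp add: AE_restrict_space_iff)
qed

lemma integrable_compose_pair:
  fixes K :: "'a::euclidean_space \<times> 'b::euclidean_space \<Rightarrow> real \<Rightarrow> 'c::euclidean_space"
  assumes K: "locally_Lipschitz_integrand T K" and xu: "x \<in> Lspace T \<infinity>" "u \<in> Lspace T \<infinity>"
  shows "integrable (leb T) (\<lambda>t. K (x t, u t) t)" "(\<lambda>t. (x t, u t)) \<in> Lspace T \<infinity>"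
proof -
  obtain M M' where M: "AE t in leb T. norm (x t) \<le> M" "AE t in leb T. norm (u t) \<le> M'"
    and m: "x \<in> borel_measurable (leb T)" "u \<in> borel_measurable (leb T)"
    using xu unfolding Lspace_infinity_iff by blast
  have "AE t in leb T. norm (x t, u t) \<le> M + M'"
    using M by eventually_elim (use norm_Pair_le add_mono order_trans in blast)
  moreover have "(\<lambda>t. (x t, u t)) \<in> borel_measurable (leb T)" using m by (rule borel_measurable_Pair)
  ultimately show "(\<lambda>t. (x t, u t)) \<in> Lspace T \<infinity>" unfolding Lspace_infinity_iff by blast
  then show "integrable (leb T) (\<lambda>t. K (x t, u t) t)"
    using locally_Lipschitz_compose_Lspace[OF K] Lspace_infinity_integrable by blast
qed

lemma continuous_on_Lspace_infinity:
  fixes x :: "real \<Rightarrow> 'a::euclidean_space"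
  assumes "continuous_on {0..T} x" shows "x \<in> Lspace T \<infinity>"
proof -
  have "compact (x ` {0..T})" using assms by (intro compact_continuous_image) auto
  then obtain M where "\<And>t. t \<in> {0..T} \<Longrightarrow> norm (x t) \<le> M"
    by (meson bounded_iff compact_imp_bounded imageI)
  then have "AE t in leb T. norm (x t) \<le> M" by (intro AE_I2) simp
  then show ?thesis
    using assms borel_measurable_integrable continuous_imp_integrable_real
    unfolding Lspace_infinity_iff by blast
qed

lemma W1_Lspace_infinity: "x \<in> W1 T s \<Longrightarrow> x \<in> Lspace T \<infinity>"
  by (intro continuous_on_Lspace_infinity abs_continuous_on_continuous) (simp add: W1_def)

text \<open>The difference of the derivatives is the difference of the two defects plus F(x,u,t) -
  F(y,v,t). The Lipschitz bound splits the latter into a control part, which joins the error, and a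
  state part, which Gronwall's inequality absorbs. \<open>C\<close> is fixed before the
  trajectories, hence uniform along a sequence.\<close>

lemma state_estimate:
  fixes F :: "'a::euclidean_space \<times> 'b::euclidean_space \<Rightarrow> real \<Rightarrow> 'a"
  assumes T: "0 < T" and F: "locally_Lipschitz_integrand T F"
  obtains C where "C \<ge> 0"
    "\<And>x y u v t. \<lbrakk>x \<in> W1 T 1; y \<in> W1 T 1; u \<in> Lspace T \<infinity>; v \<in> Lspace T \<infinity>;
       \<And>t. t \<in> {0..T} \<Longrightarrow> norm (x t) \<le> R; \<And>t. t \<in> {0..T} \<Longrightarrow> norm (y t) \<le> R;
       AE t in leb T. norm (u t) \<le> R; AE t in leb T. norm (v t) \<le> R; t \<in> {0..T}\<rbrakk> \<Longrightarrow>
       norm (x t - y t) \<le> C * (norm (x 0 - y 0) + (LINT t|leb T. norm (dot T x t - F (x t, u t) t)) +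
         (LINT t|leb T. norm (dot T y t - F (y t, v t) t)) + (LINT t|leb T. norm (u t - v t)))"
proof -
  \<comment> \<open>Radius \<open>2 * R\<close>, because a pair is bounded by the sum of the norms
    of its components.\<close>
  obtain L where L: "L \<ge> 0" "AE t in leb T. \<forall>y y'. norm y \<le> 2 * R \<longrightarrow> norm y' \<le> 2 * R \<longrightarrow>
        norm (F y t) \<le> L \<and> norm (F y t - F y' t) \<le> L * norm (y - y')"
    using locally_Lipschitz_integrandD[OF F] .
  \<comment> \<open>The factor 2 and the exponential come from \<open>Gronwall\<close>;
    \<open>1 + L\<close> merges the coefficient 1 of the initial values and defects with the
    coefficient L of the controls.\<close>
  define C where "C = 2 * (1 + L) * exp ((2 * L + 1) * T)"
  show thesis
  proof (rule that[of C])
    show "C \<ge> 0" using L by (simp add: C_def)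
    fix x y :: "real \<Rightarrow> 'a" and u v :: "real \<Rightarrow> 'b" and t :: real
    assume x: "x \<in> W1 T 1" and y: "y \<in> W1 T 1" and u: "u \<in> Lspace T \<infinity>" and v: "v \<in> Lspace T \<infinity>"
      and xR: "\<And>t. t \<in> {0..T} \<Longrightarrow> norm (x t) \<le> R" and yR: "\<And>t. t \<in> {0..T} \<Longrightarrow> norm (y t) \<le> R"
      and uR: "AE t in leb T. norm (u t) \<le> R" and vR: "AE t in leb T. norm (v t) \<le> R"
      and t: "t \<in> {0..T}"
    define ex where "ex t = norm (dot T x t - F (x t, u t) t)" for t
    define ey where "ey t = norm (dot T y t - F (y t, v t) t)" for t
    define uv where "uv t = norm (u t - v t)" for t
    let ?A = "norm (x 0 - y 0) + (LINT t|leb T. ex t) + (LINT t|leb T. ey t) + L * (LINT t|leb T. uv t)"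
    have Fi: "integrable (leb T) (\<lambda>t. F (x t, u t) t)" "integrable (leb T) (\<lambda>t. F (y t, v t) t)"
      using integrable_compose_pair(1)[OF F] W1_Lspace_infinity x y u v by blast+
    have exi: "integrable (leb T) ex" and eyi: "integrable (leb T) ey" and uvi: "integrable (leb T) uv"
      unfolding ex_def ey_def uv_def using Fi W1_integrable(2)[OF x] W1_integrable(2)[OF y]
        Lspace_infinity_integrable[OF u] Lspace_infinity_integrable[OF v]
      by (auto intro!: integrable_norm Bochner_Integration.integrable_diff)
    have cont: "continuous_on {0..T} x" "continuous_on {0..T} y"
      using x y by (auto simp: W1_def abs_continuous_on_continuous)
    then have xyi: "integrable (leb T) (\<lambda>t. norm (x t - y t))"
      by (intro continuous_imp_integrable_real continuous_intros)
    have AE: "AE t in leb T. norm (dot T x t - dot T y t) \<le> ex t + ey t + L * uv t + L * norm (x t - y t)"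
    proof -
      have "AE t in leb T. t \<in> {0..T}" by (rule AE_I2) simp
      with L(2) uR vR show ?thesis
      proof eventually_elim
        case (elim t)
        have "norm (x t, u t) \<le> 2 * R" "norm (y t, v t) \<le> 2 * R"
          using norm_Pair_le[of "x t" "u t"] norm_Pair_le[of "y t" "v t"] elim xR[of t] yR[of t] by linarith+
        then have "norm (F (x t, u t) t - F (y t, v t) t) \<le> L * norm ((x t, u t) - (y t, v t))"
          using elim by blast
        also have "\<dots> \<le> L * (norm (x t - y t) + uv t)"
          using L(1) norm_Pair_le[of "x t - y t" "u t - v t"] by (intro mult_left_mono) (auto simp: uv_def)
        finally have 1: "norm (F (x t, u t) t - F (y t, v t) t) \<le> L * norm (x t - y t) + L * uv t"
          by (simp add: algebra_simps)
        have "dot T x t - dot T y t = (dot T x t - F (x t, u t) t) - (dot T y t - F (y t, v t) t) +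
            (F (x t, u t) t - F (y t, v t) t)" by simp
        then have "norm (dot T x t - dot T y t) \<le> ex t + ey t + norm (F (x t, u t) t - F (y t, v t) t)"
          unfolding ex_def ey_def by (metis norm_triangle_mono norm_triangle_ineq4 order_refl)
        then show ?case using 1 by linarith
      qed
    qed
    have ex0: "ex r \<ge> 0" "ey r \<ge> 0" "uv r \<ge> 0" for r by (auto simp: ex_def ey_def uv_def)
    have "norm (x t - y t) \<le> 2 * ?A * exp ((2 * L + 1) * T)"
    proof (rule Gronwall[where v="\<lambda>t. norm (x t - y t)"])
      show "continuous_on {0..T} (\<lambda>t. norm (x t - y t))" using cont by (intro continuous_intros)
      show "0 \<le> ?A" using L ex0 by (intro add_nonneg_nonneg mult_nonneg_nonneg) auto
      fix s assume s: "s \<in> {0..T}"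
      have sub: "integrable (lebesgue_on {0..s}) f" if "integrable (leb T) f" for f :: "real \<Rightarrow> real"
        by (rule integrable_subinterval[OF that]) (use s in auto)
      have "x s - x 0 = (LINT r|lebesgue_on {0..s}. dot T x r)" "y s - y 0 = (LINT r|lebesgue_on {0..s}. dot T y r)"
        using W1_integral(1)[OF T x, of 0 s] W1_integral(1)[OF T y, of 0 s] s by auto
      moreover have di: "integrable (lebesgue_on {0..s}) (dot T x)" "integrable (lebesgue_on {0..s}) (dot T y)"
        using W1_integral(2)[OF T x, of 0 s] W1_integral(2)[OF T y, of 0 s] s by auto
      ultimately have "x s - y s = (x 0 - y 0) + (LINT r|lebesgue_on {0..s}. dot T x r - dot T y r)"
        by (simp add: algebra_simps)
      then have "norm (x s - y s) \<le> norm (x 0 - y 0) + norm (LINT r|lebesgue_on {0..s}. dot T x r - dot T y r)"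
        by (metis norm_triangle_ineq)
      also have "norm (LINT r|lebesgue_on {0..s}. dot T x r - dot T y r) \<le>
          (LINT r|lebesgue_on {0..s}. norm (dot T x r - dot T y r))" by simp
      also have "\<dots> \<le> (LINT r|lebesgue_on {0..s}. ex r + ey r + L * uv r + L * norm (x r - y r))"
      proof (rule integral_mono_AE)
        show "AE r in lebesgue_on {0..s}. norm (dot T x r - dot T y r) \<le> ex r + ey r + L * uv r + L * norm (x r - y r)"
          by (rule AE_leb_subinterval[OF AE]) (use s in auto)
      qed (use di sub exi eyi uvi xyi in auto)
      also have "\<dots> = (LINT r|lebesgue_on {0..s}. ex r) + (LINT r|lebesgue_on {0..s}. ey r) +
          L * (LINT r|lebesgue_on {0..s}. uv r) + L * (LINT r|lebesgue_on {0..s}. norm (x r - y r))"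
        using sub[OF exi] sub[OF eyi] sub[OF uvi] sub[OF xyi] by simp
      also have "\<dots> \<le> (LINT r|leb T. ex r) + (LINT r|leb T. ey r) + L * (LINT r|leb T. uv r) +
          L * (LINT r|lebesgue_on {0..s}. norm (x r - y r))"
        using s L(1) ex0 exi eyi uvi sub[OF xyi]
        by (intro add_mono mult_left_mono integral_lebesgue_on_mono_set) auto
      finally show "norm (x s - y s) \<le> ?A + L * (LINT r|lebesgue_on {0..s}. norm (x r - y r))" by simp
    qed (use t L(1) in auto)
    also have "\<dots> \<le> C * (norm (x 0 - y 0) + (LINT t|leb T. ex t) + (LINT t|leb T. ey t) + (LINT t|leb T. uv t))"
    proof -
      let ?N = "norm (x 0 - y 0) + (LINT t|leb T. ex t) + (LINT t|leb T. ey t)"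
      have "0 \<le> ?N" "0 \<le> (LINT t|leb T. uv t)" using ex0 by (auto intro!: add_nonneg_nonneg)
      then have "?A \<le> (1 + L) * (?N + (LINT t|leb T. uv t))"
        using L(1) mult_nonneg_nonneg[of L ?N] by (simp add: algebra_simps)
      then have "?A * (2 * exp ((2 * L + 1) * T)) \<le> (1 + L) * (?N + (LINT t|leb T. uv t)) * (2 * exp ((2 * L + 1) * T))"
        by (intro mult_right_mono) auto
      then show ?thesis unfolding C_def by (simp only: ac_simps)
    qed
    finally show "norm (x t - y t) \<le> C * (norm (x 0 - y 0) + (LINT t|leb T. norm (dot T x t - F (x t, u t) t)) +
         (LINT t|leb T. norm (dot T y t - F (y t, v t) t)) + (LINT t|leb T. norm (u t - v t)))"
      unfolding ex_def ey_def uv_def .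
  qed
qed

section \<open>L^1 convergence of states, derivatives and composed integrands\<close>

lemma uniform_limit_L1_tendsto:
  fixes x :: "nat \<Rightarrow> real \<Rightarrow> 'a::euclidean_space"
  assumes T: "0 < T" and lim: "uniform_limit {0..T} x \<xi> sequentially"
    and x: "\<And>l. x l \<in> Lspace T \<infinity>" and \<xi>: "\<xi> \<in> Lspace T \<infinity>"
  shows "(\<lambda>l. LINT t|leb T. norm (x l t - \<xi> t)) \<longlonglongrightarrow> 0"
proof (rule tendstoI)
  interpret finite_measure "leb T" by (rule finite_measure_leb)
  fix e :: real assume e: "e > 0"
  define d where "d = e / (2 * T)"
  have d: "d > 0" "d * T < e" using e T by (auto simp: d_def)
  have "\<forall>\<^sub>F l in sequentially. \<forall>t\<in>{0..T}. dist (x l t) (\<xi> t) < d"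
    using lim d(1) by (auto simp: uniform_limit_iff)
  then show "\<forall>\<^sub>F l in sequentially. dist (LINT t|leb T. norm (x l t - \<xi> t)) 0 < e"
  proof eventually_elim
    case (elim l)
    have "(LINT t|leb T. norm (x l t - \<xi> t)) \<le> (LINT t|leb T. d)"
    proof (rule integral_mono)
      show "integrable (leb T) (\<lambda>t. norm (x l t - \<xi> t))"
        by (intro integrable_norm Bochner_Integration.integrable_diff Lspace_infinity_integrable x \<xi>)
      show "norm (x l t - \<xi> t) \<le> d" if "t \<in> space (leb T)" for t
        using elim that by (auto simp: dist_norm less_imp_le)
    qed simp
    also have "\<dots> = d * T" using T measure_leb[of T] by simp
    finally show ?case using d by simp
  qed
qed

lemma pair_L1_tendsto:
  fixes x :: "nat \<Rightarrow> real \<Rightarrow> 'a::euclidean_space" and u :: "nat \<Rightarrow> real \<Rightarrow> 'b::euclidean_space"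
  assumes x: "\<And>l. x l \<in> Lspace T \<infinity>" "\<xi> \<in> Lspace T \<infinity>" and u: "\<And>l. u l \<in> Lspace T \<infinity>" "v \<in> Lspace T \<infinity>"
    and xl: "(\<lambda>l. LINT t|leb T. norm (x l t - \<xi> t)) \<longlonglongrightarrow> 0"
    and ul: "(\<lambda>l. LINT t|leb T. norm (u l t - v t)) \<longlonglongrightarrow> 0"
  shows "(\<lambda>l. LINT t|leb T. norm ((x l t, u l t) - (\<xi> t, v t))) \<longlonglongrightarrow> 0"
proof (rule tendsto_sandwich[OF _ _ tendsto_const])
  show "(\<lambda>l. (LINT t|leb T. norm (x l t - \<xi> t)) + (LINT t|leb T. norm (u l t - v t))) \<longlonglongrightarrow> 0"
    using tendsto_add[OF xl ul] by simp
  have "(LINT t|leb T. norm ((x l t, u l t) - (\<xi> t, v t))) \<le>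
      (LINT t|leb T. norm (x l t - \<xi> t)) + (LINT t|leb T. norm (u l t - v t))" for l
  proof -
    have i: "integrable (leb T) (\<lambda>t. x l t - \<xi> t)" "integrable (leb T) (\<lambda>t. u l t - v t)"
      by (intro Bochner_Integration.integrable_diff Lspace_infinity_integrable x u)+
    have ii: "integrable (leb T) (\<lambda>t. norm (x l t - \<xi> t) + norm (u l t - v t))"
      by (intro Bochner_Integration.integrable_add integrable_norm i)
    have "(LINT t|leb T. norm ((x l t, u l t) - (\<xi> t, v t))) \<le> (LINT t|leb T. norm (x l t - \<xi> t) + norm (u l t - v t))"
    proof (rule integral_mono[OF _ ii])
      show "integrable (leb T) (\<lambda>t. norm ((x l t, u l t) - (\<xi> t, v t)))"
      proof (rule Bochner_Integration.integrable_bound[OF ii])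
        have "(\<lambda>t. (x l t, u l t) - (\<xi> t, v t)) \<in> borel_measurable (leb T)"
          using x u by (intro borel_measurable_diff borel_measurable_Pair) (auto simp: Lspace_def)
        then show "(\<lambda>t. norm ((x l t, u l t) - (\<xi> t, v t))) \<in> borel_measurable (leb T)" by simp
      qed (simp add: norm_Pair_le)
    qed (simp add: norm_Pair_le)
    then show ?thesis using i by simp
  qed
  then show "\<forall>\<^sub>F l in sequentially. (LINT t|leb T. norm ((x l t, u l t) - (\<xi> t, v t))) \<le>
      (LINT t|leb T. norm (x l t - \<xi> t)) + (LINT t|leb T. norm (u l t - v t))" by simp
qed simp

lemma L1_triangle:
  fixes f g h :: "real \<Rightarrow> 'a::euclidean_space"
  assumes "integrable (leb T) f" "integrable (leb T) g" "integrable (leb T) h"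
  shows "(LINT t|leb T. norm (f t - h t)) \<le> (LINT t|leb T. norm (f t - g t)) + (LINT t|leb T. norm (g t - h t))"
proof -
  have "(LINT t|leb T. norm (f t - h t)) \<le> (LINT t|leb T. norm (f t - g t) + norm (g t - h t))"
    using assms by (intro integral_mono) (auto intro: norm_diff_triangle_le)
  then show ?thesis using assms by simp
qed

lemma compose_pair_L1_tendsto:
  fixes K :: "'a::euclidean_space \<times> 'b::euclidean_space \<Rightarrow> real \<Rightarrow> 'c::euclidean_space"
  assumes K: "locally_Lipschitz_integrand T K"
    and x: "\<And>l. x l \<in> Lspace T \<infinity>" "\<xi> \<in> Lspace T \<infinity>" and u: "\<And>l. u l \<in> Lspace T \<infinity>" "v \<in> Lspace T \<infinity>"
    and xR: "\<And>l. AE t in leb T. norm (x l t) \<le> R" and uR: "\<And>l. AE t in leb T. norm (u l t) \<le> R"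
    and xl: "(\<lambda>l. LINT t|leb T. norm (x l t - \<xi> t)) \<longlonglongrightarrow> 0"
    and ul: "(\<lambda>l. LINT t|leb T. norm (u l t - v t)) \<longlonglongrightarrow> 0"
  shows "(\<lambda>l. LINT t|leb T. norm (K (x l t, u l t) t - K (\<xi> t, v t) t)) \<longlonglongrightarrow> 0"
proof -
  obtain M M' where M: "AE t in leb T. norm (\<xi> t) \<le> M" "AE t in leb T. norm (v t) \<le> M'"
    using x(2) u(2) unfolding Lspace_infinity_iff by blast
  \<comment> \<open>One radius for the pairs of the sequence, bounded by 2|R|, and for the limit
    pair; absolute values guard against negative bounds.\<close>
  define S where "S = 2 * \<bar>R\<bar> + \<bar>M\<bar> + \<bar>M'\<bar>"
  show ?thesis
  proof (rule locally_Lipschitz_compose_L1_tendsto[OF K, where R=S])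
    show "(\<lambda>t. (x l t, u l t)) \<in> borel_measurable (leb T)" for l
      using x u by (intro borel_measurable_Pair) (auto simp: Lspace_def)
    show "(\<lambda>t. (\<xi> t, v t)) \<in> borel_measurable (leb T)"
      using x u by (intro borel_measurable_Pair) (auto simp: Lspace_def)
    show "AE t in leb T. norm (x l t, u l t) \<le> S" for l
      using xR[of l] uR[of l]
    proof eventually_elim
      case (elim t)
      then show ?case using norm_Pair_le[of "x l t" "u l t"] unfolding S_def by linarith
    qed
    show "AE t in leb T. norm (\<xi> t, v t) \<le> S"
      using M
    proof eventually_elim
      case (elim t)
      then show ?case using norm_Pair_le[of "\<xi> t" "v t"] unfolding S_def by linarith
    qed
  qed (rule pair_L1_tendsto[OF x u xl ul])
qed

text \<open>The derivative is compared with F(x,u,t) through the defect, and F(x,u,t) with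
  F(\<xi>,v,t) through superposition. Only essential boundedness of \<xi> is asked, so this applies
  before \<xi> is known to be absolutely continuous.\<close>

lemma derivative_L1_tendsto:
  fixes F :: "'a::euclidean_space \<times> 'b::euclidean_space \<Rightarrow> real \<Rightarrow> 'a"
  assumes F: "locally_Lipschitz_integrand T F"
    and x: "\<And>l. x l \<in> W1 T 1" "\<xi> \<in> Lspace T \<infinity>" and u: "\<And>l. u l \<in> Lspace T \<infinity>" "v \<in> Lspace T \<infinity>"
    and xR: "\<And>l. AE t in leb T. norm (x l t) \<le> R" and uR: "\<And>l. AE t in leb T. norm (u l t) \<le> R"
    and xl: "(\<lambda>l. LINT t|leb T. norm (x l t - \<xi> t)) \<longlonglongrightarrow> 0"
    and ul: "(\<lambda>l. LINT t|leb T. norm (u l t - v t)) \<longlonglongrightarrow> 0"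
    and defect: "(\<lambda>l. LINT t|leb T. norm (dot T (x l) t - F (x l t, u l t) t)) \<longlonglongrightarrow> 0"
  shows "(\<lambda>l. LINT t|leb T. norm (dot T (x l) t - F (\<xi> t, v t) t)) \<longlonglongrightarrow> 0"
proof (rule tendsto_sandwich[OF _ _ tendsto_const])
  have xL: "x l \<in> Lspace T \<infinity>" for l using x(1) by (rule W1_Lspace_infinity)
  show "(\<lambda>l. (LINT t|leb T. norm (dot T (x l) t - F (x l t, u l t) t)) +
      (LINT t|leb T. norm (F (x l t, u l t) t - F (\<xi> t, v t) t))) \<longlonglongrightarrow> 0"
    using tendsto_add[OF defect compose_pair_L1_tendsto[OF F xL x(2) u xR uR xl ul]] by simp
  show "\<forall>\<^sub>F l in sequentially. (LINT t|leb T. norm (dot T (x l) t - F (\<xi> t, v t) t)) \<le>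
      (LINT t|leb T. norm (dot T (x l) t - F (x l t, u l t) t)) +
      (LINT t|leb T. norm (F (x l t, u l t) t - F (\<xi> t, v t) t))"
    by (intro always_eventually allI L1_triangle W1_integrable(2) integrable_compose_pair(1)[OF F] x u xL)
qed simp

theorem W1_converges_of_initial_value:
  fixes F :: "'a::euclidean_space \<times> 'b::euclidean_space \<Rightarrow> real \<Rightarrow> 'a"
  assumes T: "0 < T" and F: "locally_Lipschitz_integrand T F"
    and x: "\<And>l. x l \<in> W1 T 1" and u: "\<And>l. u l \<in> Lspace T \<infinity>" "v \<in> Lspace T \<infinity>"
    and xR: "\<And>l t. t \<in> {0..T} \<Longrightarrow> norm (x l t) \<le> R" and uR: "\<And>l. AE t in leb T. norm (u l t) \<le> R"
    and ul: "(\<lambda>l. LINT t|leb T. norm (u l t - v t)) \<longlonglongrightarrow> 0"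
    and defect: "(\<lambda>l. LINT t|leb T. norm (dot T (x l) t - F (x l t, u l t) t)) \<longlonglongrightarrow> 0"
    and init: "(\<lambda>l. x l 0) \<longlonglongrightarrow> p"
  obtains \<xi> where "\<xi> \<in> W1 T \<infinity>" "W1_converges T 1 x \<xi>" "\<xi> 0 = p"
proof -
  obtain C where C: "C \<ge> 0" "\<And>x y u v t. \<lbrakk>x \<in> W1 T 1; y \<in> W1 T 1; u \<in> Lspace T \<infinity>; v \<in> Lspace T \<infinity>;
       \<And>t. t \<in> {0..T} \<Longrightarrow> norm (x t) \<le> R; \<And>t. t \<in> {0..T} \<Longrightarrow> norm (y t) \<le> R;
       AE t in leb T. norm (u t) \<le> R; AE t in leb T. norm (v t) \<le> R; t \<in> {0..T}\<rbrakk> \<Longrightarrow>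
       norm (x t - y t) \<le> C * (norm (x 0 - y 0) + (LINT t|leb T. norm (dot T x t - F (x t, u t) t)) +
         (LINT t|leb T. norm (dot T y t - F (y t, v t) t)) + (LINT t|leb T. norm (u t - v t)))"
    using state_estimate[OF T F, of R] by blast
  \<comment> \<open>Passing through p and v separates the two-index estimate into one error per
    index.\<close>
  define \<eta> where "\<eta> l = norm (x l 0 - p) + (LINT t|leb T. norm (dot T (x l) t - F (x l t, u l t) t)) +
    (LINT t|leb T. norm (u l t - v t))" for l
  have "(\<lambda>l. norm (x l 0 - p)) \<longlonglongrightarrow> 0" using init by (simp add: LIM_zero tendsto_norm_zero)
  then have "\<eta> \<longlonglongrightarrow> 0 + 0 + 0" unfolding \<eta>_def by (intro tendsto_add defect ul)
  then have \<eta>: "\<eta> \<longlonglongrightarrow> 0" by simp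
  \<comment> \<open>Two members of the sequence are compared: the state estimate requires Sobolev
    functions, and no limit trajectory is at hand yet.\<close>
  have est: "dist (x l t) (x m t) \<le> C * (\<eta> l + \<eta> m)" if t: "t \<in> {0..T}" for l m t
  proof -
    have "norm (x l t - x m t) \<le> C * (norm (x l 0 - x m 0) + (LINT t|leb T. norm (dot T (x l) t - F (x l t, u l t) t)) +
         (LINT t|leb T. norm (dot T (x m) t - F (x m t, u m t) t)) + (LINT t|leb T. norm (u l t - u m t)))"
      by (rule C(2)[OF x x u(1) u(1) xR xR uR uR t])
    also have "\<dots> \<le> C * (\<eta> l + \<eta> m)"
    proof (rule mult_left_mono[OF _ C(1)])
      have "(LINT t|leb T. norm (u l t - u m t)) \<le> (LINT t|leb T. norm (u l t - v t)) + (LINT t|leb T. norm (v t - u m t))"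
        by (intro L1_triangle Lspace_infinity_integrable u)
      moreover have "(LINT t|leb T. norm (v t - u m t)) = (LINT t|leb T. norm (u m t - v t))"
        by (simp add: norm_minus_commute)
      moreover have "norm (x l 0 - x m 0) \<le> norm (x l 0 - p) + norm (x m 0 - p)"
        using norm_triangle_ineq4[of "x l 0 - p" "x m 0 - p"] by simp
      ultimately show "norm (x l 0 - x m 0) + (LINT t|leb T. norm (dot T (x l) t - F (x l t, u l t) t)) +
         (LINT t|leb T. norm (dot T (x m) t - F (x m t, u m t) t)) + (LINT t|leb T. norm (u l t - u m t)) \<le> \<eta> l + \<eta> m"
        unfolding \<eta>_def by linarith
    qed
    finally show ?thesis by (simp add: dist_norm)
  qed
  have "uniformly_Cauchy_on {0..T} x"
    unfolding uniformly_Cauchy_on_def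
  proof (intro allI impI)
    fix e :: real assume e: "e > 0"
    have "\<forall>\<^sub>F l in sequentially. \<eta> l < e / (2 * C + 1)"
      using \<eta> e C(1) by (intro order_tendstoD(2)[OF \<eta>]) auto
    then obtain M where M: "\<And>l. l \<ge> M \<Longrightarrow> \<eta> l < e / (2 * C + 1)" by (auto simp: eventually_sequentially)
    show "\<exists>M. \<forall>t\<in>{0..T}. \<forall>m\<ge>M. \<forall>n\<ge>M. dist (x m t) (x n t) < e"
    proof (intro exI[of _ M] ballI allI impI)
      fix t m n assume t: "t \<in> {0..T}" and mn: "M \<le> m" "M \<le> n"
      have "dist (x m t) (x n t) \<le> C * (\<eta> m + \<eta> n)" by (rule est[OF t])
      \<comment> \<open>The 1 in \<open>2 * C + 1\<close> keeps the denominator positive when C = 0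
        and makes the last inequality strict.\<close>
      also have "\<dots> \<le> C * (2 * (e / (2 * C + 1)))"
        using M[OF mn(1)] M[OF mn(2)] C(1) by (intro mult_left_mono) auto
      also have "\<dots> < e" using C(1) e by (simp add: field_simps)
      finally show "dist (x m t) (x n t) < e" .
    qed
  qed
  then have "uniformly_convergent_on {0..T} x" by (rule Cauchy_uniformly_convergent)
  then obtain \<xi> where \<xi>: "uniform_limit {0..T} x \<xi> sequentially" by (auto simp: uniformly_convergent_on_def)
  have cont: "continuous_on {0..T} (x l)" for l using x[of l] by (simp add: W1_def abs_continuous_on_continuous)
  then have "continuous_on {0..T} \<xi>"
    by (intro uniform_limit_theorem[OF _ \<xi>]) auto
  then have \<xi>L: "\<xi> \<in> Lspace T \<infinity>" by (rule continuous_on_Lspace_infinity)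
  have xl: "(\<lambda>l. LINT t|leb T. norm (x l t - \<xi> t)) \<longlonglongrightarrow> 0"
    by (rule uniform_limit_L1_tendsto[OF T \<xi> W1_Lspace_infinity[OF x] \<xi>L])
  define g where "g t = F (\<xi> t, v t) t" for t
  have gL: "g \<in> Lspace T \<infinity>"
    unfolding g_def
    by (rule locally_Lipschitz_compose_Lspace[OF F integrable_compose_pair(2)[OF F \<xi>L u(2)]])
  have dl: "(\<lambda>l. LINT t|leb T. norm (dot T (x l) t - g t)) \<longlonglongrightarrow> 0"
    unfolding g_def
  proof (rule derivative_L1_tendsto[OF F x \<xi>L u _ uR xl ul defect])
    show "AE t in leb T. norm (x l t) \<le> R" for l by (rule AE_I2) (simp add: xR)
  qed
  have gi: "integrable (leb T) g" by (rule Lspace_infinity_integrable[OF gL])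
  have lim: "(\<lambda>l. x l t) \<longlonglongrightarrow> \<xi> t" if "t \<in> {0..T}" for t
    using tendsto_uniform_limitI[OF \<xi> that] .
  \<comment> \<open>Uniform convergence alone says nothing about the derivative of \<xi>. The
    increments of the trajectories do pass to the limit, and so do their integral forms, because the
    derivatives tend to g in L^1.\<close>
  have prim: "\<xi> t = \<xi> 0 + (LINT r|lebesgue_on {0..t}. g r)" if t: "t \<in> {0..T}" for t
  proof -
    have gt: "integrable (lebesgue_on {0..t}) g"
      by (rule integrable_subinterval[OF gi]) (use t in auto)
    have "(\<lambda>l. LINT r|lebesgue_on {0..t}. dot T (x l) r) \<longlonglongrightarrow> (LINT r|lebesgue_on {0..t}. g r)"
    proof (rule LIM_zero_cancel, rule Lim_null_comparison[OF _ dl], intro always_eventually allI)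
      fix l
      have di: "integrable (lebesgue_on {0..t}) (dot T (x l))"
        using W1_integral(2)[OF T x, of 0 t] t by auto
      have "norm ((LINT r|lebesgue_on {0..t}. dot T (x l) r) - (LINT r|lebesgue_on {0..t}. g r))
          = norm (LINT r|lebesgue_on {0..t}. dot T (x l) r - g r)" using di gt by simp
      also have "\<dots> \<le> (LINT r|lebesgue_on {0..t}. norm (dot T (x l) r - g r))" by simp
      also have "\<dots> \<le> (LINT r|leb T. norm (dot T (x l) r - g r))"
        using W1_integrable(2)[OF x] gi t by (intro integral_lebesgue_on_mono_set) auto
      finally show "norm ((LINT r|lebesgue_on {0..t}. dot T (x l) r) - (LINT r|lebesgue_on {0..t}. g r))
        \<le> (LINT r|leb T. norm (dot T (x l) r - g r))" .
    qed
    moreover have "(LINT r|lebesgue_on {0..t}. dot T (x l) r) = x l t - x l 0" for l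
      using W1_integral(1)[OF T x, of 0 t] t by auto
    ultimately have "(\<lambda>l. x l t - x l 0) \<longlonglongrightarrow> (LINT r|lebesgue_on {0..t}. g r)" by simp
    moreover have "(\<lambda>l. x l t - x l 0) \<longlonglongrightarrow> \<xi> t - \<xi> 0" using lim t T by (intro tendsto_diff) auto
    ultimately have "\<xi> t - \<xi> 0 = (LINT r|lebesgue_on {0..t}. g r)" by (rule LIMSEQ_unique[rotated])
    then show ?thesis by (simp add: algebra_simps)
  qed
  have \<xi>W: "\<xi> \<in> W1 T \<infinity>" and \<xi>d: "AE t in leb T. dot T \<xi> t = g t"
    using W1_infinity_primitive[OF T gL prim] by auto
  have \<xi>1: "\<xi> \<in> W1 T 1" by (rule W1_infinity_imp_W1_1[OF \<xi>W])
  have "W1norm T 1 (\<lambda>t. x l t - \<xi> t) = (LINT t|leb T. norm (x l t - \<xi> t)) + (LINT t|leb T. norm (dot T (x l) t - g t))" for l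
  proof -
    have "(LINT t|leb T. norm (dot T (x l) t - dot T \<xi> t)) = (LINT t|leb T. norm (dot T (x l) t - g t))"
    proof (rule integral_cong_AE)
      show "AE t in leb T. norm (dot T (x l) t - dot T \<xi> t) = norm (dot T (x l) t - g t)"
        using \<xi>d by eventually_elim simp
      show "(\<lambda>t. norm (dot T (x l) t - dot T \<xi> t)) \<in> borel_measurable (leb T)"
        "(\<lambda>t. norm (dot T (x l) t - g t)) \<in> borel_measurable (leb T)"
        by (intro borel_measurable_integrable integrable_norm Bochner_Integration.integrable_diff
            W1_integrable(2) x \<xi>1 gi)+
    qed
    then show ?thesis using W1norm_diff[OF T x \<xi>1] by simp
  qed
  then have "(\<lambda>l. W1norm T 1 (\<lambda>t. x l t - \<xi> t)) \<longlonglongrightarrow> 0"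
    using tendsto_add[OF xl dl] by simp
  then have "W1_converges T 1 x \<xi>" using x \<xi>1 by (simp add: W1_converges_def)
  moreover have "\<xi> 0 = p" using LIMSEQ_unique[OF lim[of 0] init] T by simp
  ultimately show thesis using that \<xi>W by blast
qed

section \<open>Uniform bounds and compactness in W^{1,1}\<close>

text \<open>Makes the embedding bound \<open>W1_norm_le\<close> applicable to differences of
  trajectories.\<close>

lemma W1_1_diff:
  assumes T: "0 < T" and xy: "x \<in> W1 T 1" "y \<in> W1 T 1"
  shows "(\<lambda>t. x t - y t) \<in> W1 T 1"
proof -
  have "abs_continuous_on 0 T (\<lambda>t. x t - y t)"
    unfolding abs_continuous_on_def
  proof (intro allI impI)
    fix e :: real assume "e > 0"
    then have e: "e / 2 > 0" by simp
    have AC: "abs_continuous_on 0 T x" "abs_continuous_on 0 T y" using xy by (auto simp: W1_def)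
    define Q where "Q d f \<longleftrightarrow> (\<forall>(N::nat) (l::nat \<Rightarrow> real) (r::nat \<Rightarrow> real).
        (\<forall>i<N. 0 \<le> l i \<and> l i \<le> r i \<and> r i \<le> T) \<and> disjoint_family_on (\<lambda>i. {l i<..<r i}) {..<N} \<and>
        (\<Sum>i<N. r i - l i) < d \<longrightarrow> (\<Sum>i<N. norm (f (r i) - f (l i))) < e / 2)" for d and f :: "real \<Rightarrow> 'a"
    obtain d1 where d1: "d1 > 0" "Q d1 x" using AC(1) e unfolding abs_continuous_on_def Q_def by blast
    obtain d2 where d2: "d2 > 0" "Q d2 y" using AC(2) e unfolding abs_continuous_on_def Q_def by blast
    show "\<exists>d>0. \<forall>(N::nat) l r. (\<forall>i<N. 0 \<le> l i \<and> l i \<le> r i \<and> r i \<le> T) \<and>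
        disjoint_family_on (\<lambda>i. {l i<..<r i}) {..<N} \<and> (\<Sum>i<N. r i - l i) < d \<longrightarrow>
        (\<Sum>i<N. norm ((x (r i) - y (r i)) - (x (l i) - y (l i)))) < e"
    proof (intro exI[of _ "min d1 d2"] conjI allI impI; (elim conjE)?)
      fix N :: nat and l r :: "nat \<Rightarrow> real"
      assume h: "\<forall>i<N. 0 \<le> l i \<and> l i \<le> r i \<and> r i \<le> T" "disjoint_family_on (\<lambda>i. {l i<..<r i}) {..<N}"
        "(\<Sum>i<N. r i - l i) < min d1 d2"
      have "(\<Sum>i<N. norm ((x (r i) - y (r i)) - (x (l i) - y (l i)))) \<le>
          (\<Sum>i<N. norm (x (r i) - x (l i)) + norm (y (r i) - y (l i)))"
      proof (rule sum_mono)
        fix i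
        have "(x (r i) - y (r i)) - (x (l i) - y (l i)) = (x (r i) - x (l i)) - (y (r i) - y (l i))" by simp
        then show "norm ((x (r i) - y (r i)) - (x (l i) - y (l i))) \<le> norm (x (r i) - x (l i)) + norm (y (r i) - y (l i))"
          using norm_triangle_ineq4 by metis
      qed
      also have "\<dots> = (\<Sum>i<N. norm (x (r i) - x (l i))) + (\<Sum>i<N. norm (y (r i) - y (l i)))"
        by (rule sum.distrib)
      also have "\<dots> < e / 2 + e / 2"
      proof (rule add_strict_mono)
        show "(\<Sum>i<N. norm (x (r i) - x (l i))) < e / 2" using d1(2) h unfolding Q_def by simp
        show "(\<Sum>i<N. norm (y (r i) - y (l i))) < e / 2" using d2(2) h unfolding Q_def by simp
      qed
      finally show "(\<Sum>i<N. norm ((x (r i) - y (r i)) - (x (l i) - y (l i)))) < e" by simp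
    qed (use d1 d2 in simp)
  qed
  moreover have "AE t in leb T. (\<lambda>t. x t - y t) differentiable (at t within {0..T})"
  proof -
    have "AE t in leb T. x differentiable (at t within {0..T})" "AE t in leb T. y differentiable (at t within {0..T})"
      using xy by (auto simp: W1_def)
    then show ?thesis by eventually_elim (rule differentiable_diff)
  qed
  moreover have "dot T (\<lambda>t. x t - y t) \<in> Lspace T 1"
    unfolding Lspace_1_iff
  proof -
    have i: "integrable (leb T) (\<lambda>t. dot T x t - dot T y t)"
      using W1_integrable(2)[OF xy(1)] W1_integrable(2)[OF xy(2)] by simp
    have ae: "AE t in leb T. dot T x t - dot T y t = dot T (\<lambda>t. x t - y t) t"
      using AE_dot_diff[OF T xy] by eventually_elim simp
    have m: "dot T (\<lambda>t. x t - y t) \<in> borel_measurable (leb T)"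
      by (rule measurable_leb_AE_cong[OF borel_measurable_integrable[OF i] ae])
    show "integrable (leb T) (dot T (\<lambda>t. x t - y t))"
      by (rule integrable_cong_AE_imp[OF i m]) (rule ae)
  qed
  ultimately show ?thesis by (simp add: W1_def)
qed

text \<open>The embedding bound applied to differences, with 1/T + 1 dominating both of its
  coefficients. In particular the end values converge, as the boundary constraints require.\<close>

lemma W1_converges_imp_uniform_limit:
  assumes T: "0 < T" and c: "W1_converges T 1 x y"
  shows "uniform_limit {0..T} x y sequentially"
proof -
  have x: "x l \<in> W1 T 1" and y: "y \<in> W1 T 1" and n: "(\<lambda>l. W1norm T 1 (\<lambda>t. x l t - y t)) \<longlonglongrightarrow> 0" for l
    using c by (auto simp: W1_converges_def)
  have le: "norm (x l t - y t) \<le> (1 / T + 1) * W1norm T 1 (\<lambda>t. x l t - y t)" if t: "t \<in> {0..T}" for l t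
  proof -
    let ?z = "\<lambda>t. x l t - y t"
    have "norm (?z t) \<le> (LINT r|leb T. norm (?z r)) / T + (LINT r|leb T. norm (dot T ?z r))"
      by (rule W1_norm_le[OF T W1_1_diff[OF T x y] t])
    also have "\<dots> \<le> (1 / T + 1) * W1norm T 1 ?z"
      unfolding W1norm_def Lnorm_1 using T by (simp add: algebra_simps divide_nonneg_pos)
    finally show ?thesis .
  qed
  have "(\<lambda>l. (1 / T + 1) * W1norm T 1 (\<lambda>t. x l t - y t)) \<longlonglongrightarrow> 0" using n by (rule tendsto_mult_right_zero)
  then show ?thesis
    unfolding uniform_limit_iff
  proof (intro allI impI)
    fix e :: real assume "e > 0"
    then have "\<forall>\<^sub>F l in sequentially. (1 / T + 1) * W1norm T 1 (\<lambda>t. x l t - y t) < e"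
      using \<open>(\<lambda>l. (1 / T + 1) * W1norm T 1 (\<lambda>t. x l t - y t)) \<longlonglongrightarrow> 0\<close> by (rule order_tendstoD(2)[rotated])
    then show "\<forall>\<^sub>F l in sequentially. \<forall>t\<in>{0..T}. dist (x l t) (y t) < e"
    proof eventually_elim
      case (elim l)
      then show ?case using le[of _ l] by (force simp: dist_norm)
    qed
  qed
qed

text \<open>For finite r, the pointwise bound a \<le> 1 + a^r takes the place of the Hoelder
  inequality. The right-hand side adds the bounds for r = infinity and for finite r, so that one
  expression serves both cases.\<close>

lemma LINT_le_Lnorm:
  fixes f :: "real \<Rightarrow> 'a::euclidean_space"
  assumes T: "0 < T" and f: "f \<in> Lspace T \<infinity>" and r: "1 < r" and B: "Lnorm T r f \<le> B"
  shows "(LINT t|leb T. norm (f t)) \<le> T + T * \<bar>B\<bar> + \<bar>B\<bar> powr enn2real r"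
proof -
  interpret finite_measure "leb T" by (rule finite_measure_leb)
  have fi: "integrable (leb T) (\<lambda>t. norm (f t))" by (intro integrable_norm Lspace_infinity_integrable f)
  have mT: "(LINT t|leb T. c) = c * T" for c :: real using T measure_leb[of T] by simp
  show ?thesis
  proof (cases "r = \<infinity>")
    case True
    have "(LINT t|leb T. norm (f t)) \<le> (LINT t|leb T. \<bar>B\<bar>)"
    proof (rule integral_mono_AE[OF fi])
      show "AE t in leb T. norm (f t) \<le> \<bar>B\<bar>"
        using AE_norm_le_Lnorm_infinity[OF f] by eventually_elim (use B True in auto)
    qed simp
    also have "\<dots> = \<bar>B\<bar> * T" by (rule mT)
    finally show ?thesis using T by (simp add: mult.commute add_increasing add_increasing2)
  next
    case False
    define q where "q = enn2real r"
    have q: "q > 1" using r False unfolding q_def by (cases r) auto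
    obtain M where M: "AE t in leb T. norm (f t) \<le> M" and fm: "f \<in> borel_measurable (leb T)"
      using f unfolding Lspace_infinity_iff by blast
    \<comment> \<open>Without integrability the integral of the power would default to 0 and the
      norm would bound nothing; essential boundedness of \<open>f\<close> excludes this.\<close>
    have pi: "integrable (leb T) (\<lambda>t. norm (f t) powr q)"
    proof (rule integrable_const_bound)
      show "AE t in leb T. norm (norm (f t) powr q) \<le> M powr q"
        using M by eventually_elim (use q in \<open>auto intro: powr_mono2\<close>)
      show "(\<lambda>t. norm (f t) powr q) \<in> borel_measurable (leb T)" using fm by measurable
    qed
    define I where "I = (LINT t|leb T. norm (f t) powr q)"
    have I: "I \<ge> 0" unfolding I_def by simp
    have "I = (I powr (1 / q)) powr q" using I q by (simp add: powr_powr)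
    also have "\<dots> \<le> \<bar>B\<bar> powr q"
      using B False q by (intro powr_mono2) (auto simp: Lnorm_def I_def q_def)
    finally have IB: "I \<le> \<bar>B\<bar> powr q" .
    have "(LINT t|leb T. norm (f t)) \<le> (LINT t|leb T. 1 + norm (f t) powr q)"
    proof (rule integral_mono[OF fi])
      show "norm (f t) \<le> 1 + norm (f t) powr q" for t
      proof (cases "norm (f t) \<le> 1")
        case False
        then have "norm (f t) powr 1 \<le> norm (f t) powr q" using q by (intro powr_mono) auto
        then show ?thesis using False by simp
      qed (simp add: add_increasing2)
    qed (use pi in auto)
    also have "\<dots> = T + I" using pi mT[of 1] by (simp add: I_def)
    finally have "(LINT t|leb T. norm (f t)) \<le> T + I" .
    moreover have "0 \<le> T * \<bar>B\<bar>" using T by simp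
    ultimately show ?thesis using IB unfolding q_def by linarith
  qed
qed

lemma W1norm_diff_cong:
  fixes x y :: "real \<Rightarrow> 'a::euclidean_space"
  assumes T: "0 < T" and W: "x \<in> W1 T 1" "y \<in> W1 T 1"
    and eq: "\<And>t. t \<in> {0..T} \<Longrightarrow> x' t = x t" "\<And>t. t \<in> {0..T} \<Longrightarrow> y' t = y t"
  shows "W1norm T 1 (\<lambda>t. x' t - y' t) = W1norm T 1 (\<lambda>t. x t - y t)"
proof -
  have W': "x' \<in> W1 T 1" "y' \<in> W1 T 1" using W1_cong(1)[OF T eq(1) W(1)] W1_cong(1)[OF T eq(2) W(2)] by auto
  have "(LINT t|leb T. norm (x' t - y' t)) = (LINT t|leb T. norm (x t - y t))"
    by (rule Bochner_Integration.integral_cong) (use eq in auto)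
  moreover have "(LINT t|leb T. norm (dot T x' t - dot T y' t)) = (LINT t|leb T. norm (dot T x t - dot T y t))"
    by (rule Bochner_Integration.integral_cong)
      (use W1_cong(2)[OF T eq(1) W(1)] W1_cong(2)[OF T eq(2) W(2)] in auto)
  ultimately show ?thesis using W1norm_diff[OF T W] W1norm_diff[OF T W'] by simp
qed

text \<open>By the Bolzano-Weierstrass characterisation, every infinite subset of the range needs an
  accumulation point. Its elements are listed by increasing index as an injective subsequence, whose
  subsequential limit cannot be attained more than once.\<close>

lemma (in Metric_space) compactin_closure_of_range:
  fixes s :: "nat \<Rightarrow> 'a"
  assumes s: "range s \<subseteq> M"
    and sub: "\<And>\<tau>::nat \<Rightarrow> nat. strict_mono \<tau> \<Longrightarrow>
      \<exists>\<sigma> l. strict_mono \<sigma> \<and> limitin mtopology (s \<circ> \<tau> \<circ> \<sigma>) l sequentially"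
  shows "compactin mtopology (mtopology closure_of (range s))"
  unfolding compact_closure_of_eq_Bolzano_Weierstrass
proof (intro allI impI; elim conjE)
  fix A assume A: "infinite A" "A \<subseteq> range s"
  define j where "j y = (LEAST i. s i = y)" for y
  have sj: "s (j y) = y" if "y \<in> A" for y
    unfolding j_def using A(2) that by (auto intro: LeastI)
  have "inj_on j A" using sj by (metis inj_onI)
  then have inf: "infinite (j ` A)" using A(1) finite_imageD by blast
  \<comment> \<open>Increasing enumeration of the chosen indices, so that the listed values form a
    genuine subsequence of \<open>s\<close>.\<close>
  define \<tau> where "\<tau> = enumerate (j ` A)"
  have \<tau>: "strict_mono \<tau>" unfolding \<tau>_def by (rule strict_mono_enumerate[OF inf])
  have \<tau>A: "\<tau> n \<in> j ` A" for n unfolding \<tau>_def by (rule enumerate_in_set[OF inf])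
  have "inj_on s (j ` A)" using sj by (auto intro!: inj_onI)
  then have inj: "inj (s \<circ> \<tau>)"
    unfolding inj_on_def o_def using \<tau>A strict_mono_eq[OF \<tau>] inj_onD by metis
  obtain \<sigma> l where \<sigma>: "strict_mono \<sigma>" "limitin mtopology (s \<circ> \<tau> \<circ> \<sigma>) l sequentially"
    using sub[OF \<tau>] by blast
  have inj': "inj (s \<circ> \<tau> \<circ> \<sigma>)"
    using inj strict_mono_imp_inj_on[OF \<sigma>(1)] by (rule inj_compose)
  have inA: "(s \<circ> \<tau> \<circ> \<sigma>) n \<in> A" for n using \<tau>A[of "\<sigma> n"] sj by auto
  have "l \<in> mtopology derived_set_of A"
    unfolding metric_derived_set_of
  proof (intro CollectI conjI allI impI)
    show "l \<in> M" using \<sigma>(2) limitin_mspace by blast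
    fix r :: real assume "r > 0"
    then obtain N where N: "\<And>n. n \<ge> N \<Longrightarrow> (s \<circ> \<tau> \<circ> \<sigma>) n \<in> M \<and> d ((s \<circ> \<tau> \<circ> \<sigma>) n) l < r"
      using \<sigma>(2) unfolding limit_metric_sequentially by meson
    \<comment> \<open>By injectivity, of two consecutive terms at most one equals l.\<close>
    obtain n where n: "n \<ge> N" "(s \<circ> \<tau> \<circ> \<sigma>) n \<noteq> l"
      using inj' by (metis injD n_not_Suc_n le_Suc_eq le_refl)
    then show "\<exists>y\<in>A. y \<noteq> l \<and> y \<in> mball l r"
      using inA[of n] N[OF n(1)] \<open>l \<in> M\<close> by (auto simp: commute)
  qed
  then show "mtopology derived_set_of A \<noteq> {}" by blast
qed

text \<open>Subsequential convergence is checked on arbitrary representatives and carried over to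
  the restricted ones, on which the metric separates points.\<close>

lemma relatively_compact_W1_1I:
  fixes x :: "nat \<Rightarrow> real \<Rightarrow> 'a::euclidean_space"
  assumes T: "0 < T" and x: "\<And>l. x l \<in> W1 T 1"
    and sub: "\<And>\<tau>::nat \<Rightarrow> nat. strict_mono \<tau> \<Longrightarrow> \<exists>\<sigma> y. strict_mono \<sigma> \<and> W1_converges T 1 (x \<circ> \<tau> \<circ> \<sigma>) y"
  shows "relatively_compact_W1 T 1 (range x)"
proof -
  interpret Metric_space "W1_metric_space T 1" "\<lambda>x y :: real \<Rightarrow> 'a. W1norm T 1 (\<lambda>t. x t - y t)"
    by (rule Metric_space_W1_1[OF T])
  define s where "s l = restrict (x l) {0..T}" for l
  have R: "restrict y {0..T} \<in> W1_metric_space T 1" if "y \<in> W1 T 1" for y :: "real \<Rightarrow> 'a"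
    using W1_cong(1)[OF T _ that, of "restrict y {0..T}"] by (simp add: W1_metric_space_def)
  have "compactin mtopology (mtopology closure_of (range s))"
  proof (rule compactin_closure_of_range)
    show "range s \<subseteq> W1_metric_space T 1" unfolding s_def using R x by blast
    fix \<tau> :: "nat \<Rightarrow> nat" assume "strict_mono \<tau>"
    then obtain \<sigma> y where \<sigma>: "strict_mono \<sigma>" "W1_converges T 1 (x \<circ> \<tau> \<circ> \<sigma>) y" using sub by blast
    then have y: "y \<in> W1 T 1" and l: "(\<lambda>k. W1norm T 1 (\<lambda>t. x (\<tau> (\<sigma> k)) t - y t)) \<longlonglongrightarrow> 0"
      by (auto simp: W1_converges_def)
    have "W1norm T 1 (\<lambda>t. s (\<tau> (\<sigma> k)) t - restrict y {0..T} t) = W1norm T 1 (\<lambda>t. x (\<tau> (\<sigma> k)) t - y t)" for k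
      by (rule W1norm_diff_cong[OF T x y]) (auto simp: s_def)
    then have "limitin mtopology (s \<circ> \<tau> \<circ> \<sigma>) (restrict y {0..T}) sequentially"
      unfolding limitin_metric_dist_null using l R y x by (auto simp: s_def)
    then show "\<exists>\<sigma> l. strict_mono \<sigma> \<and> limitin mtopology (s \<circ> \<tau> \<circ> \<sigma>) l sequentially"
      using \<sigma>(1) by blast
  qed
  moreover have "range s = (\<lambda>x. restrict x {0..T}) ` range x" by (auto simp: s_def)
  ultimately show ?thesis
    unfolding relatively_compact_W1_def W1_topology_def using x by auto
qed


section \<open>Limits of the method\<close>

lemma
  fixes P :: "('n::finite, 'm::finite) dc_problem"
  shows penalty_ge_dynamics: "(\<Sum>i\<in>UNIV. LINT t|leb (hor P). \<bar>dot (hor P) (fst z) t $ i - F_of P (ev z t) t $ i\<bar>) \<le> penalty P z"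
    and penalty_ge_ineq: "i \<in> ineq_idx P \<Longrightarrow> max 0 (f_of P i (ends (hor P) z)) \<le> penalty P z"
    and penalty_ge_eq: "j \<in> eq_idx P \<Longrightarrow> \<bar>f_of P j (ends (hor P) z)\<bar> \<le> penalty P z"
    and penalty_ge_mixed: "s \<in> mixed_idx P \<Longrightarrow> (LINT t|leb (hor P). max 0 (Xi_of P s (ev z t) t)) \<le> penalty P z"
proof -
  let ?a = "\<lambda>i. LINT t|leb (hor P). \<bar>dot (hor P) (fst z) t $ i - F_of P (ev z t) t $ i\<bar>"
  let ?b = "\<lambda>i. max 0 (f_of P i (ends (hor P) z))"
  let ?c = "\<lambda>j. \<bar>f_of P j (ends (hor P) z)\<bar>"
  let ?d = "\<lambda>s. LINT t|leb (hor P). max 0 (Xi_of P s (ev z t) t)"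
  have fin: "finite (ineq_idx P)" "finite (eq_idx P)" "finite (mixed_idx P)"
    by (auto simp: ineq_idx_def eq_idx_def mixed_idx_def)
  have p: "penalty P z = (\<Sum>i\<in>UNIV. ?a i) + sum ?b (ineq_idx P) + sum ?c (eq_idx P) + sum ?d (mixed_idx P)"
    by (simp add: penalty_def)
  have nn: "0 \<le> (\<Sum>i\<in>UNIV. ?a i)" "0 \<le> sum ?b (ineq_idx P)" "0 \<le> sum ?c (eq_idx P)" "0 \<le> sum ?d (mixed_idx P)"
    by (auto intro!: sum_nonneg)
  show "(\<Sum>i\<in>UNIV. ?a i) \<le> penalty P z" using p nn by linarith
  show "?b i \<le> penalty P z" if "i \<in> ineq_idx P" for i
  proof -
    have "?b i \<le> sum ?b (ineq_idx P)" using fin by (intro member_le_sum[OF that]) auto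
    then show ?thesis using p nn by linarith
  qed
  show "?c j \<le> penalty P z" if "j \<in> eq_idx P" for j
  proof -
    have "?c j \<le> sum ?c (eq_idx P)" using fin by (intro member_le_sum[OF that]) auto
    then show ?thesis using p nn by linarith
  qed
  show "?d s \<le> penalty P z" if "s \<in> mixed_idx P" for s
  proof -
    have "?d s \<le> sum ?d (mixed_idx P)" using fin by (intro member_le_sum[OF that]) auto
    then show ?thesis using p nn by linarith
  qed
qed

text \<open>The penalty sums the defect over components; the l1 norm dominates the Euclidean one,
  which turns this into control of the vector defect in the state estimate.\<close>

lemma defect_le_penalty:
  fixes P :: "('n::finite, 'm::finite) dc_problem"
  assumes data: "data_assumptions P" and z: "(x, u) \<in> Xspace (hor P)"
  shows "(LINT t|leb (hor P). norm (dot (hor P) x t - F_of P (x t, u t) t)) \<le> penalty P (x, u)"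
proof -
  let ?T = "hor P"
  have x: "x \<in> W1 ?T \<infinity>" and u: "u \<in> Lspace ?T \<infinity>" using z by (auto simp: Xspace_def)
  have i: "integrable (leb ?T) (\<lambda>t. dot ?T x t - F_of P (x t, u t) t)"
    by (intro Bochner_Integration.integrable_diff W1_integrable(2) W1_infinity_imp_W1_1 x u
        integrable_compose_pair(1)[OF locally_Lipschitz_F_of[OF data]] W1_Lspace_infinity[OF x])
  have c: "integrable (leb ?T) (\<lambda>t. \<bar>dot ?T x t $ i - F_of P (x t, u t) t $ i\<bar>)" for i
    using integrable_norm[OF integrable_bounded_linear[OF bounded_linear_vec_nth i]] by simp
  have "(LINT t|leb ?T. norm (dot ?T x t - F_of P (x t, u t) t)) \<le>
      (LINT t|leb ?T. (\<Sum>i\<in>UNIV. \<bar>dot ?T x t $ i - F_of P (x t, u t) t $ i\<bar>))"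
  proof (rule integral_mono)
    show "norm (dot ?T x t - F_of P (x t, u t) t) \<le> (\<Sum>i\<in>UNIV. \<bar>dot ?T x t $ i - F_of P (x t, u t) t $ i\<bar>)" for t
      using norm_le_l1_cart[of "dot ?T x t - F_of P (x t, u t) t"] by simp
  qed (use i c in auto)
  also have "\<dots> = (\<Sum>i\<in>UNIV. LINT t|leb ?T. \<bar>dot ?T x t $ i - F_of P (x t, u t) t $ i\<bar>)"
    using c by (rule Bochner_Integration.integral_sum)
  also have "\<dots> \<le> penalty P (x, u)"
    using penalty_ge_dynamics[of P "(x, u)"] by (simp add: ev_def)
  finally show ?thesis .
qed

text \<open>Stated for an arbitrary W^{1,1} limit, because feasibility is claimed of every limit
  point and not just of those constructed from initial values. Each violation at the limit is
  bounded by a penalty term plus an error that vanishes.\<close>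

theorem limit_feasible:
  fixes P :: "('n::finite, 'm::finite) dc_problem"
  assumes data: "data_assumptions P" and dom: "admissible_domain P"
    and z: "\<And>l. (x l, u l) \<in> dom_X0 P" and v: "v \<in> Lspace (hor P) \<infinity>"
    and xR: "\<And>l t. t \<in> {0..hor P} \<Longrightarrow> norm (x l t) \<le> R" and uR: "\<And>l. AE t in leb (hor P). norm (u l t) \<le> R"
    and ul: "(\<lambda>l. LINT t|leb (hor P). norm (u l t - v t)) \<longlonglongrightarrow> 0"
    and pen: "(\<lambda>l. penalty P (x l, u l)) \<longlonglongrightarrow> 0"
    and conv: "W1_converges (hor P) 1 x \<xi>"
  shows "\<xi> \<in> W1 (hor P) \<infinity>" and "feasible P (\<xi>, v)"
proof -
  let ?T = "hor P"
  have T: "0 < ?T" using data by (simp add: data_assumptions_def)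
  have zX: "(x l, u l) \<in> Xspace ?T" for l using dom z by (auto simp: admissible_domain_def)
  have xW: "x l \<in> W1 ?T 1" and xL: "x l \<in> Lspace ?T \<infinity>" and uL: "u l \<in> Lspace ?T \<infinity>" for l
    using zX[of l] W1_infinity_imp_W1_1 W1_Lspace_infinity by (auto simp: Xspace_def)
  have \<xi>1: "\<xi> \<in> W1 ?T 1" and W: "(\<lambda>l. W1norm ?T 1 (\<lambda>t. x l t - \<xi> t)) \<longlonglongrightarrow> 0"
    using conv by (auto simp: W1_converges_def)
  have \<xi>L: "\<xi> \<in> Lspace ?T \<infinity>" by (rule W1_Lspace_infinity[OF \<xi>1])
  have unif: "uniform_limit {0..?T} x \<xi> sequentially" by (rule W1_converges_imp_uniform_limit[OF T conv])
  have xl: "(\<lambda>l. LINT t|leb ?T. norm (x l t - \<xi> t)) \<longlonglongrightarrow> 0"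
    by (rule uniform_limit_L1_tendsto[OF T unif xL \<xi>L])
  have xAE: "AE t in leb ?T. norm (x l t) \<le> R" for l by (rule AE_I2) (simp add: xR)
  note F = locally_Lipschitz_F_of[OF data]
  have defect: "(\<lambda>l. LINT t|leb ?T. norm (dot ?T (x l) t - F_of P (x l t, u l t) t)) \<longlonglongrightarrow> 0"
    by (rule tendsto_sandwich[OF _ _ tendsto_const pen]) (auto intro!: always_eventually defect_le_penalty[OF data zX])
  have dl: "(\<lambda>l. LINT t|leb ?T. norm (dot ?T (x l) t - F_of P (\<xi> t, v t) t)) \<longlonglongrightarrow> 0"
    by (rule derivative_L1_tendsto[OF F xW \<xi>L uL v xAE uR xl ul defect])
  have FL: "(\<lambda>t. F_of P (\<xi> t, v t) t) \<in> Lspace ?T \<infinity>"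
    by (rule locally_Lipschitz_compose_Lspace[OF F integrable_compose_pair(2)[OF F \<xi>L v]])
  have d\<xi>: "(\<lambda>l. LINT t|leb ?T. norm (dot ?T (x l) t - dot ?T \<xi> t)) \<longlonglongrightarrow> 0"
  proof (rule tendsto_sandwich[OF _ _ tendsto_const W])
    show "\<forall>\<^sub>F l in sequentially. (LINT t|leb ?T. norm (dot ?T (x l) t - dot ?T \<xi> t)) \<le> W1norm ?T 1 (\<lambda>t. x l t - \<xi> t)"
      by (intro always_eventually allI) (simp add: W1norm_diff[OF T xW \<xi>1])
  qed simp
  \<comment> \<open>The derivative of \<xi> and F(\<xi>,v,t) are L^1 limits of the same sequence of
    derivatives, hence equal almost everywhere.\<close>
  have "(LINT t|leb ?T. norm (dot ?T \<xi> t - F_of P (\<xi> t, v t) t)) \<le> 0"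
  proof (rule LIMSEQ_le_const)
    show "(\<lambda>l. (LINT t|leb ?T. norm (dot ?T (x l) t - dot ?T \<xi> t)) +
        (LINT t|leb ?T. norm (dot ?T (x l) t - F_of P (\<xi> t, v t) t))) \<longlonglongrightarrow> 0"
      using tendsto_add[OF d\<xi> dl] by simp
    have "(LINT t|leb ?T. norm (dot ?T \<xi> t - F_of P (\<xi> t, v t) t)) \<le>
        (LINT t|leb ?T. norm (dot ?T \<xi> t - dot ?T (x l) t)) +
        (LINT t|leb ?T. norm (dot ?T (x l) t - F_of P (\<xi> t, v t) t))" for l
      by (intro L1_triangle W1_integrable(2) \<xi>1 xW Lspace_infinity_integrable FL)
    then show "\<exists>N. \<forall>l\<ge>N. (LINT t|leb ?T. norm (dot ?T \<xi> t - F_of P (\<xi> t, v t) t)) \<le>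
        (LINT t|leb ?T. norm (dot ?T (x l) t - dot ?T \<xi> t)) +
        (LINT t|leb ?T. norm (dot ?T (x l) t - F_of P (\<xi> t, v t) t))"
      by (simp add: norm_minus_commute)
  qed
  moreover have "integrable (leb ?T) (\<lambda>t. norm (dot ?T \<xi> t - F_of P (\<xi> t, v t) t))"
    by (intro integrable_norm Bochner_Integration.integrable_diff W1_integrable(2) \<xi>1 Lspace_infinity_integrable FL)
  ultimately have "AE t in leb ?T. norm (dot ?T \<xi> t - F_of P (\<xi> t, v t) t) = 0"
    by (subst integral_nonneg_eq_0_iff_AE[symmetric]) (auto intro: order_antisym)
  then have dyn: "AE t in leb ?T. dot ?T \<xi> t = F_of P (\<xi> t, v t) t" by eventually_elim simp
  have "dot ?T \<xi> \<in> Lspace ?T \<infinity>"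
  proof -
    obtain M where M: "AE t in leb ?T. norm (F_of P (\<xi> t, v t) t) \<le> M"
      using FL unfolding Lspace_infinity_iff by blast
    have "AE t in leb ?T. norm (dot ?T \<xi> t) \<le> M" using M dyn by eventually_elim simp
    then show ?thesis
      using borel_measurable_integrable[OF W1_integrable(2)[OF \<xi>1]] unfolding Lspace_infinity_iff by blast
  qed
  then show \<xi>W: "\<xi> \<in> W1 ?T \<infinity>" using \<xi>1 by (simp add: W1_def)
  \<comment> \<open>Closedness of X_0 is measured in the norm of Y but concerns points of X, so
    \<xi> had to be placed in W^{1,infinity} first.\<close>
  have "(\<xi>, v) \<in> dom_X0 P"
  proof -
    have "\<exists>w\<in>dom_X0 P. Ynorm ?T (pdiff w (\<xi>, v)) < e" if e: "e > 0" for e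
    proof -
      have "(\<lambda>l. W1norm ?T 1 (\<lambda>t. x l t - \<xi> t) + Lnorm ?T 1 (\<lambda>t. u l t - v t)) \<longlonglongrightarrow> 0"
        using tendsto_add[OF W ul] by (simp add: Lnorm_1)
      then have "\<forall>\<^sub>F l in sequentially. W1norm ?T 1 (\<lambda>t. x l t - \<xi> t) + Lnorm ?T 1 (\<lambda>t. u l t - v t) < e"
        using e by (rule order_tendstoD(2))
      then obtain l where l: "W1norm ?T 1 (\<lambda>t. x l t - \<xi> t) + Lnorm ?T 1 (\<lambda>t. u l t - v t) < e"
        by (auto simp: eventually_sequentially)
      have "Ynorm ?T (pdiff (x l, u l) (\<xi>, v)) < e" using l by (simp add: Ynorm_def lincomb_def)
      then show ?thesis using z by blast
    qed
    moreover have "(\<xi>, v) \<in> Xspace ?T" using \<xi>W v by (simp add: Xspace_def)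
    ultimately show ?thesis using dom by (simp add: admissible_domain_def)
  qed
  \<comment> \<open>Finite convex functions on a Euclidean space are continuous, and the end values
    converge by uniform convergence.\<close>
  moreover have ends: "(\<lambda>l. f_of P i (ends ?T (x l, u l))) \<longlonglongrightarrow> f_of P i (ends ?T (\<xi>, v))" if i: "i \<le> ell_E P" for i
  proof -
    have "convex_on UNIV (g_of P i)" "convex_on UNIV (h_of P i)" using data i by (auto simp: data_assumptions_def)
    then have c: "continuous_on UNIV (\<lambda>b. g_of P i b - h_of P i b)"
      by (intro continuous_on_diff convex_on_continuous) auto
    have "(\<lambda>l. ends ?T (x l, u l)) \<longlonglongrightarrow> ends ?T (\<xi>, v)"
      unfolding ends_def using T by (auto intro!: tendsto_Pair tendsto_uniform_limitI[OF unif])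
    then show ?thesis unfolding f_of_def by (rule continuous_on_tendsto_compose[OF c]) auto
  qed
  have IE: "ell_I P \<le> ell_E P" using data by (simp add: data_assumptions_def)
  have "f_of P i (ends ?T (\<xi>, v)) \<le> 0" if i: "i \<in> ineq_idx P" for i
  proof (rule LIMSEQ_le[OF ends pen])
    show "i \<le> ell_E P" using i IE by (simp add: ineq_idx_def)
    show "\<exists>N. \<forall>l\<ge>N. f_of P i (ends ?T (x l, u l)) \<le> penalty P (x l, u l)"
      using penalty_ge_ineq[OF i] by (metis max.boundedE)
  qed
  moreover have "f_of P j (ends ?T (\<xi>, v)) = 0" if j: "j \<in> eq_idx P" for j
  proof -
    have "(\<lambda>l. f_of P j (ends ?T (x l, u l))) \<longlonglongrightarrow> 0"
      by (rule Lim_null_comparison[OF _ pen]) (use penalty_ge_eq[OF j] in simp)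
    moreover have "j \<le> ell_E P" using j by (simp add: eq_idx_def)
    ultimately show ?thesis using LIMSEQ_unique[OF ends] by blast
  qed
  moreover have "AE t in leb ?T. Xi_of P s (\<xi> t, v t) t \<le> 0" if s: "s \<in> mixed_idx P" for s
  proof -
    note X = locally_Lipschitz_Xi_of[OF data s]
    have Xl: "(\<lambda>l. LINT t|leb ?T. norm (Xi_of P s (x l t, u l t) t - Xi_of P s (\<xi> t, v t) t)) \<longlonglongrightarrow> 0"
      by (rule compose_pair_L1_tendsto[OF X xL \<xi>L uL v xAE uR xl ul])
    have Xi: "integrable (leb ?T) (\<lambda>t. Xi_of P s (\<xi> t, v t) t)"
      "integrable (leb ?T) (\<lambda>t. Xi_of P s (x l t, u l t) t)" for l
      by (intro integrable_compose_pair(1)[OF X] xL \<xi>L uL v)+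
    \<comment> \<open>The positive part is 1-Lipschitz, so the violation at the limit exceeds that
      of an iterate by at most the L^1 distance of the two integrands.\<close>
    have "(LINT t|leb ?T. max 0 (Xi_of P s (\<xi> t, v t) t)) \<le> 0"
    proof (rule LIMSEQ_le_const)
      show "(\<lambda>l. penalty P (x l, u l) +
          (LINT t|leb ?T. norm (Xi_of P s (x l t, u l t) t - Xi_of P s (\<xi> t, v t) t))) \<longlonglongrightarrow> 0"
        using tendsto_add[OF pen Xl] by simp
      have "(LINT t|leb ?T. max 0 (Xi_of P s (\<xi> t, v t) t)) \<le> penalty P (x l, u l) +
          (LINT t|leb ?T. norm (Xi_of P s (x l t, u l t) t - Xi_of P s (\<xi> t, v t) t))" for l
      proof -
        have "(LINT t|leb ?T. max 0 (Xi_of P s (\<xi> t, v t) t)) \<le>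
          (LINT t|leb ?T. max 0 (Xi_of P s (x l t, u l t) t) +
             norm (Xi_of P s (x l t, u l t) t - Xi_of P s (\<xi> t, v t) t))"
          using Xi by (intro integral_mono) auto
        also have "\<dots> = (LINT t|leb ?T. max 0 (Xi_of P s (x l t, u l t) t)) +
             (LINT t|leb ?T. norm (Xi_of P s (x l t, u l t) t - Xi_of P s (\<xi> t, v t) t))"
          using Xi by (intro Bochner_Integration.integral_add) auto
        finally show ?thesis using penalty_ge_mixed[OF s, of "(x l, u l)"] by (simp add: ev_def)
      qed
      then show "\<exists>N. \<forall>l\<ge>N. (LINT t|leb ?T. max 0 (Xi_of P s (\<xi> t, v t) t)) \<le> penalty P (x l, u l) +
          (LINT t|leb ?T. norm (Xi_of P s (x l t, u l t) t - Xi_of P s (\<xi> t, v t) t))" by blast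
    qed
    moreover have mi: "integrable (leb ?T) (\<lambda>t. max 0 (Xi_of P s (\<xi> t, v t) t))" using Xi(1) by auto
    ultimately have "AE t in leb ?T. max 0 (Xi_of P s (\<xi> t, v t) t) = 0"
      by (subst integral_nonneg_eq_0_iff_AE[symmetric]) (auto intro: order_antisym)
    then show ?thesis by eventually_elim (simp add: max_def split: if_splits)
  qed
  ultimately show "feasible P (\<xi>, v)"
    unfolding feasible_def using dyn by (simp add: ev_def)
qed

section \<open>Subsequences generated by the method\<close>

text \<open>A new iterate is the accepted trial point of the line search, and all trial points lie
  in X_0.\<close>

lemma b_step_dca_in_domain:
  assumes "b_step_dca P A c z" shows "z k \<in> dom_X0 P"
proof (cases k)
  case 0
  then show ?thesis using assms by (simp add: b_step_dca_def)
next
  case (Suc k')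
  have "iteration P A k' (c k', z k') (c k, z k)" using assms Suc by (simp add: b_step_dca_def)
  then obtain y where "line_search P A (c k) (z k') y (z k)" unfolding iteration_def by auto
  then show ?thesis unfolding line_search_def by (auto simp: Let_def)
qed

theorem theorem5:
  fixes P :: "('n::finite, 'm::finite) dc_problem"
    and A :: step_params
    and c :: "nat \<Rightarrow> real"
    and x :: "nat \<Rightarrow> real \<Rightarrow> real^'n"
    and u :: "nat \<Rightarrow> real \<Rightarrow> real^'m"
    and r :: ennreal
    and \<rho> :: "nat \<Rightarrow> nat"
    and u_star :: "real \<Rightarrow> real^'m"
  assumes data: "data_assumptions P"
    and dom: "admissible_domain P"
    and run: "b_step_dca P A c (\<lambda>k. (x k, u k))"
    and r: "1 < r"
    and x_bounded: "\<exists>B. \<forall>k. x k \<in> W1 (hor P) r \<and> W1norm (hor P) r (x k) \<le> B"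
    and penalty_tends: "(\<lambda>k. penalty P (x k, u k)) \<longlonglongrightarrow> 0"
    and subseq: "strict_mono \<rho>"
    and u_bounded: "\<exists>B. \<forall>l. Lnorm (hor P) \<infinity> (u (\<rho> l)) \<le> B"
    and u_star: "u_star \<in> Lspace (hor P) \<infinity>"
    and u_tends: "(\<lambda>l. Lnorm (hor P) 1 (\<lambda>t. u (\<rho> l) t - u_star t)) \<longlonglongrightarrow> 0"
  shows "relatively_compact_W1 (hor P) 1 (range (\<lambda>l. x (\<rho> l))) \<and>
    (\<forall>x_star. limit_point_W1 (hor P) 1 (\<lambda>l. x (\<rho> l)) x_star \<longrightarrow>
       x_star \<in> W1 (hor P) \<infinity> \<and> feasible P (x_star, u_star)) \<and>
    ((\<exists>x0. \<forall>z. feasible P z \<longrightarrow> fst z 0 = x0) \<longrightarrow>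
       (\<exists>x_star. W1_converges (hor P) 1 (\<lambda>l. x (\<rho> l)) x_star))"
proof -
  let ?T = "hor P"
  have T: "0 < ?T" using data by (simp add: data_assumptions_def)
  define X where "X l = x (\<rho> l)" for l
  define U where "U l = u (\<rho> l)" for l
  have Z: "(X l, U l) \<in> dom_X0 P" for l unfolding X_def U_def using b_step_dca_in_domain[OF run] .
  have ZX: "(X l, U l) \<in> Xspace ?T" for l using dom Z by (auto simp: admissible_domain_def)
  have XW: "X l \<in> W1 ?T 1" and UL: "U l \<in> Lspace ?T \<infinity>" for l
    using ZX[of l] W1_infinity_imp_W1_1 by (auto simp: Xspace_def)
  \<comment> \<open>Essential boundedness of each derivative separately, with a bound that may
    depend on l; it supplies the integrability that \<open>LINT_le_Lnorm\<close> relies on.\<close>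
  have dotL: "dot ?T (X l) \<in> Lspace ?T \<infinity>" for l using ZX[of l] by (simp add: Xspace_def W1_def)
  obtain B where B: "\<And>k. W1norm ?T r (x k) \<le> B" using x_bounded by blast
  have nn: "0 \<le> Lnorm ?T r f" for f :: "real \<Rightarrow> real^'n" by (simp add: Lnorm_def)
  have XB: "Lnorm ?T r (X l) \<le> B" "Lnorm ?T r (dot ?T (X l)) \<le> B" for l
    using B[of "\<rho> l"] nn[of "X l"] nn[of "dot ?T (X l)"] by (auto simp: W1norm_def X_def)
  \<comment> \<open>The common L^1 bound that \<open>LINT_le_Lnorm\<close> gives for the
    trajectories and for their derivatives.\<close>
  define D where "D = ?T + ?T * \<bar>B\<bar> + \<bar>B\<bar> powr enn2real r"
  have Xb: "norm (X l t) \<le> D / ?T + D" if t: "t \<in> {0..?T}" for l t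
  proof -
    have "norm (X l t) \<le> (LINT r|leb ?T. norm (X l r)) / ?T + (LINT r|leb ?T. norm (dot ?T (X l) r))"
      by (rule W1_norm_le[OF T XW t])
    also have "\<dots> \<le> D / ?T + D"
      unfolding D_def using T
      by (intro add_mono divide_right_mono LINT_le_Lnorm[OF T _ r] XB dotL W1_Lspace_infinity[OF XW]) auto
    finally show ?thesis .
  qed
  obtain B' where B': "\<And>l. Lnorm ?T \<infinity> (U l) \<le> B'" using u_bounded unfolding U_def by blast
  \<comment> \<open>One radius for states and controls, as the stability results expect.\<close>
  define R where "R = max (D / ?T + D) B'"
  have XR: "norm (X l t) \<le> R" if "t \<in> {0..?T}" for l t using Xb[OF that, of l] by (simp add: R_def)
  have UR: "AE t in leb ?T. norm (U l t) \<le> R" for l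
    using AE_norm_le_Lnorm_infinity[OF UL[of l]]
  proof eventually_elim
    case (elim t)
    then show ?case using B'[of l] unfolding R_def by linarith
  qed
  have Ul: "(\<lambda>l. LINT t|leb ?T. norm (U l t - u_star t)) \<longlonglongrightarrow> 0" using u_tends by (simp add: Lnorm_1 U_def)
  have pen: "(\<lambda>l. penalty P (X l, U l)) \<longlonglongrightarrow> 0"
    using LIMSEQ_subseq_LIMSEQ[OF penalty_tends subseq] by (simp add: o_def X_def U_def)
  have defect: "(\<lambda>l. LINT t|leb ?T. norm (dot ?T (X l) t - F_of P (X l t, U l t) t)) \<longlonglongrightarrow> 0"
    by (rule tendsto_sandwich[OF _ _ tendsto_const pen]) (auto intro!: always_eventually defect_le_penalty[OF data ZX])
  \<comment> \<open>The initial value of the limit is recorded as well; it identifies p once the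
    limit is known to be feasible.\<close>
  have conv: "\<exists>\<xi>. W1_converges ?T 1 (X \<circ> \<tau>) \<xi> \<and> \<xi> 0 = p"
    if \<tau>: "strict_mono \<tau>" and p: "(\<lambda>l. X (\<tau> l) 0) \<longlonglongrightarrow> p" for \<tau> p
  proof -
    obtain \<xi> where "W1_converges ?T 1 (\<lambda>l. X (\<tau> l)) \<xi>" "\<xi> 0 = p"
    proof (rule W1_converges_of_initial_value[OF T locally_Lipschitz_F_of[OF data] XW UL u_star XR UR _ _ p])
      show "(\<lambda>l. LINT t|leb ?T. norm (U (\<tau> l) t - u_star t)) \<longlonglongrightarrow> 0"
        using LIMSEQ_subseq_LIMSEQ[OF Ul \<tau>] by (simp add: o_def)
      show "(\<lambda>l. LINT t|leb ?T. norm (dot ?T (X (\<tau> l)) t - F_of P (X (\<tau> l) t, U (\<tau> l) t) t)) \<longlonglongrightarrow> 0"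
        using LIMSEQ_subseq_LIMSEQ[OF defect \<tau>] by (simp add: o_def)
    qed
    then show ?thesis by (auto simp: o_def)
  qed
  have feas: "\<xi> \<in> W1 ?T \<infinity> \<and> feasible P (\<xi>, u_star)"
    if \<tau>: "strict_mono \<tau>" and c: "W1_converges ?T 1 (X \<circ> \<tau>) \<xi>" for \<tau> \<xi>
  proof -
    have u: "(\<lambda>l. LINT t|leb ?T. norm (U (\<tau> l) t - u_star t)) \<longlonglongrightarrow> 0"
      using LIMSEQ_subseq_LIMSEQ[OF Ul \<tau>] by (simp add: o_def)
    have p: "(\<lambda>l. penalty P (X (\<tau> l), U (\<tau> l))) \<longlonglongrightarrow> 0"
      using LIMSEQ_subseq_LIMSEQ[OF pen \<tau>] by (simp add: o_def)
    have c': "W1_converges ?T 1 (\<lambda>l. X (\<tau> l)) \<xi>" using c by (simp add: o_def)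
    show ?thesis
      using limit_feasible[OF data dom Z u_star XR UR u p c'] by blast
  qed
  have BW: "\<exists>\<sigma> p. strict_mono \<sigma> \<and> (\<lambda>l. X (\<tau> (\<sigma> l)) 0) \<longlonglongrightarrow> p" for \<tau> :: "nat \<Rightarrow> nat"
  proof -
    have "X (\<tau> l) 0 \<in> cball 0 R" for l using XR[of 0 "\<tau> l"] T by simp
    then obtain p \<sigma> where "strict_mono \<sigma>" "((\<lambda>l. X (\<tau> l) 0) \<circ> \<sigma>) \<longlonglongrightarrow> p"
      using seq_compactE[OF compact_imp_seq_compact[OF compact_cball], of "\<lambda>l. X (\<tau> l) 0" 0 R] by metis
    then show ?thesis by (auto simp: o_def)
  qed
  have "relatively_compact_W1 ?T 1 (range X)"
  proof (rule relatively_compact_W1_1I[OF T XW])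
    fix \<tau> :: "nat \<Rightarrow> nat" assume \<tau>: "strict_mono \<tau>"
    obtain \<sigma> p where \<sigma>: "strict_mono \<sigma>" "(\<lambda>l. X (\<tau> (\<sigma> l)) 0) \<longlonglongrightarrow> p" using BW by blast
    then obtain y where "W1_converges ?T 1 (X \<circ> (\<tau> \<circ> \<sigma>)) y"
      using conv[OF strict_mono_o[OF \<tau> \<sigma>(1)]] by auto
    then show "\<exists>\<sigma> y. strict_mono \<sigma> \<and> W1_converges ?T 1 (X \<circ> \<tau> \<circ> \<sigma>) y"
      using \<sigma>(1) unfolding o_assoc by blast
  qed
  moreover have "\<exists>\<xi>. W1_converges ?T 1 X \<xi>" if x0: "\<And>z. feasible P z \<Longrightarrow> fst z 0 = x0" for x0
  proof -
    \<comment> \<open>If the initial values did not tend to x0, some subsequence would stay away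
      from it. A further subsequence of trajectories converges, its limit is feasible, and so starts
      at x0: a contradiction.\<close>
    have "(\<lambda>l. X l 0) \<longlonglongrightarrow> x0"
    proof (rule ccontr)
      assume "\<not> (\<lambda>l. X l 0) \<longlonglongrightarrow> x0"
      then obtain e where e: "e > 0" "\<exists>\<^sub>F l in sequentially. dist (X l 0) x0 \<ge> e"
        by (auto simp: tendsto_iff frequently_def not_le)
      then obtain \<tau> :: "nat \<Rightarrow> nat" where \<tau>: "strict_mono \<tau>" "\<And>l. dist (X (\<tau> l) 0) x0 \<ge> e"
        using infinite_enumerate[of "{l. dist (X l 0) x0 \<ge> e}"]
        by (auto simp: frequently_cofinite[symmetric] cofinite_eq_sequentially)
      obtain \<sigma> p where \<sigma>: "strict_mono \<sigma>" "(\<lambda>l. X (\<tau> (\<sigma> l)) 0) \<longlonglongrightarrow> p" using BW by blast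
      have \<tau>\<sigma>: "strict_mono (\<tau> \<circ> \<sigma>)" by (rule strict_mono_o[OF \<tau>(1) \<sigma>(1)])
      obtain \<xi> where \<xi>: "W1_converges ?T 1 (X \<circ> (\<tau> \<circ> \<sigma>)) \<xi>" "\<xi> 0 = p"
        using conv[OF \<tau>\<sigma>] \<sigma>(2) by auto
      have "p = x0" using feas[OF \<tau>\<sigma> \<xi>(1)] x0[of "(\<xi>, u_star)"] \<xi>(2) by simp
      then have "\<forall>\<^sub>F l in sequentially. dist (X (\<tau> (\<sigma> l)) 0) x0 < e" using \<sigma>(2) e(1) by (simp add: tendstoD)
      then show False using \<tau>(2) by (auto simp: eventually_sequentially not_less[symmetric])
    qed
    \<comment> \<open>With convergent initial values the identity is an admissible choice of
      subsequence, so the whole sequence converges.\<close>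
    then show ?thesis using conv[OF strict_mono_id, of x0] by auto
  qed
  moreover have "\<forall>x_star. limit_point_W1 ?T 1 X x_star \<longrightarrow> x_star \<in> W1 ?T \<infinity> \<and> feasible P (x_star, u_star)"
    unfolding limit_point_W1_def using feas by blast
  moreover have "X = (\<lambda>l. x (\<rho> l))" by (simp add: fun_eq_iff X_def)
  ultimately show ?thesis by metis
qed

end
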